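(* With $\mathcal T(\xi;z)$ as defined in the context, $$[\mathcal T(q_1;z),\mathcal T(q_3;w)]=[\mathcal T(q_1^{-1};z),\mathcal T(q_3^{-1};w)]=0.$$
   Context: Parameters: $q,d\in\mathbb C$ with $q^nd^m\ne1$ for all integers $(n,m)\neq(0,0)$; $q_1=q^{-1}d$, $q_2=q^2$, $q_3=q^{-1}d^{-1}$ (so $q_1q_2q_3=1$); $\beta=-\log q_3/\log q_1$, so $q_3=q_1^{-\beta}$. Heisenberg algebra: generators $h^\perp_{i,n},Q_i^\perp$ ($i=1,2$, $n\in\mathbb Z$), $\mathsf a_0^\perp,\mathsf Q^\perp$ with $[h^\perp_{i,n},h^\perp_{i,m}]=n\delta_{n+m,0}$; $[h^\perp_{i,n},h^\perp_{j,m}]=-n\frac{q_1^n+q_3^n}{1+q_2^{-n}}\delta_{n+m,0}$ for $i\ne j$; $[h^\perp_{i,0},Q_i^\perp]=1$, $[h^\perp_{i,0},Q^\perp_j]=-1$ for $i\ne j$; $[\mathsf a_0^\perp,\mathsf Q^\perp]=\beta/2$; $h^\perp_{1,0}=-h^\perp_{2,0}$, $Q_1^\perp=-Q_2^\perp$; other commutators vanish. $:\ast:$ is the normal ordering (modes with $n<0$ and $Q_i^\perp,\mathsf Q^\perp$ to the left; modes with $n\ge 0$ and $\mathsf a_0^\perp$ to the right). For $i=1,2$, $$\Lambda_i^+(z)=:\exp\Big(-\sum_{n\ne0}\frac{q^n}{n}h^\perp_{i,n}z^{-n}\Big):e^{Q_i^\perp}(q^{-1}z)^{h^\perp_{i,0}}q_1^{\mathsf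 a_0^\perp},\qquad \Lambda_i^-(z)=:\exp\Big(\sum_{n\ne0}\frac{q^{-n}}{n}h^\perp_{i,n}z^{-n}\Big):e^{-Q_i^\perp}(qz)^{-h^\perp_{i,0}}q_1^{-\mathsf a_0^\perp}.$$ For $\xi\in\mathbb C\setminus\{0\}$, $$\mathcal T(\xi;z)=q:\Lambda_1^+(\xi z)\Lambda_2^+(z):+q^{-1}:\Lambda_1^-(\xi z)\Lambda_2^-(z):+z^2q(1-q_1\xi)(1-q_3\xi):\Lambda_1^+(\xi z)\Lambda_2^-(z):+z^2q^{-1}(1-q_1^{-1}\xi)(1-q_3^{-1}\xi):\Lambda_1^-(\xi z)\Lambda_2^+(z):.$$ The identity is between formal series in $z,w$ with operator coefficients. *)

theory Defs
  imports Complex_Main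
begin

section \<open>Parameters\<close>

text \<open>Non-vanishing of \<open>q\<close> and \<open>d\<close> is implicit on paper (negative powers occur), but has to be
  said here because \<open>0 powi n = 0\<close> for every \<open>n \<noteq> 0\<close>.\<close>

definition generic :: "complex \<Rightarrow> complex \<Rightarrow> bool" where
  "generic q d \<longleftrightarrow> q \<noteq> 0 \<and> d \<noteq> 0 \<and>
     (\<forall>n m :: int. (n, m) \<noteq> (0, 0) \<longrightarrow> q powi n * d powi m \<noteq> 1)"

definition q1 :: "complex \<Rightarrow> complex \<Rightarrow> complex" where "q1 q d = inverse q * d"
definition q2 :: "complex \<Rightarrow> complex \<Rightarrow> complex" where "q2 q d = q ^ 2"
definition q3 :: "complex \<Rightarrow> complex \<Rightarrow> complex" where "q3 q d = inverse q * inverse d"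


section \<open>Modules over the Heisenberg algebra\<close>

datatype idx = I1 | I2

text \<open>The operators by which the Heisenberg algebra acts on a complex vector space.
  If \<open>[h, Q] = c \<noteq> 0\<close> and \<open>h\<close> is diagonalizable, then \<open>Q\<close> itself cannot act on the space; as usual
  for lattice vertex operators it is the group-like elements \<open>e\<^sup>Q\<close> that act, and the relation
  \<open>[h, Q] = c\<close> becomes \<open>[h, e\<^sup>Q] = c e\<^sup>Q\<close>. The fields \<open>expQ\<close> and \<open>expQQ\<close> are the
  exponentials of \<open>Q\<^sub>i\<close> and of the generator conjugate to \<open>a\<^sub>0\<close> (the field \<open>azero\<close>).\<close>

record 'v heis_ops =
  smul :: "complex \<Rightarrow> 'v \<Rightarrow> 'v"
  hmode :: "idx \<Rightarrow> int \<Rightarrow> 'v \<Rightarrow> 'v"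
  expQ :: "idx \<Rightarrow> 'v \<Rightarrow> 'v"
  azero :: "'v \<Rightarrow> 'v"
  expQQ :: "'v \<Rightarrow> 'v"

definition comm :: "('v \<Rightarrow> 'v) \<Rightarrow> ('v \<Rightarrow> 'v) \<Rightarrow> 'v \<Rightarrow> 'v::ab_group_add" where
  "comm A B = (\<lambda>v. A (B v) - B (A v))"

text \<open>\<open>heis_pairing q d i j n\<close> is the scalar \<open>c\<close> in \<open>[h\<^bsub>i,n\<^esub>, h\<^bsub>j,m\<^esub>] = c \<delta>\<^bsub>n+m,0\<^esub>\<close>.\<close>

definition heis_pairing :: "complex \<Rightarrow> complex \<Rightarrow> idx \<Rightarrow> idx \<Rightarrow> int \<Rightarrow> complex" where
  "heis_pairing q d i j n =
     (if i = j then of_int n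
      else - of_int n * (q1 q d powi n + q3 q d powi n) / (1 + q2 q d powi (- n)))"

text \<open>The conditions \<open>smooth\<close>, \<open>h_integral\<close> and \<open>a_diagonal\<close> hold in Fock modules and are what gives
  the vertex operators below a meaning as formal Laurent series of operators: on every vector only
  finitely many monomials in annihilation modes are non-zero, \<open>z\<^sup>h\<close> involves integral powers
  of \<open>z\<close> only, and \<open>q\<^sub>1\<^sup>a\<close> can be evaluated on eigenvectors.
  For example, they and all relations hold on \<open>\<complex>[x\<^bsub>i,n\<^esub> | i = 1,2, n > 0] \<otimes> \<complex>[\<int> \<times> \<int>]\<close>, where
  \<open>h\<^bsub>i,-n\<^esub>\<close> is multiplication by \<open>x\<^bsub>i,n\<^esub>\<close>, \<open>h\<^bsub>i,n\<^esub>\<close> the corresponding first-order differential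
  operator, and on the lattice vector \<open>(k, l)\<close> the operators \<open>h\<^bsub>1,0\<^esub>\<close> and \<open>a\<^sub>0\<close> are
  the scalars \<open>k\<close> and \<open>\<mu> + l \<beta>/2\<close> (with \<open>\<mu>\<close> an arbitrary constant).\<close>

locale heisenberg_module =
  fixes q d \<beta> :: complex and H :: "'v::ab_group_add heis_ops"
  assumes vs: "vector_space (smul H)"
    and lin_h: "\<And>i n. Vector_Spaces.linear (smul H) (smul H) (hmode H i n)"
    and lin_Q: "\<And>i. Vector_Spaces.linear (smul H) (smul H) (expQ H i)"
    and lin_a: "Vector_Spaces.linear (smul H) (smul H) (azero H)"
    and lin_QQ: "Vector_Spaces.linear (smul H) (smul H) (expQQ H)"
    and bij_Q: "\<And>i. bij (expQ H i)"
    and bij_QQ: "bij (expQQ H)"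
    and h_h: "\<And>i j n m. comm (hmode H i n) (hmode H j m) =
                (\<lambda>v. smul H (if n + m = 0 then heis_pairing q d i j n else 0) v)"
    and h_Q: "\<And>i j n. comm (hmode H i n) (expQ H j) =
                (\<lambda>v. smul H (if n = 0 then (if i = j then 1 else -1) else 0) (expQ H j v))"
    and h_a: "\<And>i n. comm (hmode H i n) (azero H) = (\<lambda>v. 0)"
    and h_QQ: "\<And>i n. comm (hmode H i n) (expQQ H) = (\<lambda>v. 0)"
    and Q_Q: "\<And>i j. comm (expQ H i) (expQ H j) = (\<lambda>v. 0)"
    and Q_a: "\<And>i. comm (azero H) (expQ H i) = (\<lambda>v. 0)"
    and Q_QQ: "\<And>i. comm (expQ H i) (expQQ H) = (\<lambda>v. 0)"
    and a_QQ: "comm (azero H) (expQQ H) = (\<lambda>v. smul H (\<beta> / 2) (expQQ H v))"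
    and h1_h2: "\<And>v. hmode H I1 0 v = - hmode H I2 0 v"
    and Q1_Q2: "\<And>v. expQ H I1 (expQ H I2 v) = v"
    and smooth: "\<And>v. \<exists>N. \<forall>xs. (\<forall>(i, n) \<in> set xs. n > 0) \<and> sum_list (map snd xs) > N \<longrightarrow>
                   foldr (\<lambda>(i, n). hmode H i n) xs v = 0"
    and h_integral: "module.span (smul H) {v. \<exists>k :: int. hmode H I1 0 v = smul H (of_int k) v} = UNIV"
    and a_diagonal: "module.span (smul H) {v. \<exists>\<mu>. azero H v = smul H \<mu> v} = UNIV"


section \<open>Formal Laurent series of operators\<close>

text \<open>\<open>F k\<close> is the coefficient of \<open>z\<^sup>k\<close>; the series may be infinite in both directions.
  In a product, the sum defining a coefficient is evaluated vector by vector; in all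
  products formed below it has only finitely many non-zero terms.\<close>

type_synonym 'v oseries = "int \<Rightarrow> 'v \<Rightarrow> 'v"

definition oconst :: "('v \<Rightarrow> 'v) \<Rightarrow> 'v::ab_group_add oseries" where
  "oconst A = (\<lambda>k v. if k = 0 then A v else 0)"

definition omult :: "'v::ab_group_add oseries \<Rightarrow> 'v oseries \<Rightarrow> 'v oseries" (infixl "\<star>" 70) where
  "F \<star> G = (\<lambda>m v. \<Sum>k | F (m - k) (G k v) \<noteq> 0. F (m - k) (G k v))"

definition opower :: "'v::ab_group_add oseries \<Rightarrow> nat \<Rightarrow> 'v oseries" where
  "opower F n = ((\<lambda>G. F \<star> G) ^^ n) (oconst (\<lambda>v. v))"

definition oexp :: "'v::ab_group_add heis_ops \<Rightarrow> 'v oseries \<Rightarrow> 'v oseries" where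
  "oexp H F = (\<lambda>m v. \<Sum>n | opower F n m v \<noteq> 0. smul H (1 / fact n) (opower F n m v))"

text \<open>\<open>op_fun H A f\<close> is \<open>f(A)\<close> for a diagonalizable operator \<open>A\<close>.\<close>

definition op_fun :: "'v::ab_group_add heis_ops \<Rightarrow> ('v \<Rightarrow> 'v) \<Rightarrow> (complex \<Rightarrow> complex) \<Rightarrow> 'v \<Rightarrow> 'v" where
  "op_fun H A f = (THE F. Vector_Spaces.linear (smul H) (smul H) F \<and>
     (\<forall>\<mu> v. A v = smul H \<mu> v \<longrightarrow> F v = smul H (f \<mu>) v))"

text \<open>\<open>zpow H c A\<close> is the series \<open>(c z)\<^sup>A\<close> for a diagonalizable \<open>A\<close> with integral eigenvalues:
  the coefficient of \<open>z\<^sup>k\<close> is \<open>c\<^sup>k\<close> times the projection onto the \<open>k\<close>-eigenspace.\<close>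

definition zpow :: "'v::ab_group_add heis_ops \<Rightarrow> complex \<Rightarrow> ('v \<Rightarrow> 'v) \<Rightarrow> 'v oseries" where
  "zpow H c A = (\<lambda>k. op_fun H A (\<lambda>\<mu>. if \<mu> = of_int k then c powi k else 0))"

text \<open>\<open>modes H i S \<alpha> c\<close> is \<open>\<Sum>\<^bsub>n \<in> S\<^esub> \<alpha>\<^sub>n h\<^bsub>i,n\<^esub> (c z)\<^sup>-\<^sup>n\<close>.\<close>

definition modes :: "'v::ab_group_add heis_ops \<Rightarrow> idx \<Rightarrow> int set \<Rightarrow> (int \<Rightarrow> complex) \<Rightarrow> complex \<Rightarrow> 'v oseries"
where
  "modes H i S \<alpha> c = (\<lambda>k v. if - k \<in> S then smul H (\<alpha> (- k) * c powi k) (hmode H i (- k) v) else 0)"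


section \<open>Vertex operators and normal ordering\<close>

text \<open>A normally ordered expression is kept as the pair of its left half (modes with \<open>n < 0\<close> and
  \<open>e\<^sup>Q\<close>) and its right half (modes with \<open>n \<ge> 0\<close> and \<open>a\<^sub>0\<close>). Left halves commute with each other,
  and so do right halves; the normally ordered product multiplies the halves separately.\<close>

type_synonym 'v nordered = "'v oseries \<times> 'v oseries"

definition nmult :: "'v::ab_group_add nordered \<Rightarrow> 'v nordered \<Rightarrow> 'v nordered" where
  "nmult X Y = (fst X \<star> fst Y, snd X \<star> snd Y)"

definition nseries :: "'v::ab_group_add nordered \<Rightarrow> 'v oseries" where
  "nseries X = fst X \<star> snd X"

text \<open>\<open>Lambda_plus q l1 H i c\<close> and \<open>Lambda_minus q l1 H i c\<close> are \<open>\<Lambda>\<^sub>i\<^sup>+(c z)\<close> and \<open>\<Lambda>\<^sub>i\<^sup>-(c z)\<close>, where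
  \<open>l1\<close> is the chosen value of \<open>log q\<^sub>1\<close>, so that \<open>q\<^sub>1\<^sup>a = exp (l1 a)\<close>.\<close>

definition Lambda_plus ::
  "complex \<Rightarrow> complex \<Rightarrow> 'v::ab_group_add heis_ops \<Rightarrow> idx \<Rightarrow> complex \<Rightarrow> 'v nordered" where
  "Lambda_plus q l1 H i c =
     (let \<alpha> = (\<lambda>n. - (q powi n / of_int n)) in
      (oexp H (modes H i {..<0} \<alpha> c) \<star> oconst (expQ H i),
       oexp H (modes H i {0<..} \<alpha> c)
         \<star> (zpow H (inverse q * c) (hmode H i 0)
         \<star> oconst (op_fun H (azero H) (\<lambda>\<mu>. exp (l1 * \<mu>))))))"

definition Lambda_minus ::
  "complex \<Rightarrow> complex \<Rightarrow> 'v::ab_group_add heis_ops \<Rightarrow> idx \<Rightarrow> complex \<Rightarrow> 'v nordered" where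
  "Lambda_minus q l1 H i c =
     (let \<alpha> = (\<lambda>n. q powi (- n) / of_int n) in
      (oexp H (modes H i {..<0} \<alpha> c) \<star> oconst (inv (expQ H i)),
       oexp H (modes H i {0<..} \<alpha> c)
         \<star> (zpow H (q * c) (\<lambda>v. - hmode H i 0 v)
         \<star> oconst (op_fun H (azero H) (\<lambda>\<mu>. exp (- l1 * \<mu>))))))"

text \<open>The series \<open>T(\<xi>; z)\<close>; the index \<open>m - 2\<close> accounts for the factor \<open>z\<^sup>2\<close>.\<close>

definition Tcur ::
  "complex \<Rightarrow> complex \<Rightarrow> complex \<Rightarrow> 'v::ab_group_add heis_ops \<Rightarrow> complex \<Rightarrow> 'v oseries" where
  "Tcur q d l1 H \<xi> = (\<lambda>m v.
     (let Lp = Lambda_plus q l1 H; Lm = Lambda_minus q l1 H in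
        smul H q (nseries (nmult (Lp I1 \<xi>) (Lp I2 1)) m v)
      + smul H (inverse q) (nseries (nmult (Lm I1 \<xi>) (Lm I2 1)) m v)
      + smul H (q * (1 - q1 q d * \<xi>) * (1 - q3 q d * \<xi>))
          (nseries (nmult (Lp I1 \<xi>) (Lm I2 1)) (m - 2) v)
      + smul H (inverse q * (1 - inverse (q1 q d) * \<xi>) * (1 - inverse (q3 q d) * \<xi>))
          (nseries (nmult (Lm I1 \<xi>) (Lp I2 1)) (m - 2) v)))"

text \<open>The commutator \<open>[F(z), G(w)]\<close> as a formal series in two variables: the coefficient of
  \<open>z\<^sup>m w\<^sup>n\<close> is \<open>[F\<^sub>m, G\<^sub>n]\<close>.\<close>

definition oseries_comm :: "'v::ab_group_add oseries \<Rightarrow> 'v oseries \<Rightarrow> int \<Rightarrow> int \<Rightarrow> 'v \<Rightarrow> 'v" where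
  "oseries_comm F G = (\<lambda>m n. comm (F m) (G n))"

end

theory Submission
  imports Defs "HOL-Computational_Algebra.Formal_Power_Series"
begin

text \<open>
  \<^emph>\<open>Why the currents commute.\<close> Put \<open>\<sigma> = 1\<close> for the first commutator and \<open>\<sigma> = -1\<close> for the second, and
  write \<open>Q = q\<^sup>\<sigma>\<close>, \<open>D = d\<^sup>\<sigma>\<close>, \<open>\<xi> = D/Q\<close>, \<open>\<eta> = 1/(DQ)\<close>, so that the two arguments of \<open>T\<close> are
  \<open>\<xi>\<close> and \<open>\<eta>\<close>. At these values one of the four coefficients of \<open>T\<close> vanishes, and three summands
  remain, with the pairs of signs \<open>(\<sigma>, \<sigma>)\<close>, \<open>(-\<sigma>, -\<sigma>)\<close> and \<open>(\<sigma>, -\<sigma>)\<close>. Call them \<open>A\<^sub>1, A\<^sub>2, A\<^sub>3\<close>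
  in \<open>T(\<xi>; z)\<close> and \<open>B\<^sub>1, B\<^sub>2, B\<^sub>3\<close> in \<open>T(\<eta>; w)\<close>. In terms of \<open>Q, D\<close> and of signs relative to
  \<open>\<sigma>\<close> both commutators are given by the same formulas, so one computation covers them.

  Moving the annihilation half of \<open>A(z)\<close> past the creation half of \<open>B(w)\<close> gives
  \<open>A(z) B(w) = f(w/z) :A(z) B(w):\<close> (up to zero modes), where \<open>f\<close> is the exponential of a series of
  scalars. A single pair \<open>\<Lambda>\<^sub>1, \<Lambda>\<^sub>2\<close> contributes an infinite product because of the denominator
  \<open>1 + q\<^sub>2\<^sup>-\<^sup>n\<close> in the pairing, but for the nine products \<open>A\<^sub>i B\<^sub>j\<close> these combine to rational functions:
  \<^item> \<open>f = 1\<close> if \<open>i, j \<in> {1, 2}\<close>, hence \<open>[A\<^sub>i(z), B\<^sub>j(w)] = 0\<close>;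
  \<^item> for \<open>A\<^sub>3 B\<^sub>3\<close> it is a polynomial of degree 4, and with the factor \<open>z\<^sup>4\<close> from the zero modes it
    becomes symmetric under the exchange of the two operators, hence \<open>[A\<^sub>3(z), B\<^sub>3(w)] = 0\<close>;
  \<^item> if exactly one index is 3, then \<open>f(x) = (1 - ax)/(1 - bx)\<close>, and the product in the other order involves, up to zero
    modes, the expansion of the same rational function at infinity. The commutator is therefore a multiple of
    the delta series supported at \<open>w/z = p\<close> with \<open>p = 1/b\<close>, times the operator
    \<open>:A\<^sub>i(z) B\<^sub>j(p z):\<close>. Here \<open>p = 1\<close> when 1 is the other index and \<open>p = D\<^sup>2\<close> when it is 2.

  The residual commutators cancel in pairs: \<open>:A\<^sub>1(z) B\<^sub>3(z):\<close> equals \<open>:A\<^sub>3(z) B\<^sub>1(z):\<close>, because both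
  contain the same four factors, the two \<open>\<Lambda>\<^sub>2\<close> being exchanged; and \<open>:A\<^sub>2(z) B\<^sub>3(D\<^sup>2 z):\<close> equals
  \<open>:A\<^sub>3(z) B\<^sub>2(D\<^sup>2 z):\<close>, the two \<open>\<Lambda>\<^sub>1\<close> being exchanged, because \<open>D\<^sup>2 \<eta> = \<xi>\<close>. The scalar
  coefficients are opposite, which is where the coefficients of the third summand in \<open>T\<close> enter.

  \<^emph>\<open>How this becomes a statement about coefficients.\<close> The exponentials are handled through Euler's
  recursion \<open>n S\<^sub>n = \<Sum>\<^sub>k k x\<^sub>k S\<^bsub>n-k\<^esub>\<close> for \<open>exp (\<Sum> x\<^sub>k z\<^sup>k) = \<Sum> S\<^sub>n z\<^sup>n\<close>, which determines the \<open>S\<^sub>n\<close>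
  (\<open>expc_unique\<close>). Multiplicativity (\<open>expc_mult\<close>), the exchange rule (\<open>expc_contraction\<close>) and the
  evaluation of \<open>oexp\<close> (\<open>oexp_mode_series\<close>) all follow by checking that recursion. The vectors of
  integral charge, that is the eigenvectors of the mode \<open>h\<^bsub>1,0\<^esub>\<close>, span the module, and on such a vector the zero
  modes are scalars, shifts of the index and operators commuting with all oscillators
  (\<open>vpair_charge\<close>). What is left are oscillators only, for which \<open>vop_vop\<close> expresses a product by
  normally ordered products and \<open>vop2_fusion\<close> evaluates these at \<open>w = p z\<close>. The commutators are
  computed in \<open>comm_vpair_delta\<close> and \<open>comm_vpair_polynomial\<close>, the functions \<open>f\<close> in
  the lemmas \<open>contraction_pp_pm\<close> to \<open>contraction_pm_pm\<close>, and the cancellation takes place in \<open>comm_current_charge\<close>.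
\<close>

section \<open>Exponentials of operator-valued series\<close>

text \<open>If \<open>f\<close> is the coefficient sequence of a power series \<open>F(x)\<close> with constant term 1, this says that
  \<open>g\<close> consists of the coefficients of \<open>x F'(x) / F(x)\<close>, that is \<open>F(x) = exp (\<Sum> g\<^sub>n x\<^sup>n / n)\<close>. Sequences are
  indexed by integers and vanish at negative indices, so that the summation range in the recursion may be
  taken longer than necessary.\<close>

definition log_deriv_coeffs :: "(int \<Rightarrow> complex) \<Rightarrow> (int \<Rightarrow> complex) \<Rightarrow> bool" where
  "log_deriv_coeffs g f \<longleftrightarrow> (\<forall>n<0. f n = 0) \<and> f 0 = 1 \<and>
     (\<forall>N n. n \<le> N \<longrightarrow> of_int n * f n = (\<Sum>k\<in>{1..N}. g k * f (n - k)))"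

locale operator_calculus = vector_space scale
  for scale :: "complex \<Rightarrow> 'v::ab_group_add \<Rightarrow> 'v" (infixr "*s" 75)
begin

definition lin :: "('v \<Rightarrow> 'v) \<Rightarrow> bool" where
  "lin f \<longleftrightarrow> (\<forall>x y. f (x + y) = f x + f y) \<and> (\<forall>c x. f (c *s x) = c *s f x)"

lemma lin_iff_linear: "lin f \<longleftrightarrow> Vector_Spaces.linear scale scale f"
  unfolding lin_def Vector_Spaces.linear_iff using vector_space_axioms by blast

lemma lin_add: "lin f \<Longrightarrow> f (x + y) = f x + f y"
  and lin_scale: "lin f \<Longrightarrow> f (c *s x) = c *s f x"
  by (auto simp: lin_def)

lemma lin_zero: "lin f \<Longrightarrow> f 0 = 0"
  using lin_scale[of f 0 0] by simp

lemma lin_minus: "lin f \<Longrightarrow> f (- x) = - f x"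
  using lin_scale[of f "-1" x] by simp

lemma lin_diff: "lin f \<Longrightarrow> f (x - y) = f x - f y"
  using lin_add[of f x "- y"] by (simp add: lin_minus)

lemma lin_sum: "lin f \<Longrightarrow> f (\<Sum>i\<in>I. g i) = (\<Sum>i\<in>I. f (g i))"
  by (induction I rule: infinite_finite_induct) (auto simp: lin_zero lin_add)

lemma lin_compose: "lin f \<Longrightarrow> lin g \<Longrightarrow> lin (\<lambda>v. f (g v))"
  by (simp add: lin_def)

lemma lin_comb: "lin f \<Longrightarrow> lin g \<Longrightarrow> lin (\<lambda>v. f v + g v)"
  by (simp add: lin_def algebra_simps scale_right_distrib)

lemma lin_scaled: "lin f \<Longrightarrow> lin (\<lambda>v. c *s f v)"
  by (simp add: lin_def algebra_simps scale_right_distrib)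

lemma lin_0: "lin (\<lambda>v. 0)"
  by (simp add: lin_def)

lemma lin_id: "lin (\<lambda>v. v)"
  by (simp add: lin_def)

lemma lin_sum_op: "(\<And>i. i \<in> I \<Longrightarrow> lin (f i)) \<Longrightarrow> lin (\<lambda>v. \<Sum>i\<in>I. f i v)"
  by (induction I rule: infinite_finite_induct) (auto simp: lin_0 lin_comb)

lemmas lin_intros = lin_compose lin_comb lin_scaled lin_0 lin_id lin_sum_op

text \<open>The elementary Schur polynomials in the operators \<open>x\<^sub>1, x\<^sub>2, \<dots>\<close>: for commuting \<open>x\<^sub>k\<close> they are the
  coefficients of \<open>exp (\<Sum> x\<^sub>k z\<^sup>k)\<close>. They are defined by Euler's recursion, which comes from
  differentiating the exponential.\<close>

fun schur_poly :: "(int \<Rightarrow> 'v \<Rightarrow> 'v) \<Rightarrow> nat \<Rightarrow> 'v \<Rightarrow> 'v" where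
  "schur_poly x 0 v = v"
| "schur_poly x (Suc n) v = (1 / of_nat (Suc n)) *s
     (\<Sum>k\<le>n. of_nat (Suc k) *s x (int (Suc k)) (schur_poly x (n - k) v))"

text \<open>The extension by zero to negative indices lets convolutions range over any sufficiently large
  interval, so that index shifts under sums need no case distinctions.\<close>

definition expc :: "(int \<Rightarrow> 'v \<Rightarrow> 'v) \<Rightarrow> int \<Rightarrow> 'v \<Rightarrow> 'v" where
  "expc x n v = (if n < 0 then 0 else schur_poly x (nat n) v)"

lemma expc_neg: "n < 0 \<Longrightarrow> expc x n v = 0"
  and expc_0: "expc x 0 v = v"
  by (simp_all add: expc_def)

lemma expc_euler_exact:
  assumes "n > 0"
  shows "of_int n *s expc x n v = (\<Sum>k\<in>{1..n}. of_int k *s x k (expc x (n - k) v))"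
proof -
  obtain m where m: "n = int (Suc m)"
    using assms by (metis Suc_pred' zero_less_imp_eq_int)
  have "of_int n *s expc x n v
      = (\<Sum>k\<le>m. of_nat (Suc k) *s x (int (Suc k)) (schur_poly x (m - k) v))"
    by (simp add: expc_def m nat_add_distrib del: of_nat_Suc) 
  also have "\<dots> = (\<Sum>k\<in>{1..n}. of_int k *s x k (expc x (n - k) v))"
    by (rule sum.reindex_bij_witness[of _ "\<lambda>k. nat (k - 1)" "\<lambda>k. int (Suc k)"])
       (auto simp: m expc_def nat_diff_distrib' simp flip: of_nat_diff)
  finally show ?thesis .
qed

lemma expc_euler:
  assumes "\<And>k. k > 0 \<Longrightarrow> lin (x k)" and "n \<le> N"
  shows "of_int n *s expc x n v = (\<Sum>k\<in>{1..N}. of_int k *s x k (expc x (n - k) v))"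
proof -
  have "(\<Sum>k\<in>{1..N}. of_int k *s x k (expc x (n - k) v))
      = (\<Sum>k\<in>{1..n}. of_int k *s x k (expc x (n - k) v))"
    using assms by (intro sum.mono_neutral_right) (auto simp: expc_neg lin_zero)
  also have "\<dots> = of_int n *s expc x n v"
  proof (cases "n > 0")
    case False
    then show ?thesis by (cases "n = 0") (auto simp: expc_neg)
  qed (simp add: expc_euler_exact)
  finally show ?thesis ..
qed

text \<open>The recursion has only one solution with a given initial value. Identities between exponentials are
  proved below by checking that both sides solve the same recursion.\<close>

lemma expc_unique:
  assumes neg: "\<And>n. n < 0 \<Longrightarrow> G n = 0" and zero: "G 0 = w"
    and euler: "\<And>n. n > 0 \<Longrightarrow> of_int n *s G n = (\<Sum>k\<in>{1..n}. of_int k *s x k (G (n - k)))"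
  shows "G n = expc x n w"
proof -
  have "G (int m) = expc x (int m) w" for m
  proof (induction m rule: less_induct)
    case (less m)
    show ?case
    proof (cases "m = 0")
      case True
      then show ?thesis by (simp add: expc_0 zero)
    next
      case False
      have "G (int m - k) = expc x (int m - k) w" if "k \<in> {1..int m}" for k
        using less[of "nat (int m - k)"] that False by auto
      then have "(\<Sum>k\<in>{1..int m}. of_int k *s x k (G (int m - k)))
          = (\<Sum>k\<in>{1..int m}. of_int k *s x k (expc x (int m - k) w))"
        by (intro sum.cong) auto
      with False have "of_int (int m) *s G (int m) = of_int (int m) *s expc x (int m) w"
        using euler[of "int m"] expc_euler_exact[of "int m" x w] by (simp only: of_nat_0_less_iff)
      then show ?thesis using False by (simp only: scale_cancel_left) simp
    qed
  qed
  from this[of "nat n"] show ?thesis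
    by (cases "n < 0") (auto simp: neg expc_neg)
qed

lemma lin_expc:
  assumes "\<And>k. k > 0 \<Longrightarrow> lin (x k)"
  shows "lin (expc x n)"
proof -
  have "lin (schur_poly x m)" for m
  proof (induction m rule: less_induct)
    case (less m)
    show ?case
    proof (cases m)
      case (Suc l)
      have "lin (\<lambda>v. (1 / of_nat (Suc l)) *s
          (\<Sum>k\<le>l. of_nat (Suc k) *s x (int (Suc k)) (schur_poly x (l - k) v)))"
      proof (rule lin_scaled, rule lin_sum_op, rule lin_scaled)
        fix k assume "k \<in> {..l}"
        have "lin (x (int (Suc k)))" "lin (schur_poly x (l - k))" using assms less Suc by simp_all
        then show "lin (\<lambda>v. x (int (Suc k)) (schur_poly x (l - k) v))" by (rule lin_compose)
      qed
      moreover have "schur_poly x (Suc l) = (\<lambda>v. (1 / of_nat (Suc l)) *s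
          (\<Sum>k\<le>l. of_nat (Suc k) *s x (int (Suc k)) (schur_poly x (l - k) v)))"
        by (rule ext) simp
      ultimately show ?thesis using Suc by simp
    qed (simp add: lin_def)
  qed
  then show ?thesis by (auto simp: expc_def lin_def)
qed

lemma expc_cong:
  assumes "\<And>k v. k > 0 \<Longrightarrow> x k v = y k v"
  shows "expc x n v = expc y n v"
  by (rule expc_unique) (auto simp: expc_neg expc_0 expc_euler_exact assms intro!: sum.cong)

lemma expc_commute:
  assumes "lin T" and "\<And>k v. k > 0 \<Longrightarrow> T (x k v) = x k (T v)"
  shows "T (expc x n v) = expc x n (T v)"
proof (rule expc_unique)
  fix n :: int assume n: "n > 0"
  have "of_int n *s T (expc x n v) = T (of_int n *s expc x n v)"
    using assms by (simp add: lin_scale)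
  also have "\<dots> = (\<Sum>k\<in>{1..n}. of_int k *s x k (T (expc x (n - k) v)))"
    using n assms by (auto simp: expc_euler_exact lin_sum lin_scale intro!: sum.cong)
  finally show "of_int n *s T (expc x n v) = \<dots>" .
qed (use assms in \<open>auto simp: expc_neg expc_0 lin_zero\<close>)

lemma expc_scale:
  assumes "\<And>k. k > 0 \<Longrightarrow> lin (x k)" and "p \<noteq> 0"
  shows "expc (\<lambda>k v. p powi k *s x k v) n v = p powi n *s expc x n v"
proof (rule expc_unique[symmetric])
  fix n :: int assume n: "n > 0"
  have "of_int n *s p powi n *s expc x n v = p powi n *s of_int n *s expc x n v"
    by (simp add: mult.commute)
  also have "\<dots> = (\<Sum>k\<in>{1..n}. p powi n *s of_int k *s x k (expc x (n - k) v))"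
    by (simp add: expc_euler_exact[OF n] scale_sum_right)
  also have "\<dots> = (\<Sum>k\<in>{1..n}. of_int k *s p powi k *s x k (p powi (n - k) *s expc x (n - k) v))"
    using assms by (intro sum.cong refl) (auto simp: lin_scale power_int_diff)
  finally show "of_int n *s p powi n *s expc x n v
      = (\<Sum>k\<in>{1..n}. of_int k *s p powi k *s x k (p powi (n - k) *s expc x (n - k) v))" .
qed (auto simp: expc_neg expc_0)

lemma sum_int_shift:
  fixes f :: "int \<Rightarrow> 'v" and k n :: int
  assumes "\<And>i. i < 0 \<Longrightarrow> f i = 0" and "k \<ge> 0"
  shows "(\<Sum>i\<in>{0..n}. f (i - k)) = (\<Sum>i\<in>{0..n - k}. f i)"
proof -
  have "(\<Sum>i\<in>{0..n}. f (i - k)) = (\<Sum>i\<in>{-k..n - k}. f i)"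
    by (rule sum.reindex_bij_witness[of _ "\<lambda>i. i + k" "\<lambda>i. i - k"]) auto
  also have "\<dots> = (\<Sum>i\<in>{0..n - k}. f i)"
    using assms by (intro sum.mono_neutral_right) auto
  finally show ?thesis .
qed

text \<open>Both sides have logarithmic derivative \<open>\<Sum> k (x\<^sub>k + y\<^sub>k) z\<^sup>k\<close>: in the convolution on the right one splits
  \<open>n = i + (n - i)\<close> and applies the recursion of the first factor to \<open>i\<close> and that of the second factor
  to \<open>n - i\<close>.\<close>

lemma expc_mult:
  assumes x: "\<And>k. k > 0 \<Longrightarrow> lin (x k)" and y: "\<And>k. k > 0 \<Longrightarrow> lin (y k)"
    and comm: "\<And>j k v. j > 0 \<Longrightarrow> k > 0 \<Longrightarrow> x j (y k v) = y k (x j v)"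
  shows "expc (\<lambda>k v. x k v + y k v) n v = (\<Sum>i\<in>{0..n}. expc x i (expc y (n - i) v))"
proof (rule expc_unique[symmetric])
  fix n :: int assume n: "n > 0"
  define G where "G n = (\<Sum>i\<in>{0..n}. expc x i (expc y (n - i) v))" for n
  have X: "lin (expc x i)" for i by (rule lin_expc) (rule x)
  have xy: "expc x i (y k v) = y k (expc x i v)" if "k > 0" for i k v
    using that by (intro expc_commute[symmetric] y) (auto simp: comm)
  have 1: "(\<Sum>i\<in>{0..n}. of_int i *s expc x i (expc y (n - i) v))
         = (\<Sum>k\<in>{1..n}. of_int k *s x k (G (n - k)))"
  proof -
    have "(\<Sum>i\<in>{0..n}. of_int i *s expc x i (expc y (n - i) v))
        = (\<Sum>i\<in>{0..n}. \<Sum>k\<in>{1..n}. of_int k *s x k (expc x (i - k) (expc y (n - i) v)))"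
      by (intro sum.cong refl expc_euler) (auto simp: x)
    also have "\<dots> = (\<Sum>k\<in>{1..n}. of_int k *s x k (\<Sum>i\<in>{0..n}. expc x (i - k) (expc y (n - k - (i - k)) v)))"
      by (subst sum.swap) (auto simp: lin_sum x scale_sum_right intro!: sum.cong)
    also have "\<dots> = (\<Sum>k\<in>{1..n}. of_int k *s x k (G (n - k)))"
      by (intro sum.cong refl, subst sum_int_shift) (auto simp: expc_neg G_def)
    finally show ?thesis .
  qed
  have 2: "(\<Sum>i\<in>{0..n}. expc x i (of_int (n - i) *s expc y (n - i) v))
         = (\<Sum>k\<in>{1..n}. of_int k *s y k (G (n - k)))"
  proof -
    have "(\<Sum>i\<in>{0..n}. expc x i (of_int (n - i) *s expc y (n - i) v))
        = (\<Sum>i\<in>{0..n}. expc x i (\<Sum>k\<in>{1..n}. of_int k *s y k (expc y (n - i - k) v)))"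
      by (intro sum.cong refl arg_cong[of _ _ "expc x _"] expc_euler) (auto simp: y)
    also have "\<dots> = (\<Sum>i\<in>{0..n}. \<Sum>k\<in>{1..n}. of_int k *s y k (expc x i (expc y (n - i - k) v)))"
      by (auto simp: lin_sum[OF X] lin_scale[OF X] xy intro!: sum.cong)
    also have "\<dots> = (\<Sum>k\<in>{1..n}. of_int k *s y k (\<Sum>i\<in>{0..n}. expc x i (expc y (n - i - k) v)))"
      by (subst sum.swap) (auto simp: lin_sum y scale_sum_right intro!: sum.cong)
    also have "\<dots> = (\<Sum>k\<in>{1..n}. of_int k *s y k (G (n - k)))"
    proof (intro sum.cong refl arg_cong[of _ _ "\<lambda>w. _ *s y _ w"])
      fix k assume k: "k \<in> {1..n}"
      show "(\<Sum>i\<in>{0..n}. expc x i (expc y (n - i - k) v)) = G (n - k)"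
        unfolding G_def using k
        by (intro sum.mono_neutral_cong_right)
           (auto simp: expc_neg lin_zero[OF X] algebra_simps)
    qed
    finally show ?thesis .
  qed
  have "of_int n *s G n = (\<Sum>i\<in>{0..n}. of_int i *s expc x i (expc y (n - i) v)
                             + expc x i (of_int (n - i) *s expc y (n - i) v))"
    by (simp add: G_def scale_sum_right lin_scale[OF X] flip: scale_left_distrib)
  also have "\<dots> = (\<Sum>k\<in>{1..n}. of_int k *s (x k (G (n - k)) + y k (G (n - k))))"
    by (simp add: sum.distrib 1 2 scale_right_distrib del: of_int_diff)
  finally show "of_int n *s (\<Sum>i\<in>{0..n}. expc x i (expc y (n - i) v))
      = (\<Sum>k\<in>{1..n}. of_int k *s (x k (\<Sum>i\<in>{0..n - k}. expc x i (expc y (n - k - i) v))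
                                  + y k (\<Sum>i\<in>{0..n - k}. expc x i (expc y (n - k - i) v))))"
    by (simp add: G_def)
qed (auto simp: expc_neg expc_0)

lemma expc_expc_commute:
  assumes x: "\<And>k. k > 0 \<Longrightarrow> lin (x k)" and y: "\<And>k. k > 0 \<Longrightarrow> lin (y k)"
    and comm: "\<And>j k v. j > 0 \<Longrightarrow> k > 0 \<Longrightarrow> x j (y k v) = y k (x j v)"
  shows "expc x a (expc y b v) = expc y b (expc x a v)"
  by (intro expc_commute lin_expc x expc_commute[symmetric] y) (auto simp: comm)

text \<open>The commutator of \<open>T\<close> with a function of the \<open>y\<^sub>k\<close> is \<open>c\<close> times its derivative
  \<open>\<partial>/\<partial>y\<^sub>n\<close>, and \<open>\<partial>/\<partial>y\<^sub>n\<close> multiplies \<open>exp (\<Sum> y\<^sub>k w\<^sup>k)\<close> by \<open>w\<^sup>n\<close>.\<close>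

lemma mode_expc_contraction:
  assumes T: "lin T" and n: "n > 0" and y: "\<And>k. k > 0 \<Longrightarrow> lin (y k)"
    and yy: "\<And>j k v. j > 0 \<Longrightarrow> k > 0 \<Longrightarrow> y j (y k v) = y k (y j v)"
    and comm: "\<And>m v. m > 0 \<Longrightarrow> T (y m v) = y m (T v) + (if m = n then c else 0) *s v"
  shows "T (expc y b v) = expc y b (T v) + c *s expc y (b - n) v"
proof -
  have yexp: "y k (expc y b v) = expc y b (y k v)" if "k > 0" for k b v
    using that by (intro expc_commute y) (auto simp: yy)
  have "T (expc y b v) - c *s expc y (b - n) v = expc y b (T v)"
  proof (rule expc_unique)
    fix b :: int assume b: "b > 0"
    have "of_int b *s T (expc y b v) = T (of_int b *s expc y b v)"
      by (simp add: lin_scale[OF T])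
    also have "\<dots> = (\<Sum>k\<in>{1..b}. of_int k *s T (y k (expc y (b - k) v)))"
      by (simp add: expc_euler_exact[OF b] lin_sum[OF T] lin_scale[OF T])
    also have "\<dots> = (\<Sum>k\<in>{1..b}. of_int k *s y k (T (expc y (b - k) v)))
        + (\<Sum>k\<in>{1..b}. (if k = n then of_int n * c else 0) *s expc y (b - k) v)"
      by (auto simp: comm scale_right_distrib simp flip: sum.distrib intro!: sum.cong)
    also have "(\<Sum>k\<in>{1..b}. (if k = n then of_int n * c else 0) *s expc y (b - k) v)
        = (\<Sum>k\<in>{1..b}. if k = n then (of_int n * c) *s expc y (b - n) v else 0)"
      by (intro sum.cong) auto
    also have "\<dots> = (of_int n * c) *s expc y (b - n) v"
      using n by (auto simp: sum.delta expc_neg)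
    finally have A: "of_int b *s T (expc y b v)
      = (\<Sum>k\<in>{1..b}. of_int k *s y k (T (expc y (b - k) v))) + (of_int n * c) *s expc y (b - n) v" .
    have "of_int (b - n) *s expc y (b - n) v
        = (\<Sum>k\<in>{1..b}. of_int k *s y k (expc y (b - n - k) v))"
      using n y by (intro expc_euler) auto
    then have "c *s of_int (b - n) *s expc y (b - n) v
        = (\<Sum>k\<in>{1..b}. of_int k *s y k (c *s expc y (b - k - n) v))"
      using y by (auto simp: scale_sum_right lin_scale algebra_simps intro!: sum.cong)
    then have B: "of_int b *s c *s expc y (b - n) v
        = (\<Sum>k\<in>{1..b}. of_int k *s y k (c *s expc y (b - k - n) v)) + (of_int n * c) *s expc y (b - n) v"
      by (simp add: scale_left_diff_distrib scale_right_diff_distrib algebra_simps)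
    have "of_int b *s (T (expc y b v) - c *s expc y (b - n) v)
       = (\<Sum>k\<in>{1..b}. of_int k *s y k (T (expc y (b - k) v)))
         - (\<Sum>k\<in>{1..b}. of_int k *s y k (c *s expc y (b - k - n) v))"
      unfolding scale_right_diff_distrib A B by simp
    also have "\<dots> = (\<Sum>k\<in>{1..b}. of_int k *s y k (T (expc y (b - k) v) - c *s expc y (b - k - n) v))"
      using y by (auto simp: lin_diff scale_right_diff_distrib simp flip: sum_subtractf intro!: sum.cong)
    finally show "of_int b *s (T (expc y b v) - c *s expc y (b - n) v) = \<dots>" .
  qed (use n in \<open>auto simp: expc_neg expc_0 lin_zero[OF T]\<close>)
  then show ?thesis by (simp add: algebra_simps)
qed

text \<open>The exchange rule \<open>exp X exp Y = exp [X, Y] exp Y exp X\<close> for a scalar commutator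
  \<open>[X, Y] = \<Sum> c\<^sub>n (w/z)\<^sup>n\<close>, where \<open>X = \<Sum> x\<^sub>n z\<^sup>-\<^sup>n\<close> and \<open>Y = \<Sum> y\<^sub>n w\<^sup>n\<close>; the sequence \<open>f\<close> consists of the
  coefficients of \<open>exp [X, Y]\<close>. As a function of \<open>a\<close> the right-hand side satisfies the recursion of
  \<open>exp X\<close>: with \<open>a = (a - k) + k\<close>, the part \<open>a - k\<close> produces the terms in which \<open>x\<^sub>n\<close> stands behind
  \<open>exp Y\<close>, and the part \<open>k\<close>, by the recursion for \<open>f\<close>, those that arise when \<open>x\<^sub>n\<close> is moved past
  \<open>exp Y\<close>.\<close>

lemma expc_contraction:
  assumes x: "\<And>k. k > 0 \<Longrightarrow> lin (x k)" and y: "\<And>k. k > 0 \<Longrightarrow> lin (y k)"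
    and yy: "\<And>j k v. j > 0 \<Longrightarrow> k > 0 \<Longrightarrow> y j (y k v) = y k (y j v)"
    and comm: "\<And>n m v. n > 0 \<Longrightarrow> m > 0 \<Longrightarrow>
                 x n (y m v) = y m (x n v) + (if m = n then c n else 0) *s v"
    and f: "log_deriv_coeffs (\<lambda>n. of_int n * c n) f"
  shows "expc x a (expc y b v) = (\<Sum>k\<in>{0..b}. f k *s expc y (b - k) (expc x (a - k) v))"
proof (rule expc_unique[symmetric])
  have fneg: "f n = 0" if "n < 0" for n using f that by (simp add: log_deriv_coeffs_def)
  have f0: "f 0 = 1" using f by (simp add: log_deriv_coeffs_def)
  have frec: "of_int n * f n = (\<Sum>k\<in>{1..N}. of_int k * c k * f (n - k))" if "n \<le> N" for n N
    using f that by (simp add: log_deriv_coeffs_def)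
  have Y: "lin (expc y i)" for i by (rule lin_expc) (rule y)
  have xY: "x n (expc y b v) = expc y b (x n v) + c n *s expc y (b - n) v" if "n > 0" for n b v
    using that by (intro mode_expc_contraction x y yy comm)
  show "(\<Sum>k\<in>{0..b}. f k *s expc y (b - k) (expc x (0 - k) v)) = expc y b v"
    proof (cases "b < 0")
      case False
      then have "(\<Sum>k\<in>{0..b}. f k *s expc y (b - k) (expc x (0 - k) v))
          = (\<Sum>k\<in>{0}. f k *s expc y (b - k) (expc x (0 - k) v))"
        by (intro sum.mono_neutral_right) (auto simp: expc_neg lin_zero[OF Y])
      then show ?thesis by (simp add: f0 expc_0)
    qed (simp add: expc_neg)
  show "of_int a *s (\<Sum>k\<in>{0..b}. f k *s expc y (b - k) (expc x (a - k) v))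
      = (\<Sum>n\<in>{1..a}. of_int n *s x n (\<Sum>k\<in>{0..b}. f k *s expc y (b - k) (expc x (a - n - k) v)))"
    if a: "a > 0" for a
  proof -
    define W where "W k = expc y (b - k) (expc x (a - k) v)" for k
    have "of_int a *s (\<Sum>k\<in>{0..b}. f k *s W k)
       = (\<Sum>k\<in>{0..b}. f k *s expc y (b - k) (of_int (a - k) *s expc x (a - k) v))
         + (\<Sum>k\<in>{0..b}. (of_int k * f k) *s W k)"
      by (simp only: sum.distrib[symmetric] scale_sum_right W_def lin_scale[OF Y] scale_scale
               scale_left_distrib[symmetric]) (simp add: algebra_simps)
    also have "(\<Sum>k\<in>{0..b}. f k *s expc y (b - k) (of_int (a - k) *s expc x (a - k) v))
       = (\<Sum>k\<in>{0..b}. f k *s expc y (b - k) (\<Sum>n\<in>{1..a}. of_int n *s x n (expc x (a - k - n) v)))"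
      using x by (intro sum.cong refl, subst expc_euler[of x _ a]) auto
    also have "\<dots> = (\<Sum>k\<in>{0..b}. \<Sum>n\<in>{1..a}. (of_int n * f k) *s expc y (b - k) (x n (expc x (a - n - k) v)))"
      by (auto simp: lin_sum[OF Y] lin_scale[OF Y] scale_sum_right algebra_simps intro!: sum.cong)
    also have "\<dots> = (\<Sum>n\<in>{1..a}. \<Sum>k\<in>{0..b}. (of_int n * f k) *s expc y (b - k) (x n (expc x (a - n - k) v)))"
      by (rule sum.swap)
    also have "(\<Sum>k\<in>{0..b}. (of_int k * f k) *s W k)
       = (\<Sum>k\<in>{0..b}. \<Sum>n\<in>{1..a}. (of_int n * c n * f (k - n)) *s W k)"
    proof (intro sum.cong refl)
      fix k
      show "(of_int k * f k) *s W k = (\<Sum>n\<in>{1..a}. (of_int n * c n * f (k - n)) *s W k)"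
      proof (cases "k \<le> a")
        case True
        then show ?thesis by (simp add: frec[of k a] scale_sum_left)
      next
        case False
        then show ?thesis by (simp add: W_def expc_neg lin_zero[OF Y])
      qed
    qed
    also have "\<dots> = (\<Sum>n\<in>{1..a}. \<Sum>k\<in>{0..b}. (of_int n * c n * f (k - n)) *s W (k - n + n))"
      by (subst sum.swap) simp
    also have "\<dots> = (\<Sum>n\<in>{1..a}. \<Sum>k\<in>{0..b}. (of_int n * c n * f k) *s W (k + n))"
    proof (rule sum.cong[OF refl])
      fix n assume n: "n \<in> {1..a}"
      have "(\<Sum>k\<in>{0..b}. (of_int n * c n * f (k - n)) *s W (k - n + n))
          = (\<Sum>k\<in>{0..b - n}. (of_int n * c n * f k) *s W (k + n))"
        using n by (intro sum_int_shift) (auto simp: fneg)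
      also have "\<dots> = (\<Sum>k\<in>{0..b}. (of_int n * c n * f k) *s W (k + n))"
        using n by (intro sum.mono_neutral_left) (auto simp: W_def expc_neg)
      finally show "(\<Sum>k\<in>{0..b}. (of_int n * c n * f (k - n)) *s W (k - n + n)) = \<dots>" .
    qed
    also have "(\<Sum>n\<in>{1..a}. \<Sum>k\<in>{0..b}. (of_int n * f k) *s expc y (b - k) (x n (expc x (a - n - k) v)))
        + \<dots> = (\<Sum>n\<in>{1..a}. of_int n *s x n (\<Sum>k\<in>{0..b}. f k *s expc y (b - k) (expc x (a - n - k) v)))"
      unfolding sum.distrib[symmetric]
    proof (intro sum.cong refl)
      fix n assume n: "n \<in> {1..a}"
      then have "lin (x n)" using x by simp
      then have "of_int n *s x n (\<Sum>k\<in>{0..b}. f k *s expc y (b - k) (expc x (a - n - k) v))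
          = (\<Sum>k\<in>{0..b}. (of_int n * f k) *s x n (expc y (b - k) (expc x (a - n - k) v)))"
        by (simp add: lin_sum lin_scale scale_sum_right)
      also have "\<dots> = (\<Sum>k\<in>{0..b}. (of_int n * f k) *s expc y (b - k) (x n (expc x (a - n - k) v)) +
                  (of_int n * c n * f k) *s W (k + n))"
        using n by (auto simp: xY W_def scale_right_distrib algebra_simps intro!: sum.cong)
      finally show "(\<Sum>k\<in>{0..b}. (of_int n * f k) *s expc y (b - k) (x n (expc x (a - n - k) v)) +
                  (of_int n * c n * f k) *s W (k + n))
         = of_int n *s x n (\<Sum>k\<in>{0..b}. f k *s expc y (b - k) (expc x (a - n - k) v))" ..
    qed
    finally show ?thesis unfolding W_def .
  qed
qed (auto simp: expc_neg lin_zero[OF lin_expc[of y]] y)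

end


section \<open>Functions of diagonalizable operators\<close>

context operator_calculus
begin

text \<open>Prescribe \<open>F\<close> on a basis of eigenvectors. An arbitrary eigenvector is a combination of those basis
  vectors that have the same eigenvalue, so \<open>F\<close> is correct on it as well.\<close>

lemma diagonal_function_exists:
  assumes A: "lin A" and diag: "span {v. \<exists>\<mu>. A v = \<mu> *s v} = UNIV"
  shows "\<exists>F. lin F \<and> (\<forall>\<mu> v. A v = \<mu> *s v \<longrightarrow> F v = f \<mu> *s v)"
proof -
  interpret vector_space_pair scale scale ..
  obtain B where B: "B \<subseteq> {v. \<exists>\<mu>. A v = \<mu> *s v}" "independent B"
      "{v. \<exists>\<mu>. A v = \<mu> *s v} \<subseteq> span B"
    using maximal_independent_subset by blast
  have spanB: "span B = UNIV"
    using span_mono[OF B(3)] by (simp add: diag span_span top.extremum_unique)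
  have "\<forall>b\<in>B. \<exists>\<mu>. A b = \<mu> *s b" using B(1) by blast
  then obtain m where m: "\<And>b. b \<in> B \<Longrightarrow> A b = m b *s b" by metis
  define F where "F = construct B (\<lambda>b. f (m b) *s b)"
  have F: "lin F" unfolding lin_iff_linear F_def by (rule linear_construct) (rule B(2))
  have Fb: "F b = f (m b) *s b" if "b \<in> B" for b
    unfolding F_def by (rule construct_basis) (use B(2) that in auto)
  have "F v = f \<mu> *s v" if v: "A v = \<mu> *s v" for \<mu> v
  proof -
    define r where "r = representation B v"
    define C where "C = {b. r b \<noteq> 0}"
    have C: "finite C" "C \<subseteq> B" unfolding C_def r_def
      by (auto simp: finite_representation dest: representation_ne_zero)
    have vr: "v = (\<Sum>b\<in>C. r b *s b)"
      unfolding C_def r_def by (rule sum_nonzero_representation_eq[symmetric]) (auto simp: B(2) spanB)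
    have "0 = A v - \<mu> *s v" using v by simp
    also have "\<dots> = (\<Sum>b\<in>C. (r b * (m b - \<mu>)) *s b)"
      using C unfolding vr
      by (auto simp: lin_sum[OF A] lin_scale[OF A] m subset_iff scale_sum_right algebra_simps
            simp flip: sum_subtractf intro!: sum.cong)
    finally have "r b * (m b - \<mu>) = 0" if "b \<in> C" for b
      using B(2) C that independentD[of B C "\<lambda>b. r b * (m b - \<mu>)" b] by auto
    then have mC: "m b = \<mu>" if "b \<in> C" for b
      using that by (auto simp: C_def)
    have "F v = (\<Sum>b\<in>C. r b *s F b)" by (simp add: vr lin_sum[OF F] lin_scale[OF F])
    also have "\<dots> = (\<Sum>b\<in>C. f \<mu> *s r b *s b)"
      using C mC by (intro sum.cong) (auto simp: Fb subset_iff mult.commute)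
    also have "\<dots> = f \<mu> *s v" unfolding vr by (simp add: scale_sum_right)
    finally show ?thesis .
  qed
  with F show ?thesis by blast
qed

lemma lin_eq_on_span:
  assumes "lin F" "lin G" "\<And>v. v \<in> S \<Longrightarrow> F v = G v" "span S = UNIV"
  shows "F v = G v"
proof -
  have "v \<in> span S" by (simp add: assms)
  then show ?thesis
    by (induction rule: span_induct_alt)
       (simp_all add: assms lin_zero lin_add lin_scale)
qed

end


locale heis_space = operator_calculus "smul H" for H :: "'v::ab_group_add heis_ops"
begin

abbreviation scal (infixr "*s" 75) where "scal \<equiv> smul H"

text \<open>The description that defines \<open>op_fun\<close> has exactly one solution, because linear maps that agree on a
  spanning set are equal.\<close>

lemma op_fun_diagonal:
  assumes A: "lin A" and diag: "span {v. \<exists>\<mu>. A v = \<mu> *s v} = UNIV"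
  shows lin_op_fun: "lin (op_fun H A f)"
    and op_fun_eigen: "A v = \<mu> *s v \<Longrightarrow> op_fun H A f v = f \<mu> *s v"
proof -
  let ?P = "\<lambda>F. lin F \<and> (\<forall>\<mu> v. A v = \<mu> *s v \<longrightarrow> F v = f \<mu> *s v)"
  obtain F where F: "?P F" using diagonal_function_exists[OF A diag] by blast
  have unique: "G = F" if "?P G" for G
  proof
    show "G v = F v" for v
      by (rule lin_eq_on_span[of G F "{v. \<exists>\<mu>. A v = \<mu> *s v}"]) (use that F diag in \<open>auto, metis\<close>)
  qed
  have eq: "op_fun H A f = F"
    unfolding op_fun_def lin_iff_linear[symmetric]
  proof (rule the_equality[of ?P])
    show "?P F" by (rule F)
    show "G = F" if "?P G" for G using that by (rule unique)
  qed
  show "lin (op_fun H A f)" "A v = \<mu> *s v \<Longrightarrow> op_fun H A f v = f \<mu> *s v"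
    unfolding eq using F by blast+
qed

lemma op_fun_commute:
  assumes A: "lin A" and diag: "span {v. \<exists>\<mu>. A v = \<mu> *s v} = UNIV"
    and T: "lin T" and TA: "\<And>v. T (A v) = A (T v)"
  shows "T (op_fun H A f v) = op_fun H A f (T v)"
proof -
  note F = lin_op_fun[OF A diag, of f]
  have "T (op_fun H A f v) = op_fun H A f (T v)" if "v \<in> {v. \<exists>\<mu>. A v = \<mu> *s v}" for v
  proof -
    obtain \<mu> where \<mu>: "A v = \<mu> *s v" using \<open>v \<in> _\<close> by blast
    then have \<mu>': "A (T v) = \<mu> *s T v" using TA[of v] lin_scale[OF T] by simp
    show ?thesis
      by (simp add: op_fun_eigen[OF A diag \<mu>] op_fun_eigen[OF A diag \<mu>'] lin_scale[OF T])
  qed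
  from lin_eq_on_span[of "\<lambda>v. T (op_fun H A f v)" "\<lambda>v. op_fun H A f (T v)", OF _ _ this diag]
  show ?thesis by (simp add: lin_compose F T)
qed

end


section \<open>Products of operator series\<close>

lemma omult_eval:
  assumes "finite K" "\<And>k. F (m - k) (G k v) \<noteq> 0 \<Longrightarrow> k \<in> K"
  shows "(F \<star> G) m v = (\<Sum>k\<in>K. F (m - k) (G k v))"
  unfolding omult_def using assms by (intro sum.mono_neutral_left) auto

lemma omult_single:
  assumes "\<And>k. k \<noteq> k0 \<Longrightarrow> F (m - k) (G k v) = 0"
  shows "(F \<star> G) m v = F (m - k0) (G k0 v)"
  by (subst omult_eval[of "{k0}"]) (use assms in auto)

context operator_calculus
begin

lemma lin_omult:
  assumes F: "\<And>k. lin (F k)" and G: "\<And>k. lin (G k)"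
    and fin: "\<And>v. finite {k. F (m - k) (G k v) \<noteq> 0}"
  shows "lin ((F \<star> G) m)"
  unfolding lin_def
proof (intro conjI allI)
  fix v w
  let ?K = "{k. F (m - k) (G k v) \<noteq> 0} \<union> {k. F (m - k) (G k w) \<noteq> 0}"
  have "(F \<star> G) m (v + w) = (\<Sum>k\<in>?K. F (m - k) (G k (v + w)))"
    by (rule omult_eval) (auto simp: fin lin_add[OF F] lin_add[OF G])
  also have "\<dots> = (F \<star> G) m v + (F \<star> G) m w"
    by (subst (1 2) omult_eval[where K = ?K])
       (auto simp: fin lin_add[OF F] lin_add[OF G] sum.distrib)
  finally show "(F \<star> G) m (v + w) = (F \<star> G) m v + (F \<star> G) m w" .
next
  fix c v
  let ?K = "{k. F (m - k) (G k v) \<noteq> 0}"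
  have "(F \<star> G) m (c *s v) = (\<Sum>k\<in>?K. F (m - k) (G k (c *s v)))"
    by (rule omult_eval) (auto simp: fin lin_scale[OF F] lin_scale[OF G])
  also have "\<dots> = c *s (F \<star> G) m v"
    by (subst omult_eval[where K = ?K])
       (auto simp: fin lin_scale[OF F] lin_scale[OF G] scale_sum_right)
  finally show "(F \<star> G) m (c *s v) = c *s (F \<star> G) m v" .
qed

text \<open>Creation modes come with positive powers of \<open>z\<close> and annihilation modes with negative ones; the sign
  \<open>\<epsilon>\<close> (1 or -1) of the exponents makes one argument serve for both.\<close>

definition mode_series :: "int \<Rightarrow> (int \<Rightarrow> 'v \<Rightarrow> 'v) \<Rightarrow> 'v oseries" where
  "mode_series \<epsilon> x = (\<lambda>m v. if \<epsilon> * m > 0 then x (\<epsilon> * m) v else 0)"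

lemma mode_series_apply:
  "mode_series \<epsilon> x m v = (if \<epsilon> * m > 0 then x (\<epsilon> * m) v else 0)"
  by (simp add: mode_series_def)

text \<open>The coefficient of \<open>z\<^sup>j\<close> in the \<open>n\<close>-th power of \<open>\<Sum> x\<^sub>k z\<^sup>k\<close>, the sum running over \<open>k > 0\<close>.\<close>

fun power_coeff :: "(int \<Rightarrow> 'v \<Rightarrow> 'v) \<Rightarrow> nat \<Rightarrow> int \<Rightarrow> 'v \<Rightarrow> 'v" where
  "power_coeff x 0 j v = (if j = 0 then v else 0)"
| "power_coeff x (Suc n) j v = (\<Sum>k\<in>{1..j}. x k (power_coeff x n (j - k) v))"

lemma power_coeff_eq_0:
  assumes "\<And>k. k > 0 \<Longrightarrow> lin (x k)"
  shows "j < int n \<Longrightarrow> power_coeff x n j v = 0"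
proof (induction n arbitrary: j)
  case (Suc n)
  then show ?case by (auto simp: lin_zero assms intro!: sum.neutral)
qed simp

lemma power_coeff_neg: "j < 0 \<Longrightarrow> power_coeff x n j v = 0"
  by (cases n) auto

lemma opower_mode_series:
  assumes x: "\<And>k. k > 0 \<Longrightarrow> lin (x k)" and \<epsilon>: "\<epsilon> = 1 \<or> \<epsilon> = -1"
  shows "opower (mode_series \<epsilon> x) n m v = power_coeff x n (\<epsilon> * m) v"
proof (induction n arbitrary: m)
  case 0
  then show ?case using \<epsilon> by (auto simp: opower_def oconst_def)
next
  case (Suc n)
  have \<epsilon>\<epsilon>: "\<epsilon> * (\<epsilon> * y) = y" for y using \<epsilon> by auto
  let ?K = "(\<lambda>i. m - \<epsilon> * i) ` {1..\<epsilon> * m}"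
  have "opower (mode_series \<epsilon> x) (Suc n) m v
      = (mode_series \<epsilon> x \<star> opower (mode_series \<epsilon> x) n) m v"
    by (simp add: opower_def)
  also have "\<dots> = (\<Sum>k\<in>?K. mode_series \<epsilon> x (m - k) (opower (mode_series \<epsilon> x) n k v))"
  proof (rule omult_eval)
    fix k assume nz: "mode_series \<epsilon> x (m - k) (opower (mode_series \<epsilon> x) n k v) \<noteq> 0"
    then have "\<epsilon> * (m - k) > 0" by (auto simp: mode_series_apply split: if_splits)
    moreover have "\<epsilon> * k \<ge> 0"
    proof (rule ccontr)
      assume "\<not> \<epsilon> * k \<ge> 0"
      then have "opower (mode_series \<epsilon> x) n k v = 0" by (simp add: Suc power_coeff_neg)
      with nz show False by (auto simp: mode_series_apply lin_zero x split: if_splits)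
    qed
    ultimately have "\<epsilon> * (m - k) \<in> {1..\<epsilon> * m}" by (auto simp: algebra_simps)
    moreover have "k = m - \<epsilon> * (\<epsilon> * (m - k))" by (simp add: \<epsilon>\<epsilon>)
    ultimately show "k \<in> ?K" by blast
  qed auto
  also have "\<dots> = (\<Sum>i\<in>{1..\<epsilon> * m}. x i (power_coeff x n (\<epsilon> * m - i) v))"
  proof (subst sum.reindex)
    show "inj_on (\<lambda>i. m - \<epsilon> * i) {1..\<epsilon> * m}" using \<epsilon> by (auto simp: inj_on_def)
    show "sum ((\<lambda>k. mode_series \<epsilon> x (m - k) (opower (mode_series \<epsilon> x) n k v)) \<circ> (\<lambda>i. m - \<epsilon> * i)) {1..\<epsilon> * m}
      = (\<Sum>i\<in>{1..\<epsilon> * m}. x i (power_coeff x n (\<epsilon> * m - i) v))"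
      by (rule sum.cong) (auto simp: Suc mode_series_apply \<epsilon>\<epsilon> right_diff_distrib)
  qed
  finally show ?case by simp
qed

text \<open>The coefficientwise form of \<open>z (X\<^sup>n\<^sup>+\<^sup>1)' = (n + 1) (z X') X\<^sup>n\<close>; here the \<open>x\<^sub>k\<close> have to commute with
  each other.\<close>

lemma power_coeff_euler:
  assumes x: "\<And>k. k > 0 \<Longrightarrow> lin (x k)"
    and xx: "\<And>j k v. j > 0 \<Longrightarrow> k > 0 \<Longrightarrow> x j (x k v) = x k (x j v)"
  shows "of_int j *s power_coeff x (Suc n) j v
       = of_nat (Suc n) *s (\<Sum>k\<in>{1..j}. of_int k *s x k (power_coeff x n (j - k) v))"
proof (induction n arbitrary: j)
  case 0
  show ?case by (auto simp: scale_sum_right lin_zero x intro!: sum.cong)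
next
  case (Suc n)
  let ?p = "power_coeff x"
  have ext: "(\<Sum>i\<in>{1..j - k}. of_int i *s x i (?p n (j - k - i) v))
      = (\<Sum>i\<in>{1..j}. of_int i *s x i (?p n (j - k - i) v))" if "k > 0" for k
    using that by (intro sum.mono_neutral_left) (auto simp: power_coeff_neg lin_zero x)
  have ext': "(\<Sum>k\<in>{1..j}. x k (?p n (j - i - k) v)) = ?p (Suc n) (j - i) v" if "i > 0" for i
    using that by (simp, intro sum.mono_neutral_right) (auto simp: power_coeff_neg lin_zero x)
  have "of_int j *s ?p (Suc (Suc n)) j v
      = (\<Sum>k\<in>{1..j}. of_int k *s x k (?p (Suc n) (j - k) v))
        + (\<Sum>k\<in>{1..j}. x k (of_int (j - k) *s ?p (Suc n) (j - k) v))"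
    by (subst power_coeff.simps(2))
       (auto simp: scale_sum_right lin_scale x simp flip: sum.distrib scale_left_distrib
             simp del: power_coeff.simps intro!: sum.cong)
  also have "(\<Sum>k\<in>{1..j}. x k (of_int (j - k) *s ?p (Suc n) (j - k) v))
      = (\<Sum>k\<in>{1..j}. x k (of_nat (Suc n) *s (\<Sum>i\<in>{1..j}. of_int i *s x i (?p n (j - k - i) v))))"
    by (auto simp: Suc ext simp del: power_coeff.simps of_int_diff of_nat_Suc intro!: sum.cong)
  also have "\<dots> = (\<Sum>k\<in>{1..j}. \<Sum>i\<in>{1..j}. of_nat (Suc n) *s of_int i *s x i (x k (?p n (j - i - k) v)))"
    by (auto simp: lin_scale lin_sum x scale_sum_right xx algebra_simps
             simp del: power_coeff.simps of_nat_Suc intro!: sum.cong)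
  also have "\<dots> = of_nat (Suc n) *s (\<Sum>i\<in>{1..j}. of_int i *s x i (\<Sum>k\<in>{1..j}. x k (?p n (j - i - k) v)))"
    by (subst sum.swap) (auto simp: lin_sum x scale_sum_right
             simp del: power_coeff.simps of_nat_Suc intro!: sum.cong)
  also have "(\<Sum>i\<in>{1..j}. of_int i *s x i (\<Sum>k\<in>{1..j}. x k (?p n (j - i - k) v)))
     = (\<Sum>i\<in>{1..j}. of_int i *s x i (?p (Suc n) (j - i) v))"
    by (intro sum.cong refl) (auto simp: ext' simp del: power_coeff.simps)
  finally show ?case
    by (simp add: of_nat_Suc[of "Suc n"] scale_left_distrib del: power_coeff.simps of_nat_Suc)
qed

lemma sum_power_coeff:
  assumes x: "\<And>k. k > 0 \<Longrightarrow> lin (x k)"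
    and xx: "\<And>j k v. j > 0 \<Longrightarrow> k > 0 \<Longrightarrow> x j (x k v) = x k (x j v)"
  shows "(\<Sum>n | power_coeff x n j v \<noteq> 0. (1 / fact n) *s power_coeff x n j v) = expc x j v"
proof (rule expc_unique)
  \<comment> \<open>Every factor raises the degree by at least one, so the powers beyond the degree drop out.\<close>
  have bound: "(\<Sum>n | power_coeff x n j v \<noteq> 0. (1 / fact n) *s power_coeff x n j v)
      = (\<Sum>n\<le>J. (1 / fact n) *s power_coeff x n j v)" if "j \<le> int J" for j J
  proof (rule sum.mono_neutral_left)
    show "{n. power_coeff x n j v \<noteq> 0} \<subseteq> {..J}"
      using that power_coeff_eq_0[of x j] x by (auto simp: not_le) (meson leI not_le of_nat_less_iff order_le_less_trans)
  qed auto
  fix j :: int assume j: "j > 0"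
  define J where "J = nat j - 1"
  have J: "j = int (Suc J)" using j by (simp add: J_def)
  have "of_int j *s (\<Sum>n | power_coeff x n j v \<noteq> 0. (1 / fact n) *s power_coeff x n j v)
      = (\<Sum>n\<le>Suc J. (1 / fact n) *s of_int j *s power_coeff x n j v)"
    by (subst bound[of j "Suc J"]) (auto simp: J scale_sum_right mult.commute simp del: of_nat_Suc power_coeff.simps sum.atMost_Suc)
  also have "\<dots> = (\<Sum>n\<le>J. (1 / fact (Suc n)) *s of_int j *s power_coeff x (Suc n) j v)"
    using j by (subst sum.atMost_Suc_shift) (simp del: power_coeff.simps(2))
  also have "\<dots> = (\<Sum>n\<le>J. (1 / fact n) *s (\<Sum>k\<in>{1..j}. of_int k *s x k (power_coeff x n (j - k) v)))"
    by (intro sum.cong refl) (simp add: power_coeff_euler x xx del: power_coeff.simps of_nat_Suc)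
  also have "\<dots> = (\<Sum>k\<in>{1..j}. of_int k *s x k (\<Sum>n\<le>J. (1 / fact n) *s power_coeff x n (j - k) v))"
    unfolding scale_sum_right
    by (subst sum.swap) (auto simp: x lin_sum lin_scale scale_sum_right algebra_simps intro!: sum.cong)
  also have "\<dots> = (\<Sum>k\<in>{1..j}. of_int k *s x k
      (\<Sum>n | power_coeff x n (j - k) v \<noteq> 0. (1 / fact n) *s power_coeff x n (j - k) v))"
    using J by (intro sum.cong refl, subst bound[of _ J]) auto
  finally show "of_int j *s (\<Sum>n | power_coeff x n j v \<noteq> 0. (1 / fact n) *s power_coeff x n j v) = \<dots>" .
next
  have "{n. power_coeff x n 0 v \<noteq> 0} \<subseteq> {0}"
    using power_coeff_eq_0[of x 0] x by (auto simp: not_le)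
  then have "(\<Sum>n | power_coeff x n 0 v \<noteq> 0. (1 / fact n) *s power_coeff x n 0 v)
      = (\<Sum>n\<in>{0}. (1 / fact n) *s power_coeff x n 0 v)"
    by (intro sum.mono_neutral_left) auto
  then show "(\<Sum>n | power_coeff x n 0 v \<noteq> 0. (1 / fact n) *s power_coeff x n 0 v) = v" by simp
qed (simp add: power_coeff_neg)

end

text \<open>Since every mode carries a non-zero power of \<open>z\<close>, only finitely many powers contribute to a given
  coefficient, so the exponential of a series of modes is given by Schur polynomials.\<close>

lemma (in heis_space) oexp_mode_series:
  assumes x: "\<And>k. k > 0 \<Longrightarrow> lin (x k)"
    and xx: "\<And>j k v. j > 0 \<Longrightarrow> k > 0 \<Longrightarrow> x j (x k v) = x k (x j v)"
    and \<epsilon>: "\<epsilon> = 1 \<or> \<epsilon> = -1"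
  shows "oexp H (mode_series \<epsilon> x) m v = expc x (\<epsilon> * m) v"
  using sum_power_coeff[of x] assms by (simp add: oexp_def opower_mode_series)


section \<open>Exponentials of Heisenberg modes\<close>

sublocale heisenberg_module \<subseteq> heis_space H
  by (simp add: heis_space_def operator_calculus_def vs)

type_synonym mode_coeffs = "idx \<Rightarrow> int \<Rightarrow> complex"

text \<open>The effect of the substitution \<open>z \<mapsto> p z\<close> on the coefficient of \<open>h\<^bsub>i,n\<^esub> z\<^sup>-\<^sup>n\<close>.\<close>

definition dilate :: "complex \<Rightarrow> mode_coeffs \<Rightarrow> mode_coeffs" where
  "dilate p \<rho> = (\<lambda>i n. p powi (- n) * \<rho> i n)"

definition add_coeffs :: "mode_coeffs \<Rightarrow> mode_coeffs \<Rightarrow> mode_coeffs" where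
  "add_coeffs \<alpha> \<rho> = (\<lambda>i n. \<alpha> i n + \<rho> i n)"

text \<open>The commutator of \<open>\<Sum>\<^sub>i \<alpha>\<^bsub>i,n\<^esub> h\<^bsub>i,n\<^esub>\<close> with \<open>\<Sum>\<^sub>i \<rho>\<^bsub>i,-n\<^esub> h\<^bsub>i,-n\<^esub>\<close>.\<close>

definition coeff_pairing :: "complex \<Rightarrow> complex \<Rightarrow> mode_coeffs \<Rightarrow> mode_coeffs \<Rightarrow> int \<Rightarrow> complex" where
  "coeff_pairing q d \<alpha> \<rho> n =
     \<alpha> I1 n * \<rho> I1 (- n) * heis_pairing q d I1 I1 n + \<alpha> I1 n * \<rho> I2 (- n) * heis_pairing q d I1 I2 n
   + \<alpha> I2 n * \<rho> I1 (- n) * heis_pairing q d I2 I1 n + \<alpha> I2 n * \<rho> I2 (- n) * heis_pairing q d I2 I2 n"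

context heisenberg_module
begin

lemma lin_hmode: "lin (hmode H i n)"
  and lin_expQ: "lin (expQ H i)"
  and lin_azero: "lin (azero H)"
  by (simp_all add: lin_iff_linear lin_h lin_Q lin_a)

lemma hmode_commutator:
  "hmode H i n (hmode H j m v) = hmode H j m (hmode H i n v)
     + (if n + m = 0 then heis_pairing q d i j n else 0) *s v"
  using fun_cong[OF h_h[of i n j m], of v] unfolding comm_def by (metis add.commute diff_add_cancel)

text \<open>The part of \<open>\<Sum> \<alpha>\<^bsub>i,n\<^esub> h\<^bsub>i,n\<^esub> z\<^sup>-\<^sup>n\<close> with \<open>n = \<epsilon>k\<close>: annihilation modes for \<open>\<epsilon> = 1\<close>, creation modes for
  \<open>\<epsilon> = -1\<close>.\<close>

definition osc :: "int \<Rightarrow> mode_coeffs \<Rightarrow> int \<Rightarrow> 'v \<Rightarrow> 'v" where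
  "osc \<epsilon> \<alpha> k v = \<alpha> I1 (\<epsilon> * k) *s hmode H I1 (\<epsilon> * k) v + \<alpha> I2 (\<epsilon> * k) *s hmode H I2 (\<epsilon> * k) v"

text \<open>The two halves of the normally ordered exponential of \<open>\<Sum> \<alpha>\<^bsub>i,n\<^esub> h\<^bsub>i,n\<^esub> z\<^sup>-\<^sup>n\<close>.\<close>

abbreviation half :: "int \<Rightarrow> mode_coeffs \<Rightarrow> int \<Rightarrow> 'v \<Rightarrow> 'v" where
  "half \<epsilon> \<alpha> \<equiv> expc (osc \<epsilon> \<alpha>)"

lemma lin_osc: "lin (osc \<epsilon> \<alpha> k)"
  unfolding osc_def by (intro lin_comb lin_scaled lin_hmode)

lemma lin_half: "lin (half \<epsilon> \<alpha> n)"
  by (rule lin_expc) (rule lin_osc)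

lemma osc_commute:
  assumes "\<epsilon> \<noteq> 0" "j > 0" "k > 0"
  shows "osc \<epsilon> \<alpha> j (osc \<epsilon> \<rho> k v) = osc \<epsilon> \<rho> k (osc \<epsilon> \<alpha> j v)"
proof -
  have "\<epsilon> * j + \<epsilon> * k \<noteq> 0" using assms by (simp flip: distrib_left)
  then have "hmode H i (\<epsilon> * j) (hmode H i' (\<epsilon> * k) v) = hmode H i' (\<epsilon> * k) (hmode H i (\<epsilon> * j) v)" for i i'
    by (subst hmode_commutator) simp
  then show ?thesis
    by (simp add: osc_def lin_add[OF lin_hmode] lin_scale[OF lin_hmode] scale_right_distrib algebra_simps)
qed

lemma osc_contraction:
  assumes "n > 0" "m > 0"
  shows "osc 1 \<alpha> n (osc (-1) \<rho> m v) = osc (-1) \<rho> m (osc 1 \<alpha> n v)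
           + (if m = n then coeff_pairing q d \<alpha> \<rho> n else 0) *s v"
proof -
  have "hmode H i n (hmode H i' (- m) v) = hmode H i' (- m) (hmode H i n v) +
      (if m = n then heis_pairing q d i i' n else 0) *s v" for i i'
    by (subst hmode_commutator) auto
  then show ?thesis
    by (simp add: osc_def lin_add[OF lin_hmode] lin_scale[OF lin_hmode] scale_right_distrib
         coeff_pairing_def algebra_simps)
qed

lemma half_half_commute:
  "\<epsilon> \<noteq> 0 \<Longrightarrow> half \<epsilon> \<alpha> a (half \<epsilon> \<rho> b v) = half \<epsilon> \<rho> b (half \<epsilon> \<alpha> a v)"
  by (intro expc_expc_commute lin_osc osc_commute)

lemma half_commute:
  assumes "lin T" "\<And>i n v. n \<noteq> 0 \<Longrightarrow> T (hmode H i n v) = hmode H i n (T v)" "\<epsilon> \<noteq> 0"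
  shows "T (half \<epsilon> \<alpha> n v) = half \<epsilon> \<alpha> n (T v)"
  by (rule expc_commute) (use assms in \<open>auto simp: osc_def lin_add lin_scale\<close>)

lemma half_add:
  assumes "\<epsilon> \<noteq> 0"
  shows "half \<epsilon> (add_coeffs \<alpha> \<rho>) n v = (\<Sum>i\<in>{0..n}. half \<epsilon> \<alpha> i (half \<epsilon> \<rho> (n - i) v))"
proof -
  have "half \<epsilon> (add_coeffs \<alpha> \<rho>) n v = expc (\<lambda>k v. osc \<epsilon> \<alpha> k v + osc \<epsilon> \<rho> k v) n v"
    by (rule expc_cong) (simp add: osc_def add_coeffs_def scale_left_distrib algebra_simps)
  also have "\<dots> = (\<Sum>i\<in>{0..n}. half \<epsilon> \<alpha> i (half \<epsilon> \<rho> (n - i) v))"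
    by (intro expc_mult lin_osc osc_commute assms)
  finally show ?thesis .
qed

lemma half_dilate:
  assumes "p \<noteq> 0"
  shows "half \<epsilon> (dilate p \<alpha>) n v = p powi (- \<epsilon> * n) *s half \<epsilon> \<alpha> n v"
proof -
  have "half \<epsilon> (dilate p \<alpha>) n v = expc (\<lambda>k v. (p powi (- \<epsilon>)) powi k *s osc \<epsilon> \<alpha> k v) n v"
    by (rule expc_cong) (simp add: osc_def dilate_def scale_right_distrib flip: power_int_mult)
  also have "\<dots> = (p powi (- \<epsilon>)) powi n *s half \<epsilon> \<alpha> n v"
    by (rule expc_scale) (use assms in \<open>auto simp: lin_osc\<close>)
  finally show ?thesis by (simp flip: power_int_mult)
qed

lemma half_contraction:
  assumes "log_deriv_coeffs (\<lambda>n. of_int n * coeff_pairing q d \<alpha> \<rho> n) f"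
  shows "half 1 \<alpha> a (half (-1) \<rho> b v)
       = (\<Sum>k\<in>{0..b}. f k *s half (-1) \<rho> (b - k) (half 1 \<alpha> (a - k) v))"
  by (rule expc_contraction[where c = "coeff_pairing q d \<alpha> \<rho>"])
     (use assms in \<open>auto intro!: lin_osc osc_commute simp: osc_contraction\<close>)


subsection \<open>Local nilpotency of annihilation modes\<close>

text \<open>The property of a vector that the condition \<open>smooth\<close> provides, with its bound made explicit.
  Applying an annihilation mode lowers the bound, which is how joint bounds for several exponentials are
  obtained.\<close>

definition annihilated_above :: "int \<Rightarrow> 'v \<Rightarrow> bool" where
  "annihilated_above N v \<longleftrightarrow> (\<forall>xs. (\<forall>(i, n) \<in> set xs. n > 0) \<and> sum_list (map snd xs) > N \<longrightarrow>
                   foldr (\<lambda>(i, n). hmode H i n) xs v = 0)"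

lemma annihilated_above_exists: "\<exists>N. annihilated_above N v"
  using smooth unfolding annihilated_above_def .

lemma annihilated_above_mono: "annihilated_above N v \<Longrightarrow> N \<le> M \<Longrightarrow> annihilated_above M v"
  unfolding annihilated_above_def by (meson order_le_less_trans)

lemma annihilated_above_neg:
  assumes "annihilated_above N v" "N < 0"
  shows "v = 0"
  using assms(1)[unfolded annihilated_above_def, rule_format, of "[]"] assms(2) by simp

lemma annihilated_above_hmode:
  assumes "annihilated_above N v" "n > 0"
  shows "annihilated_above (N - n) (hmode H i n v)"
  unfolding annihilated_above_def
proof (intro allI impI)
  fix xs :: "(idx \<times> int) list"
  assume "(\<forall>(i, n) \<in> set xs. n > 0) \<and> sum_list (map snd xs) > N - n"
  then show "foldr (\<lambda>(i, n). hmode H i n) xs (hmode H i n v) = 0"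
    using assms(1)[unfolded annihilated_above_def, rule_format, of "xs @ [(i, n)]"] assms(2) by auto
qed

lemma lin_foldr_hmode: "lin (foldr (\<lambda>(i, n). hmode H i n) xs)"
proof (induction xs)
  case (Cons x xs)
  then show ?case
    using lin_compose[OF lin_hmode[of "fst x" "snd x"] Cons] by (simp add: case_prod_beta comp_def)
qed (simp add: lin_def)

lemma annihilated_above_add:
  "annihilated_above N v \<Longrightarrow> annihilated_above N w \<Longrightarrow> annihilated_above N (v + w)"
  by (simp add: annihilated_above_def lin_add[OF lin_foldr_hmode])

lemma annihilated_above_scale: "annihilated_above N v \<Longrightarrow> annihilated_above N (c *s v)"
  by (simp add: annihilated_above_def lin_scale[OF lin_foldr_hmode])

lemma annihilated_above_0: "annihilated_above N 0"
  by (simp add: annihilated_above_def lin_zero[OF lin_foldr_hmode])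

lemma annihilated_above_sum:
  "(\<And>i. i \<in> I \<Longrightarrow> annihilated_above N (g i)) \<Longrightarrow> annihilated_above N (\<Sum>i\<in>I. g i)"
  by (induction I rule: infinite_finite_induct)
     (auto simp: annihilated_above_0 annihilated_above_add)

lemma annihilated_above_osc:
  assumes "annihilated_above N v" "n > 0"
  shows "annihilated_above (N - n) (osc 1 \<alpha> n v)"
  using assms by (simp add: osc_def annihilated_above_add annihilated_above_scale annihilated_above_hmode)

lemma annihilated_above_half:
  assumes "annihilated_above N v"
  shows "annihilated_above (N - n) (half 1 \<alpha> n v)"
proof -
  have "annihilated_above (N - int m) (half 1 \<alpha> (int m) v)" for m
  proof (induction m rule: less_induct)
    case (less m)
    show ?case
    proof (cases "m = 0")
      case False
      have "annihilated_above (N - int m) (osc 1 \<alpha> k (half 1 \<alpha> (int m - k) v))" if "k \<in> {1..int m}" for k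
        using annihilated_above_osc[OF less[of "nat (int m - k)"], of k \<alpha>] that by auto
      then have "annihilated_above (N - int m) ((1 / of_int (int m)) *s of_int (int m) *s half 1 \<alpha> (int m) v)"
        using False
        by (subst expc_euler_exact)
           (auto intro!: annihilated_above_scale annihilated_above_sum)
      then show ?thesis using False by simp
    qed (simp add: expc_0 assms)
  qed
  from this[of "nat n"] show ?thesis
    by (cases "n < 0") (auto simp: expc_neg annihilated_above_0)
qed

lemma half_eq_0:
  "annihilated_above N v \<Longrightarrow> n > N \<Longrightarrow> half 1 \<alpha> n v = 0"
  using annihilated_above_neg[OF annihilated_above_half] by force

lemma half_half_eq_0:
  "annihilated_above N v \<Longrightarrow> k + l > N \<Longrightarrow> half 1 \<alpha> k (half 1 \<rho> l v) = 0"
  by (rule half_eq_0[OF annihilated_above_half]) auto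


subsection \<open>Normally ordered exponentials\<close>

text \<open>The coefficient of \<open>z\<^sup>a\<close> in the normally ordered exponential \<open>V(\<alpha>; z)\<close> without zero modes. The sum
  over the degree of the annihilation half is cut off at \<open>M\<close>; on a vector with \<open>annihilated_above M\<close> the
  omitted terms vanish.\<close>

definition vop :: "int \<Rightarrow> mode_coeffs \<Rightarrow> int \<Rightarrow> 'v \<Rightarrow> 'v" where
  "vop M \<alpha> a u = (\<Sum>r\<in>{0..M}. half (-1) \<alpha> (a + r) (half 1 \<alpha> r u))"

text \<open>The coefficient of \<open>z\<^sup>a w\<^sup>b\<close> in \<open>:V(\<alpha>; z) V(\<rho>; w):\<close>, with the same cut-off.\<close>

definition vop2 :: "int \<Rightarrow> mode_coeffs \<Rightarrow> mode_coeffs \<Rightarrow> int \<Rightarrow> int \<Rightarrow> 'v \<Rightarrow> 'v" where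
  "vop2 M \<alpha> \<rho> a b u = (\<Sum>k\<in>{0..M}. \<Sum>l\<in>{0..M}.
     half (-1) \<alpha> (a + k) (half (-1) \<rho> (b + l) (half 1 \<alpha> k (half 1 \<rho> l u))))"

lemma lin_vop: "lin (vop M \<alpha> a)"
  unfolding vop_def[abs_def] by (intro lin_sum_op lin_compose[OF lin_half lin_half])

lemma vop_commute:
  assumes "lin T" "\<And>i n v. n \<noteq> 0 \<Longrightarrow> T (hmode H i n v) = hmode H i n (T v)"
  shows "T (vop M \<alpha> a u) = vop M \<alpha> a (T u)"
proof -
  have "T (half \<epsilon> \<alpha> n v) = half \<epsilon> \<alpha> n (T v)" if "\<epsilon> \<noteq> 0" for \<epsilon> n v
    using assms that by (rule half_commute)
  then show ?thesis by (simp add: vop_def lin_sum[OF assms(1)])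
qed

lemma vop2_swap: "vop2 M \<alpha> \<rho> a b u = vop2 M \<rho> \<alpha> b a u"
  unfolding vop2_def
  by (subst sum.swap) (simp add: half_half_commute[of _ \<alpha> _ \<rho>])

text \<open>The relation \<open>V(\<alpha>; z) V(\<rho>; w) = f(w/z) :V(\<alpha>; z) V(\<rho>; w):\<close>. The outer cut-off \<open>K\<close> has to exceed \<open>M\<close>
  by \<open>J\<close>, because the annihilation half of \<open>V(\<alpha>; z)\<close> can lose degree up to \<open>J\<close> on its way past the
  creation half of \<open>V(\<rho>; w)\<close>.\<close>

lemma vop_vop:
  assumes f: "log_deriv_coeffs (\<lambda>n. of_int n * coeff_pairing q d \<alpha> \<rho> n) f"
    and M: "annihilated_above M u" and J: "J \<ge> b + M" "J \<ge> 0" and K: "K \<ge> M + J"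
  shows "vop K \<alpha> a (vop M \<rho> b u) = (\<Sum>j\<in>{0..J}. f j *s vop2 M \<alpha> \<rho> (a + j) (b - j) u)"
proof -
  have "vop K \<alpha> a (vop M \<rho> b u)
      = (\<Sum>k\<in>{0..K}. \<Sum>l\<in>{0..M}. half (-1) \<alpha> (a + k) (half 1 \<alpha> k (half (-1) \<rho> (b + l) (half 1 \<rho> l u))))"
    by (simp add: vop_def lin_sum[OF lin_half])
  also have "\<dots> = (\<Sum>l\<in>{0..M}. \<Sum>k\<in>{0..K}. \<Sum>j\<in>{0..J}.
      f j *s half (-1) \<alpha> (a + j + (k - j)) (half (-1) \<rho> (b - j + l) (half 1 \<alpha> (k - j) (half 1 \<rho> l u))))"
  proof (subst sum.swap, intro sum.cong[OF refl])
    fix k l assume kl: "k \<in> {0..K}" "l \<in> {0..M}"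
    have "half 1 \<alpha> k (half (-1) \<rho> (b + l) (half 1 \<rho> l u))
       = (\<Sum>j\<in>{0..b + l}. f j *s half (-1) \<rho> (b + l - j) (half 1 \<alpha> (k - j) (half 1 \<rho> l u)))"
      by (rule half_contraction[OF f])
    also have "\<dots> = (\<Sum>j\<in>{0..J}. f j *s half (-1) \<rho> (b + l - j) (half 1 \<alpha> (k - j) (half 1 \<rho> l u)))"
      using J kl by (intro sum.mono_neutral_left) (auto simp: expc_neg)
    finally show "half (-1) \<alpha> (a + k) (half 1 \<alpha> k (half (-1) \<rho> (b + l) (half 1 \<rho> l u))) = (\<Sum>j\<in>{0..J}.
      f j *s half (-1) \<alpha> (a + j + (k - j)) (half (-1) \<rho> (b - j + l) (half 1 \<alpha> (k - j) (half 1 \<rho> l u))))"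
      by (simp add: lin_sum[OF lin_half] lin_scale[OF lin_half] algebra_simps)
  qed
  also have "\<dots> = (\<Sum>l\<in>{0..M}. \<Sum>j\<in>{0..J}. \<Sum>k\<in>{0..M}.
      f j *s half (-1) \<alpha> (a + j + k) (half (-1) \<rho> (b - j + l) (half 1 \<alpha> k (half 1 \<rho> l u))))"
  proof (subst sum.swap[of _ _ "{0..K}"], intro sum.cong[OF refl])
    fix l j assume lj: "l \<in> {0..M}" "j \<in> {0..J}"
    let ?F = "\<lambda>k. f j *s half (-1) \<alpha> (a + j + k) (half (-1) \<rho> (b - j + l) (half 1 \<alpha> k (half 1 \<rho> l u)))"
    have "(\<Sum>k\<in>{0..K}. ?F (k - j)) = (\<Sum>k\<in>{0..K - j}. ?F k)"
      using lj by (intro sum_int_shift) (auto simp: expc_neg lin_zero[OF lin_half])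
    also have "\<dots> = (\<Sum>k\<in>{0..M}. ?F k)"
      using lj K by (intro sum.mono_neutral_right) (auto simp: half_half_eq_0[OF M] lin_zero[OF lin_half])
    finally show "(\<Sum>k\<in>{0..K}. ?F (k - j)) = (\<Sum>k\<in>{0..M}. ?F k)" .
  qed
  also have "\<dots> = (\<Sum>j\<in>{0..J}. \<Sum>k\<in>{0..M}. \<Sum>l\<in>{0..M}.
      f j *s half (-1) \<alpha> (a + j + k) (half (-1) \<rho> (b - j + l) (half 1 \<alpha> k (half 1 \<rho> l u))))"
    by (subst sum.swap) (auto intro!: sum.cong sum.swap)
  also have "\<dots> = (\<Sum>j\<in>{0..J}. f j *s vop2 M \<alpha> \<rho> (a + j) (b - j) u)"
    by (simp add: vop2_def scale_sum_right)
  finally show ?thesis .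
qed

text \<open>On setting \<open>w = p z\<close> in \<open>:V(\<alpha>; z) V(\<rho>; w):\<close> the two exponentials merge into one, since all creation modes
  commute with each other, and so do all annihilation modes. The left-hand side is the coefficient of
  \<open>z\<^bsup>a+b\<^esup>\<close>: the summand \<open>j\<close> is the term \<open>z\<^bsup>a+j\<^esup> w\<^bsup>b-j\<^esup>\<close>, and outside the given range the terms
  vanish.\<close>

lemma vop2_fusion:
  assumes p: "p \<noteq> 0" and M: "annihilated_above M u" and J: "J \<ge> a + M" "J \<ge> b + M"
  shows "(\<Sum>j\<in>{-J..J}. p powi (b - j) *s vop2 M \<alpha> \<rho> (a + j) (b - j) u)
       = vop M (add_coeffs \<alpha> (dilate p \<rho>)) (a + b) u"
proof -
  define \<gamma> where "\<gamma> = add_coeffs \<alpha> (dilate p \<rho>)"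
  \<comment> \<open>Merging the creation halves uses up the sum over \<open>j\<close>.\<close>
  have left: "(\<Sum>j\<in>{-J..J}. p powi (b - j) *s half (-1) \<alpha> (a + j + k) (half (-1) \<rho> (b - j + l) w))
      = p powi (- l) *s half (-1) \<gamma> (a + b + (k + l)) w" if kl: "k \<in> {0..M}" "l \<in> {0..M}" for k l w
  proof -
    have "half (-1) \<gamma> (a + b + (k + l)) w
        = (\<Sum>i\<in>{0..a + b + (k + l)}. p powi (a + b + k + l - i) *s
             half (-1) \<alpha> i (half (-1) \<rho> (a + b + k + l - i) w))"
      by (simp add: \<gamma>_def half_add half_dilate[OF p] lin_scale[OF lin_half] algebra_simps)
    also have "\<dots> = (\<Sum>i\<in>{a + k - J..a + k + J}. p powi (a + b + k + l - i) *s
             half (-1) \<alpha> i (half (-1) \<rho> (a + b + k + l - i) w))"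
      using J kl by (intro sum.mono_neutral_left) (auto simp: expc_neg lin_zero[OF lin_half])
    also have "\<dots> = (\<Sum>j\<in>{-J..J}. p powi (b - j + l) *s
             half (-1) \<alpha> (a + j + k) (half (-1) \<rho> (b - j + l) w))"
      by (rule sum.reindex_bij_witness[of _ "\<lambda>j. a + k + j" "\<lambda>i. i - a - k"]) (auto simp: algebra_simps)
    finally have "p powi (- l) *s half (-1) \<gamma> (a + b + (k + l)) w
        = (\<Sum>j\<in>{-J..J}. (p powi (- l) * p powi (b - j + l)) *s
             half (-1) \<alpha> (a + j + k) (half (-1) \<rho> (b - j + l) w))"
      by (simp add: scale_sum_right)
    then show ?thesis using p by (simp flip: power_int_add)
  qed
  \<comment> \<open>The remaining factor \<open>p\<^sup>-\<^sup>l\<close> is what merging the annihilation halves requires.\<close>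
  have right: "half 1 \<gamma> r u = (\<Sum>k\<in>{0..M}. p powi (- (r - k)) *s half 1 \<alpha> k (half 1 \<rho> (r - k) u))"
    if r: "r \<in> {0..M}" for r
  proof -
    have "half 1 \<gamma> r u = (\<Sum>k\<in>{0..r}. p powi (- (r - k)) *s half 1 \<alpha> k (half 1 \<rho> (r - k) u))"
      by (simp add: \<gamma>_def half_add half_dilate[OF p] lin_scale[OF lin_half])
    also have "\<dots> = (\<Sum>k\<in>{0..M}. p powi (- (r - k)) *s half 1 \<alpha> k (half 1 \<rho> (r - k) u))"
      using r by (intro sum.mono_neutral_left) (auto simp: expc_neg lin_zero[OF lin_half])
    finally show ?thesis .
  qed
  define \<phi> where "\<phi> k l = p powi (- l) *s half (-1) \<gamma> (a + b + (k + l)) (half 1 \<alpha> k (half 1 \<rho> l u))" for k l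
  have \<phi>0: "\<phi> k l = 0" if "l < 0 \<or> k + l > M" for k l
    using that by (auto simp: \<phi>_def expc_neg half_half_eq_0[OF M] lin_zero[OF lin_half])
  have "(\<Sum>j\<in>{-J..J}. p powi (b - j) *s vop2 M \<alpha> \<rho> (a + j) (b - j) u)
      = (\<Sum>j\<in>{-J..J}. \<Sum>k\<in>{0..M}. \<Sum>l\<in>{0..M}. p powi (b - j) *s half (-1) \<alpha> (a + j + k)
           (half (-1) \<rho> (b - j + l) (half 1 \<alpha> k (half 1 \<rho> l u))))"
    by (simp add: vop2_def scale_sum_right)
  also have "\<dots> = (\<Sum>k\<in>{0..M}. \<Sum>l\<in>{0..M}. \<Sum>j\<in>{-J..J}. p powi (b - j) *s half (-1) \<alpha> (a + j + k)
           (half (-1) \<rho> (b - j + l) (half 1 \<alpha> k (half 1 \<rho> l u))))"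
    by (subst sum.swap) (auto intro!: sum.cong sum.swap)
  also have "\<dots> = (\<Sum>k\<in>{0..M}. \<Sum>l\<in>{0..M}. \<phi> k l)"
    by (intro sum.cong refl) (simp add: left \<phi>_def)
  also have "\<dots> = (\<Sum>k\<in>{0..M}. \<Sum>r\<in>{0..M}. \<phi> k (r - k))"
  proof (rule sum.cong[OF refl])
    fix k assume k: "k \<in> {0..M}"
    have "(\<Sum>l\<in>{0..M}. \<phi> k l) = (\<Sum>l\<in>{0..M - k}. \<phi> k l)"
      using k by (intro sum.mono_neutral_right) (auto simp: \<phi>0)
    also have "\<dots> = (\<Sum>r\<in>{0..M}. \<phi> k (r - k))"
      using k by (intro sum_int_shift[symmetric]) (auto simp: \<phi>0)
    finally show "(\<Sum>l\<in>{0..M}. \<phi> k l) = (\<Sum>r\<in>{0..M}. \<phi> k (r - k))" .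
  qed
  also have "\<dots> = (\<Sum>r\<in>{0..M}. \<Sum>k\<in>{0..M}. \<phi> k (r - k))" by (rule sum.swap)
  also have "\<dots> = vop M \<gamma> (a + b) u"
    unfolding vop_def
    by (intro sum.cong[OF refl]) (simp add: right \<phi>_def lin_sum[OF lin_half] lin_scale[OF lin_half])
  finally show ?thesis by (simp add: \<gamma>_def)
qed

end


section \<open>Vertex operators on vectors of definite charge\<close>

text \<open>The two exponentials in \<open>\<Lambda>\<^sub>i\<^sup>+(c z)\<close> and \<open>\<Lambda>\<^sub>i\<^sup>-(c z)\<close> are the cases \<open>s = 1\<close> and \<open>s = -1\<close> of one
  formula.\<close>

definition vertex_coeffs :: "complex \<Rightarrow> int \<Rightarrow> idx \<Rightarrow> complex \<Rightarrow> mode_coeffs" where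
  "vertex_coeffs q s i c = (\<lambda>j n. if j = i then - (of_int s * q powi (s * n) / of_int n) * c powi (- n) else 0)"

definition pair_coeffs :: "complex \<Rightarrow> int \<Rightarrow> int \<Rightarrow> complex \<Rightarrow> mode_coeffs" where
  "pair_coeffs q s t \<xi> = add_coeffs (vertex_coeffs q s I1 \<xi>) (vertex_coeffs q t I2 1)"

definition vertex :: "complex \<Rightarrow> complex \<Rightarrow> 'v::ab_group_add heis_ops \<Rightarrow> int \<Rightarrow> idx \<Rightarrow> complex \<Rightarrow> 'v nordered" where
  "vertex q l1 H s i c = (if s = 1 then Lambda_plus q l1 H i c else Lambda_minus q l1 H i c)"

abbreviation is_sign :: "int \<Rightarrow> bool" where
  "is_sign s \<equiv> s = 1 \<or> s = -1"

fun idx_sign :: "idx \<Rightarrow> int" where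
  "idx_sign I1 = 1" | "idx_sign I2 = -1"

context heisenberg_module
begin

text \<open>The vectors on which the zero modes \<open>h\<^bsub>i,0\<^esub>\<close> are explicit integers; they span the module
  by \<open>h_integral\<close>.\<close>

definition charge :: "int \<Rightarrow> 'v \<Rightarrow> bool" where
  "charge c u \<longleftrightarrow> hmode H I1 0 u = of_int c *s u"

text \<open>The operator \<open>e\<^bsup>sQ\<^esup>\<close> with \<open>Q = Q\<^sub>1\<close>, for \<open>s = 1\<close> and \<open>s = -1\<close>; since \<open>Q\<^sub>2 = -Q\<^sub>1\<close>, it covers both indices.\<close>

definition shift :: "int \<Rightarrow> 'v \<Rightarrow> 'v" where
  "shift s = (if s = 1 then expQ H I1 else expQ H I2)"

text \<open>For \<open>l = log q\<^sub>1\<close> this is \<open>q\<^sub>1\<close> to the power \<open>n a\<^sub>0\<close>.\<close>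

definition apow :: "complex \<Rightarrow> int \<Rightarrow> 'v \<Rightarrow> 'v" where
  "apow l n = op_fun H (azero H) (\<lambda>\<mu>. exp (of_int n * l * \<mu>))"

lemma span_charge: "span {u. \<exists>c. charge c u} = UNIV"
  using h_integral by (simp add: charge_def)

lemma eq_on_charge:
  assumes "lin F" "lin G" "\<And>c u. charge c u \<Longrightarrow> F u = G u"
  shows "F v = G v"
  by (rule lin_eq_on_span[OF assms(1,2) _ span_charge]) (use assms(3) in auto)

text \<open>The \<open>\<star>\<close>-product is defined through the set of non-zero terms, and has its meaning only where this set is
  finite. For linear coefficients it is enough to check this on vectors of definite charge, where \<open>z\<^sup>h\<close>
  is a single power of \<open>z\<close>.\<close>

lemma finite_support_on_charge:
  assumes F: "\<And>k. lin (F k)" and G: "\<And>k. lin (G k)"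
    and fin: "\<And>c u. charge c u \<Longrightarrow> finite {k. F (m - k) (G k u) \<noteq> 0}"
  shows "finite {k. F (m - k) (G k v) \<noteq> 0}"
proof -
  have "v \<in> span {u. \<exists>c. charge c u}" by (simp add: span_charge)
  then show ?thesis
  proof (induction rule: span_induct_alt)
    case base
    then show ?case by (simp add: lin_zero[OF F] lin_zero[OF G])
  next
    case (step a u v)
    have "{k. F (m - k) (G k (a *s u + v)) \<noteq> 0}
        \<subseteq> {k. F (m - k) (G k u) \<noteq> 0} \<union> {k. F (m - k) (G k v) \<noteq> 0}"
      by (auto simp: lin_add[OF F] lin_add[OF G] lin_scale[OF F] lin_scale[OF G])
    then show ?case using step fin by (auto intro: finite_subset)
  qed
qed

lemma charge_commute:
  assumes "lin T" "\<And>v. T (hmode H I1 0 v) = hmode H I1 0 (T v)" "charge c u"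
  shows "charge c (T u)"
  using assms(2)[of u, symmetric] assms(1,3) by (simp add: charge_def lin_scale)

lemma hmode_zero_commute: "hmode H i n (hmode H j 0 v) = hmode H j 0 (hmode H i n v)"
  by (subst hmode_commutator) (auto simp: heis_pairing_def)

lemma charge_scale: "charge c u \<Longrightarrow> charge c (a *s u)"
  by (rule charge_commute) (auto simp: lin_def lin_scale[OF lin_hmode] scale_right_distrib mult.commute)

lemma charge_half:
  assumes "charge c u" "\<epsilon> \<noteq> 0"
  shows "charge c (half \<epsilon> \<alpha> n u)"
  by (rule charge_commute[OF lin_half _ assms(1)])
     (rule half_commute[symmetric, OF lin_hmode _ assms(2)], rule hmode_zero_commute[symmetric])

lemma charge_vop: "charge c u \<Longrightarrow> charge c (vop M \<alpha> a u)"
  by (rule charge_commute[OF lin_vop _]) (auto simp: vop_commute[OF lin_hmode] hmode_zero_commute)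

lemma charge_idx:
  assumes "charge c u"
  shows "hmode H i 0 u = of_int (idx_sign i * c) *s u"
proof (cases i)
  case I2
  have "hmode H I2 0 u = - hmode H I1 0 u" using h1_h2[of u] by simp
  then show ?thesis using assms I2 by (simp add: charge_def)
qed (use assms in \<open>simp add: charge_def\<close>)

lemma lin_shift: "lin (shift s)"
  by (simp add: shift_def lin_expQ)

lemma expQ_hmode: "n \<noteq> 0 \<Longrightarrow> expQ H j (hmode H i n v) = hmode H i n (expQ H j v)"
  using fun_cong[OF h_Q[of i n j], of v] by (simp add: comm_def)

lemma shift_hmode: "n \<noteq> 0 \<Longrightarrow> shift s (hmode H i n v) = hmode H i n (shift s v)"
  by (simp add: shift_def expQ_hmode)

lemma charge_shift:
  assumes "charge c u" "is_sign s"
  shows "charge (c + s) (shift s u)"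
proof -
  have "hmode H I1 0 (expQ H j u) - expQ H j (hmode H I1 0 u)
      = (if I1 = j then 1 else -1) *s expQ H j u" for j
    using fun_cong[OF h_Q[of I1 0 j], of u] by (simp add: comm_def)
  from this[of I1] this[of I2] show ?thesis
    using assms by (auto simp: charge_def shift_def lin_scale[OF lin_expQ] algebra_simps)
qed

lemma shift_shift:
  assumes "is_sign s"
  shows "shift s (shift (- s) v) = v"
proof -
  have "expQ H I1 (expQ H I2 v) = expQ H I2 (expQ H I1 v)"
    using fun_cong[OF Q_Q[of I1 I2], of v] by (simp add: comm_def)
  then show ?thesis using assms Q1_Q2[of v] by (auto simp: shift_def)
qed

lemma shift_expQ:
  assumes "is_sign s"
  shows "(if s = 1 then expQ H i else inv (expQ H i)) = shift (idx_sign i * s)"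
proof -
  have 12: "expQ H I1 \<circ> expQ H I2 = id" "expQ H I2 \<circ> expQ H I1 = id"
    using shift_shift[of 1] shift_shift[of "-1"] by (auto simp: fun_eq_iff shift_def)
  then have "inv (expQ H I1) = expQ H I2" "inv (expQ H I2) = expQ H I1"
    by (auto intro: inv_unique_comp)
  with assms show ?thesis by (cases i) (auto simp: shift_def)
qed

lemma azero_span: "span {v. \<exists>\<mu>. azero H v = \<mu> *s v} = UNIV"
  using a_diagonal .

lemma lin_apow: "lin (apow l n)"
  unfolding apow_def by (rule lin_op_fun[OF lin_azero azero_span])

lemma apow_commute:
  assumes "lin T" "\<And>v. T (azero H v) = azero H (T v)"
  shows "apow l n (T v) = T (apow l n v)"
  unfolding apow_def by (rule op_fun_commute[symmetric, OF lin_azero azero_span assms])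

lemma hmode_azero: "hmode H i n (azero H v) = azero H (hmode H i n v)"
  using fun_cong[OF h_a[of i n], of v] by (simp add: comm_def)

lemma apow_hmode: "apow l n (hmode H i m v) = hmode H i m (apow l n v)"
  by (rule apow_commute) (auto simp: lin_hmode hmode_azero)

lemma apow_shift: "apow l n (shift s v) = shift s (apow l n v)"
proof (rule apow_commute[OF lin_shift])
  have "expQ H i (azero H v) = azero H (expQ H i v)" for i v
    using fun_cong[OF Q_a[of i], of v] by (simp add: comm_def)
  then show "shift s (azero H v) = azero H (shift s v)" for v by (simp add: shift_def)
qed

lemma charge_apow: "charge c u \<Longrightarrow> charge c (apow l n u)"
  by (rule charge_commute[OF lin_apow]) (auto simp: apow_hmode)

lemma apow_apow: "apow l m (apow l n v) = apow l (m + n) v"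
proof (rule lin_eq_on_span[OF lin_compose[OF lin_apow lin_apow] lin_apow _ azero_span])
  fix v assume "v \<in> {v. \<exists>\<mu>. azero H v = \<mu> *s v}"
  then obtain \<mu> where \<mu>: "azero H v = \<mu> *s v" by blast
  have "apow l k v = exp (of_int k * l * \<mu>) *s v" for k
    unfolding apow_def by (rule op_fun_eigen[OF lin_azero azero_span \<mu>])
  then show "apow l m (apow l n v) = apow l (m + n) v"
    by (simp add: lin_scale[OF lin_apow] mult.commute algebra_simps flip: exp_add)
qed

lemma half_shift: "\<epsilon> \<noteq> 0 \<Longrightarrow> half \<epsilon> \<alpha> n (shift s v) = shift s (half \<epsilon> \<alpha> n v)"
  by (rule half_commute[symmetric]) (auto simp: lin_shift shift_hmode)

lemma half_apow: "\<epsilon> \<noteq> 0 \<Longrightarrow> half \<epsilon> \<alpha> n (apow l m v) = apow l m (half \<epsilon> \<alpha> n v)"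
  by (rule half_commute[symmetric]) (auto simp: lin_apow apow_hmode)

lemma oexp_modes_creation:
  "oexp H (modes H i {..<0} a c) m = half (-1) (\<lambda>j n. if j = i then a n * c powi (- n) else 0) m"
proof -
  have "modes H i {..<0} a c = mode_series 1 (osc (-1) (\<lambda>j n. if j = i then a n * c powi (- n) else 0))"
    by (intro ext, cases i) (auto simp: modes_def mode_series_def osc_def)
  then show ?thesis
    by (intro ext) (simp add: oexp_mode_series lin_osc osc_commute)
qed

lemma oexp_modes_annihilation:
  "oexp H (modes H i {0<..} a c) m = half 1 (\<lambda>j n. if j = i then a n * c powi (- n) else 0) (- m)"
proof -
  have "modes H i {0<..} a c = mode_series (-1) (osc 1 (\<lambda>j n. if j = i then a n * c powi (- n) else 0))"
    by (intro ext, cases i) (auto simp: modes_def mode_series_def osc_def)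
  then show ?thesis
    by (intro ext) (simp add: oexp_mode_series lin_osc osc_commute)
qed

lemma vertex_eq:
  assumes "is_sign s"
  shows "vertex q l1 H s i c =
     (oexp H (modes H i {..<0} (\<lambda>n. - (of_int s * q powi (s * n) / of_int n)) c)
        \<star> oconst (shift (idx_sign i * s)),
      oexp H (modes H i {0<..} (\<lambda>n. - (of_int s * q powi (s * n) / of_int n)) c)
        \<star> (zpow H (q powi (- s) * c) (\<lambda>v. of_int s *s hmode H i 0 v) \<star> oconst (apow l1 s)))"
  using assms
  by (auto simp: vertex_def Lambda_plus_def Lambda_minus_def Let_def apow_def power_int_minus
       simp flip: shift_expQ)

lemma fst_vertex:
  assumes "is_sign s"
  shows "fst (vertex q l1 H s i c) k v = half (-1) (vertex_coeffs q s i c) k (shift (idx_sign i * s) v)"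
  by (simp add: vertex_eq[OF assms] oexp_modes_creation vertex_coeffs_def,
      subst omult_single[of 0]) (auto simp: oconst_def oexp_modes_creation lin_zero[OF lin_half])

text \<open>On a vector of charge \<open>m\<close> the series \<open>(C z)\<^bsup>sh\<^esup>\<close> reduces to its term of degree \<open>s m\<close> or \<open>- s m\<close>,
  according to the index of the mode.\<close>

lemma zpow_eigen:
  assumes "charge m u" "is_sign s"
  shows lin_zpow: "lin (zpow H C (\<lambda>v. of_int s *s hmode H i 0 v) k)"
    and "zpow H C (\<lambda>v. of_int s *s hmode H i 0 v) k u
       = (if k = s * idx_sign i * m then C powi k else 0) *s u"
proof -
  define A where "A = (\<lambda>v. of_int s *s hmode H i 0 v)"
  have A: "lin A" unfolding A_def by (intro lin_scaled lin_hmode)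
  have eig: "A u = of_int (s * idx_sign i * m) *s u" if "charge m u" for m u
    using charge_idx[OF that, of i] by (simp add: A_def mult.assoc)
  have "{u. \<exists>c. charge c u} \<subseteq> {v. \<exists>\<mu>. A v = \<mu> *s v}" using eig by blast
  from span_mono[OF this] have diag: "span {v. \<exists>\<mu>. A v = \<mu> *s v} = UNIV"
    by (simp add: span_charge top.extremum_unique)
  show "lin (zpow H C (\<lambda>v. of_int s *s hmode H i 0 v) k)"
    unfolding zpow_def A_def[symmetric] by (rule lin_op_fun[OF A diag])
  show "zpow H C (\<lambda>v. of_int s *s hmode H i 0 v) k u
       = (if k = s * idx_sign i * m then C powi k else 0) *s u"
    unfolding zpow_def A_def[symmetric] op_fun_eigen[OF A diag eig[OF assms(1)]]
    by (auto simp del: of_int_mult)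
qed

lemma charge_0: "charge 0 0"
  by (simp add: charge_def lin_zero[OF lin_hmode])

lemma zpow_apow:
  "(zpow H C A \<star> oconst (apow l s)) k v = zpow H C A k (apow l s v)"
  if "\<And>k. lin (zpow H C A k)"
  by (subst omult_single[of 0]) (auto simp: oconst_def lin_zero[OF that])

lemma snd_vertex:
  assumes s: "is_sign s"
  shows lin_snd_vertex: "lin (snd (vertex q l1 H s i c) k)"
    and snd_vertex_charge: "charge m u \<Longrightarrow> snd (vertex q l1 H s i c) k u
      = (q powi (- s) * c) powi (s * idx_sign i * m) *s
          half 1 (vertex_coeffs q s i c) (s * idx_sign i * m - k) (apow l1 s u)"
proof -
  define C where "C = q powi (- s) * c"
  define A where "A = (\<lambda>v. of_int s *s hmode H i 0 v)"
  define F where "F = oexp H (modes H i {0<..} (\<lambda>n. - (of_int s * q powi (s * n) / of_int n)) c)"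
  define G where "G = zpow H C A \<star> oconst (apow l1 s)"
  have zlin: "lin (zpow H C A k)" for k
    unfolding A_def by (rule lin_zpow[OF charge_0 s])
  have snd_eq: "snd (vertex q l1 H s i c) = F \<star> G"
    by (simp add: vertex_eq[OF s] F_def G_def C_def A_def)
  have F: "F k = half 1 (vertex_coeffs q s i c) (- k)" for k
    by (simp add: F_def oexp_modes_annihilation vertex_coeffs_def)
  have Geq: "G k = (\<lambda>v. zpow H C A k (apow l1 s v))" for k
    by (rule ext) (simp add: G_def zpow_apow zlin)
  have G: "lin (G k)" for k
    unfolding Geq by (rule lin_compose[OF zlin lin_apow])
  have Gc: "G k u = (if k = s * idx_sign i * m then C powi k else 0) *s apow l1 s u"
    if "charge m u" for k m u
    unfolding Geq A_def by (rule zpow_eigen[OF charge_apow[OF that] s])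
  have "finite {k. F (m - k) (G k v) \<noteq> 0}" for m v
  proof (rule finite_support_on_charge[of F G])
    fix c' u assume "charge c' u"
    then have "{k. F (m - k) (G k u) \<noteq> 0} \<subseteq> {s * idx_sign i * c'}"
      by (auto simp: F Gc lin_zero[OF lin_half] split: if_splits)
    then show "finite {k. F (m - k) (G k u) \<noteq> 0}" by (rule finite_subset) simp
  qed (auto simp: F G lin_half)
  then show "lin (snd (vertex q l1 H s i c) k)"
    unfolding snd_eq by (intro lin_omult) (auto simp: F G lin_half)
  assume u: "charge m u"
  have "(F \<star> G) k u = F (k - s * idx_sign i * m) (G (s * idx_sign i * m) u)"
    by (rule omult_single) (auto simp: F Gc[OF u] lin_zero[OF lin_half])
  then show "snd (vertex q l1 H s i c) k u
      = (q powi (- s) * c) powi (s * idx_sign i * m) *s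
          half 1 (vertex_coeffs q s i c) (s * idx_sign i * m - k) (apow l1 s u)"
    by (simp add: snd_eq F Gc[OF u] lin_scale[OF lin_half] C_def)
qed

lemma half_add_reversed:
  assumes "\<epsilon> \<noteq> 0"
  shows "half \<epsilon> (add_coeffs \<alpha> \<rho>) n v = (\<Sum>i\<in>{0..n}. half \<epsilon> \<alpha> (n - i) (half \<epsilon> \<rho> i v))"
  unfolding half_add[OF assms]
  by (rule sum.reindex_bij_witness[of _ "\<lambda>i. n - i" "\<lambda>i. n - i"]) auto

text \<open>The series \<open>:\<Lambda>\<^sub>1\<^sup>s(\<xi> z) \<Lambda>\<^sub>2\<^sup>t(z):\<close> for signs \<open>s, t\<close>; up to scalars these are the summands of the current.\<close>

definition vpair :: "complex \<Rightarrow> int \<Rightarrow> int \<Rightarrow> complex \<Rightarrow> 'v oseries" where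
  "vpair l s t \<xi> = nseries (nmult (vertex q l H s I1 \<xi>) (vertex q l H t I2 1))"

lemma fst_vertex_pair:
  assumes s: "is_sign s" and t: "is_sign t"
  shows "fst (nmult (vertex q l H s I1 \<xi>) (vertex q l H t I2 1)) k v
       = half (-1) (pair_coeffs q s t \<xi>) k (shift s (shift (- t) v))"
proof -
  let ?F = "fst (vertex q l H s I1 \<xi>)" and ?G = "fst (vertex q l H t I2 1)"
  have "(?F \<star> ?G) k v = (\<Sum>j\<in>{0..k}. ?F (k - j) (?G j v))"
    by (rule omult_eval)
       (auto simp: fst_vertex s t expc_neg lin_zero[OF lin_half] lin_zero[OF lin_shift] intro: ccontr)
  also have "\<dots> = half (-1) (pair_coeffs q s t \<xi>) k (shift s (shift (- t) v))"
    by (simp add: fst_vertex s t pair_coeffs_def half_add_reversed half_shift lin_sum[OF lin_shift])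
  finally show ?thesis by (simp add: nmult_def)
qed

text \<open>The factors \<open>q\<close> to the power \<open>-m\<close> and \<open>q\<close> to the power \<open>m\<close> from the zero modes of \<open>\<Lambda>\<^sub>1\<close> and \<open>\<Lambda>\<^sub>2\<close>
  cancel, so that \<open>\<xi>\<^bsup>sm\<^esup>\<close> remains.\<close>

lemma snd_vertex_pair:
  fixes s t :: int and l \<xi> :: complex
  assumes s: "is_sign s" and t: "is_sign t" and q: "q \<noteq> 0"
  defines "R \<equiv> snd (nmult (vertex q l H s I1 \<xi>) (vertex q l H t I2 1))"
  shows lin_snd_vertex_pair: "lin (R k)"
    and snd_vertex_pair_charge: "charge m u \<Longrightarrow> R k u
      = \<xi> powi (s * m) *s half 1 (pair_coeffs q s t \<xi>) ((s - t) * m - k) (apow l (s + t) u)"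
proof -
  let ?F = "snd (vertex q l H s I1 \<xi>)" and ?G = "snd (vertex q l H t I2 1)"
  let ?\<alpha> = "vertex_coeffs q s I1 \<xi>" and ?\<rho> = "vertex_coeffs q t I2 1"
  have R: "R = ?F \<star> ?G" by (simp add: R_def nmult_def)
  note lin = lin_snd_vertex[OF s] lin_snd_vertex[OF t]
  have prod_term: "?F (k - j) (?G j u) = \<xi> powi (s * m) *s
      half 1 ?\<alpha> ((s - t) * m - k - (- t * m - j)) (half 1 ?\<rho> (- t * m - j) (apow l (s + t) u))"
    if u: "charge m u" for k j m u
  proof -
    have "(q powi (- s) * \<xi>) powi (s * m) * (q powi (- t) * 1) powi (- t * m) = \<xi> powi (s * m)"
      using s t q by (auto simp: power_int_mult_distrib power_int_minus field_simps power_int_inverse power_int_divide_distrib)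
    moreover have "s * m - (k - j) = (s - t) * m - k - (- t * m - j)" by (simp add: algebra_simps)
    moreover have G: "?G j u = (q powi (- t) * 1) powi (- t * m) *s half 1 ?\<rho> (- t * m - j) (apow l t u)"
      using snd_vertex_charge[OF t u, of l I2 1 j] by simp
    moreover have "charge m (?G j u)"
      unfolding G by (intro charge_scale charge_half charge_apow u) simp
    from snd_vertex_charge[OF s this, of l I1 \<xi> "k - j"]
    have "?F (k - j) (?G j u) = (q powi (- s) * \<xi>) powi (s * m) *s
        half 1 ?\<alpha> (s * m - (k - j)) (apow l s (?G j u))" by simp
    ultimately show ?thesis
      by (simp only: lin_scale[OF lin_half] lin_scale[OF lin_apow] half_apow apow_apow scale_scale)
  qed
  have supp: "{j. ?F (k - j) (?G j u) \<noteq> 0} \<subseteq> {k - s * m..- t * m}" if u: "charge m u" for k m u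
  proof
    fix j assume "j \<in> {j. ?F (k - j) (?G j u) \<noteq> 0}"
    then have "\<not> (s - t) * m - k - (- t * m - j) < 0" "\<not> - t * m - j < 0"
      unfolding prod_term[OF u] by (auto simp: expc_neg lin_zero[OF lin_half])
    then show "j \<in> {k - s * m..- t * m}" by (auto simp: algebra_simps)
  qed
  have "finite {j. ?F (k - j) (?G j v) \<noteq> 0}" for k v
    by (rule finite_support_on_charge[of ?F ?G]) (use lin finite_subset[OF supp] in auto)
  then show "lin (R k)"
    unfolding R by (intro lin_omult lin)
  assume u: "charge m u"
  have "R k u = (\<Sum>j\<in>{k - s * m..- t * m}. ?F (k - j) (?G j u))"
    unfolding R by (rule omult_eval) (simp, use supp[OF u, of k] in blast)
  also have "\<dots> = (\<Sum>i\<in>{0..(s - t) * m - k}. \<xi> powi (s * m) *s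
      half 1 ?\<alpha> ((s - t) * m - k - i) (half 1 ?\<rho> i (apow l (s + t) u)))"
    by (rule sum.reindex_bij_witness[of _ "\<lambda>i. - t * m - i" "\<lambda>j. - t * m - j"])
       (auto simp: prod_term[OF u] algebra_simps)
  also have "\<dots> = \<xi> powi (s * m) *s half 1 (pair_coeffs q s t \<xi>) ((s - t) * m - k) (apow l (s + t) u)"
    by (simp add: pair_coeffs_def half_add_reversed scale_sum_right)
  finally show "R k u = \<dots>" .
qed

text \<open>On a vector of charge \<open>m\<close> the zero modes give a scalar, a shift of the power of \<open>z\<close> by \<open>(s - t) m\<close>,
  and the operators \<open>e\<^sup>Q\<close> and \<open>q\<^sub>1\<^sup>a\<close>, which commute with all oscillators. Thus products of such series can be
  computed with oscillators alone.\<close>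

lemma vpair:
  assumes s: "is_sign s" and t: "is_sign t" and q: "q \<noteq> 0"
  shows lin_vpair: "lin (vpair l s t \<xi> k)"
    and vpair_charge: "charge m u \<Longrightarrow> annihilated_above M u \<Longrightarrow> vpair l s t \<xi> k u
      = \<xi> powi (s * m) *s shift s (shift (- t) (apow l (s + t)
          (vop M (pair_coeffs q s t \<xi>) (k - (s - t) * m) u)))"
proof -
  define F where "F = fst (nmult (vertex q l H s I1 \<xi>) (vertex q l H t I2 1))"
  define G where "G = snd (nmult (vertex q l H s I1 \<xi>) (vertex q l H t I2 1))"
  let ?\<alpha> = "pair_coeffs q s t \<xi>"
  let ?e = "\<lambda>m. (s - t) * m"
  have V: "vpair l s t \<xi> = F \<star> G" by (simp add: vpair_def nseries_def F_def G_def)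
  have "F k = (\<lambda>v. half (-1) ?\<alpha> k (shift s (shift (- t) v)))" for k
    unfolding F_def by (rule ext) (rule fst_vertex_pair[OF s t])
  then have lin: "lin (F k)" "lin (G k)" for k
    using lin_snd_vertex_pair[OF s t q]
    by (simp_all add: G_def lin_compose[OF lin_half lin_compose[OF lin_shift lin_shift]])
  have prod_term: "F (k - j) (G j u) = \<xi> powi (s * m) *s shift s (shift (- t) (apow l (s + t)
       (half (-1) ?\<alpha> (k - j) (half 1 ?\<alpha> (?e m - j) u))))" if "charge m u" for k j m u
    using that
    by (simp add: F_def G_def fst_vertex_pair[OF s t] snd_vertex_pair_charge[OF s t q]
         lin_scale[OF lin_half] lin_scale[OF lin_shift] half_shift half_apow)
  have supp: "{j. F (k - j) (G j u) \<noteq> 0} \<subseteq> {?e m - M..?e m}"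
    if "charge m u" "annihilated_above M u" for k m u M
  proof
    fix j assume j: "j \<in> {j. F (k - j) (G j u) \<noteq> 0}"
    have "half 1 ?\<alpha> (?e m - j) u \<noteq> 0"
    proof
      assume "half 1 ?\<alpha> (?e m - j) u = 0"
      with j show False
        by (simp add: prod_term[OF that(1)] lin_zero[OF lin_half] lin_zero[OF lin_apow] lin_zero[OF lin_shift])
    qed
    then show "j \<in> {?e m - M..?e m}"
      using half_eq_0[OF that(2), of "?e m - j"] expc_neg[of "?e m - j"] by (force simp: not_less)
  qed
  have "finite {j. F (k - j) (G j v) \<noteq> 0}" for k v
  proof (rule finite_support_on_charge[of F G])
    fix c u assume u: "charge c u"
    obtain M where "annihilated_above M u" using annihilated_above_exists by blast
    from finite_subset[OF supp[OF u this]] show "finite {j. F (k - j) (G j u) \<noteq> 0}" by simp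
  qed (simp_all add: lin)
  then show "lin (vpair l s t \<xi> k)" unfolding V by (intro lin_omult lin)
  assume u: "charge m u" "annihilated_above M u"
  have "(F \<star> G) k u = (\<Sum>j\<in>{?e m - M..?e m}. F (k - j) (G j u))"
    by (rule omult_eval) (simp, use supp[OF u, of k] in blast)
  also have "\<dots> = (\<Sum>r\<in>{0..M}. \<xi> powi (s * m) *s shift s (shift (- t) (apow l (s + t)
       (half (-1) ?\<alpha> (k - ?e m + r) (half 1 ?\<alpha> r u)))))"
    by (rule sum.reindex_bij_witness[of _ "\<lambda>r. ?e m - r" "\<lambda>j. ?e m - j"])
       (auto simp: prod_term[OF u(1)] algebra_simps)
  also have "\<dots> = \<xi> powi (s * m) *s shift s (shift (- t) (apow l (s + t) (vop M ?\<alpha> (k - ?e m) u)))"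
    by (simp add: vop_def lin_sum[OF lin_shift] lin_sum[OF lin_apow] scale_sum_right)
  finally show "vpair l s t \<xi> k u = \<dots>" by (simp add: V)
qed

end


section \<open>Contractions as power series\<close>

text \<open>The same relation as \<open>log_deriv_coeffs\<close>, for formal power series, where it is multiplicative and can be
  checked on linear factors.\<close>

definition log_deriv_fps :: "(nat \<Rightarrow> complex) \<Rightarrow> complex fps \<Rightarrow> bool" where
  "log_deriv_fps g F \<longleftrightarrow> fps_nth F 0 = 1 \<and>
     fps_X * fps_deriv F = Abs_fps (\<lambda>n. if n = 0 then 0 else g n) * F"

lemma log_deriv_fps_mult:
  assumes "log_deriv_fps g F" "log_deriv_fps h G"
  shows "log_deriv_fps (\<lambda>n. g n + h n) (F * G)"
proof -
  have eq: "Abs_fps (\<lambda>n. if n = 0 then 0 else g n + h n)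
      = Abs_fps (\<lambda>n. if n = 0 then 0 else g n) + Abs_fps (\<lambda>n. if n = 0 then 0 else h n)"
    by (rule fps_ext) simp
  have "fps_X * fps_deriv (F * G) = (fps_X * fps_deriv F) * G + F * (fps_X * fps_deriv G)"
    by (simp add: algebra_simps)
  also have "\<dots> = Abs_fps (\<lambda>n. if n = 0 then 0 else g n + h n) * (F * G)"
    using assms unfolding log_deriv_fps_def eq by (simp add: algebra_simps)
  finally show ?thesis using assms by (simp add: log_deriv_fps_def)
qed

lemma log_deriv_fps_linear: "log_deriv_fps (\<lambda>n. - (a ^ n)) (1 - fps_const a * fps_X)"
  unfolding log_deriv_fps_def
proof (intro conjI fps_ext)
  fix n
  let ?G = "Abs_fps (\<lambda>n. if n = 0 then 0 else - (a ^ n))"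
  have "?G * (1 - fps_const a * fps_X) = ?G - fps_const a * (fps_X * ?G)"
    by (simp add: algebra_simps)
  then show "fps_nth (fps_X * fps_deriv (1 - fps_const a * fps_X)) n
      = fps_nth (?G * (1 - fps_const a * fps_X)) n"
    by (cases n; cases "n - 1") (auto simp del: fps_deriv_mult)
qed simp

lemma log_deriv_fps_geometric: "log_deriv_fps (\<lambda>n. b ^ n) (Abs_fps (\<lambda>n. b ^ n))"
  unfolding log_deriv_fps_def
proof (intro conjI fps_ext)
  fix n
  have "(\<Sum>i = 0..n. (if i = 0 then 0 else b ^ i) * b ^ (n - i)) = (\<Sum>i\<in>{1..n}. b ^ n)"
    by (rule sum.mono_neutral_cong_right) (auto simp flip: power_add)
  then have "fps_nth (Abs_fps (\<lambda>n. if n = 0 then 0 else b ^ n) * Abs_fps (\<lambda>n. b ^ n)) n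
      = of_nat n * b ^ n"
    by (simp add: fps_mult_nth)
  then show "fps_nth (fps_X * fps_deriv (Abs_fps (\<lambda>n. b ^ n))) n
      = fps_nth (Abs_fps (\<lambda>n. if n = 0 then 0 else b ^ n) * Abs_fps (\<lambda>n. b ^ n)) n"
    by (cases n) simp_all
qed simp

lemma log_deriv_fps_coeffs:
  assumes F: "log_deriv_fps g F" and g: "\<And>n. n > 0 \<Longrightarrow> h (int n) = g n"
    and f: "\<And>n. f (int n) = fps_nth F n" "\<And>n. n < 0 \<Longrightarrow> f n = 0"
  shows "log_deriv_coeffs h f"
  unfolding log_deriv_coeffs_def
proof (intro conjI allI impI)
  show "f 0 = 1" using f(1)[of 0] F by (simp add: log_deriv_fps_def)
  fix N n :: int assume nN: "n \<le> N"
  show "of_int n * f n = (\<Sum>k\<in>{1..N}. h k * f (n - k))"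
  proof (cases "n < 0")
    case True
    then show ?thesis by (auto simp: f intro!: sum.neutral[symmetric])
  next
    case False
    define m where "m = nat n"
    have m: "n = int m" using False by (simp add: m_def)
    have "fps_nth (fps_X * fps_deriv F) m = of_nat m * fps_nth F m"
      by (cases m) simp_all
    then have "of_int n * f n = fps_nth (fps_X * fps_deriv F) m"
      by (simp add: m f(1))
    also have "\<dots> = (\<Sum>i = 0..m. (if i = 0 then 0 else g i) * fps_nth F (m - i))"
      using F by (simp add: log_deriv_fps_def fps_mult_nth)
    also have "\<dots> = (\<Sum>i\<in>{1..m}. g i * fps_nth F (m - i))"
      by (rule sum.mono_neutral_cong_right) auto
    also have "\<dots> = (\<Sum>k\<in>{1..n}. h k * f (n - k))"
      by (rule sum.reindex_bij_witness[of _ nat int])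
         (auto simp: m g f(1)[symmetric] of_nat_diff)
    also have "\<dots> = (\<Sum>k\<in>{1..N}. h k * f (n - k))"
      using nN by (intro sum.mono_neutral_left) (auto simp: f(2))
    finally show ?thesis .
  qed
qed (use f in auto)

text \<open>The coefficients of \<open>(1 - a x) / (1 - b x)\<close> at \<open>x = 0\<close>.\<close>

definition moebius_coeff :: "complex \<Rightarrow> complex \<Rightarrow> int \<Rightarrow> complex" where
  "moebius_coeff a b n = (if n < 0 then 0 else if n = 0 then 1 else (b - a) * b powi (n - 1))"

lemma log_deriv_moebius:
  assumes "\<And>n. n > 0 \<Longrightarrow> h (int n) = b ^ n - a ^ n"
  shows "log_deriv_coeffs h (moebius_coeff a b)"
proof (rule log_deriv_fps_coeffs[OF log_deriv_fps_mult[OF log_deriv_fps_linear[of a] log_deriv_fps_geometric[of b]]])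
  let ?B = "Abs_fps (\<lambda>n. b ^ n)"
  have "(1 - fps_const a * fps_X) * ?B = ?B - fps_const a * (fps_X * ?B)"
    by (simp add: algebra_simps)
  then show "moebius_coeff a b (int n) = fps_nth ((1 - fps_const a * fps_X) * ?B) n" for n
    by (cases n) (auto simp: moebius_coeff_def algebra_simps)
qed (auto simp: assms moebius_coeff_def)

text \<open>Two Moebius functions in \<open>x\<close> and \<open>1/x\<close> that are, up to the factors \<open>\<alpha>\<close> and \<open>\<alpha>'\<close>, one rational
  function with its pole at \<open>x = 1/b\<close> differ as series by a multiple of the delta series
  \<open>\<Sum>\<^sub>j b\<^sup>j x\<^sup>j\<close>. The hypotheses compare the coefficients at \<open>j = 0\<close>, \<open>j = 1\<close> and \<open>j = -1\<close>.\<close>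

lemma moebius_delta:
  assumes "b * b' = 1" "\<alpha> - \<alpha>' = \<Delta>" "\<alpha> * (b - a) = \<Delta> * b" "\<alpha>' * (b' - a') = - \<Delta> * b'"
  shows "\<alpha> * moebius_coeff a b j - \<alpha>' * moebius_coeff a' b' (- j) = \<Delta> * b' powi (- j)"
proof -
  have b: "b \<noteq> 0" "b' = inverse b" using assms(1) by (auto simp: inverse_unique)
  consider "j > 0" | "j = 0" | "j < 0" by linarith
  then show ?thesis
  proof cases
    case 1
    have "\<alpha> * ((b - a) * b powi (j - 1)) = \<Delta> * b * b powi (j - 1)"
      by (metis assms(3) mult.assoc)
    also have "\<dots> = \<Delta> * b powi j" using b by (simp add: power_int_diff)
    finally show ?thesis using 1 b by (simp add: moebius_coeff_def power_int_minus power_int_inverse)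
  next
    case 2
    then show ?thesis using assms(2) by (simp add: moebius_coeff_def)
  next
    case 3
    have "\<alpha>' * ((b' - a') * b' powi (- j - 1)) = - \<Delta> * b' * b' powi (- j - 1)"
      by (metis assms(4) mult.assoc)
    also have "\<dots> = - \<Delta> * b' powi (- j)" using b by (simp add: power_int_diff)
    finally show ?thesis using 3 by (simp add: moebius_coeff_def)
  qed
qed

text \<open>The coefficients of \<open>(1 - a x) (1 - b x) (1 - c x) (1 - d x)\<close>.\<close>

definition quartic_coeff :: "complex \<Rightarrow> complex \<Rightarrow> complex \<Rightarrow> complex \<Rightarrow> int \<Rightarrow> complex" where
  "quartic_coeff a b c d n =
     (if n = 0 then 1 else if n = 1 then - (a + b + c + d)
      else if n = 2 then a * b + a * c + a * d + b * c + b * d + c * d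
      else if n = 3 then - (a * b * c + a * b * d + a * c * d + b * c * d)
      else if n = 4 then a * b * c * d else 0)"

lemma log_deriv_quartic:
  assumes "\<And>n. n > 0 \<Longrightarrow> h (int n) = - (a ^ n) - b ^ n - c ^ n - d ^ n"
  shows "log_deriv_coeffs h (quartic_coeff a b c d)"
proof (rule log_deriv_fps_coeffs[OF log_deriv_fps_mult[OF log_deriv_fps_mult[OF
        log_deriv_fps_linear[of a] log_deriv_fps_linear[of b]]
        log_deriv_fps_mult[OF log_deriv_fps_linear[of c] log_deriv_fps_linear[of d]]]])
  let ?P = "(1 - fps_const a * fps_X) * (1 - fps_const b * fps_X) *
            ((1 - fps_const c * fps_X) * (1 - fps_const d * fps_X))"
  have "?P = 1 - fps_const (a + b + c + d) * fps_X
      + fps_const (a * b + a * c + a * d + b * c + b * d + c * d) * fps_X ^ 2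
      - fps_const (a * b * c + a * b * d + a * c * d + b * c * d) * fps_X ^ 3
      + fps_const (a * b * c * d) * fps_X ^ 4"
    by (simp add: algebra_simps power2_eq_square power3_eq_cube power4_eq_xxxx
          flip: fps_const_add fps_const_mult)
  then show "quartic_coeff a b c d (int n) = fps_nth ?P n" for n
    by (simp add: quartic_coeff_def fps_X_power_nth)
qed (auto simp: assms quartic_coeff_def)

lemma sign_power:
  fixes q :: complex
  assumes "is_sign \<sigma>"
  shows "q powi (\<sigma> * s * int n) = ((q powi \<sigma>) ^ n) powi s"
proof -
  have "q powi (\<sigma> * s * int n) = q powi (\<sigma> * int n * s)" by (simp add: mult_ac)
  then show ?thesis by (simp only: power_int_mult power_int_of_nat)
qed

text \<open>The logarithmic derivative of the contraction, in terms of \<open>u = q\<^bsup>\<sigma>n\<^esup>\<close> and \<open>v = d\<^bsup>\<sigma>n\<^esup>\<close>. The first two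
  summands come from equal indices and the last one from different indices. The quotient
  \<open>(v + 1/v) / (u + 1/u)\<close> is \<open>(q\<^sub>1\<^sup>n + q\<^sub>3\<^sup>n) / (1 + q\<^sub>2\<^sup>-\<^sup>n)\<close>, which is invariant under
  \<open>q \<mapsto> 1/q\<close> and under \<open>d \<mapsto> 1/d\<close>; therefore the result depends on \<open>\<sigma>\<close> only through \<open>u\<close> and \<open>v\<close>.\<close>

lemma coeff_pairing_pair_coeffs:
  assumes \<sigma>: "is_sign \<sigma>" and nz: "q \<noteq> 0" "d \<noteq> 0" and n: "n > 0"
    and u: "u = (q powi \<sigma>) ^ n" and v: "v = (d powi \<sigma>) ^ n"
    and un: "u * u + 1 \<noteq> 0" and \<xi>: "\<xi> \<noteq> 0"
  shows "of_int (int n) * coeff_pairing q d (pair_coeffs q (\<sigma> * s) (\<sigma> * t) \<xi>) (pair_coeffs q (\<sigma> * s') (\<sigma> * t') \<eta>) (int n)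
     = - of_int (s * s') * u powi (s - s') * \<eta> ^ n / \<xi> ^ n - of_int (t * t') * u powi (t - t')
       + (v + 1 / v) / (u + 1 / u) * (of_int (s * t') * u powi (s - t') / \<xi> ^ n
                                     + of_int (t * s') * u powi (t - s') * \<eta> ^ n)"
proof -
  have uv: "u \<noteq> 0" "v \<noteq> 0" using nz by (auto simp: u v)
  define P where "P = (v + 1 / v) / (u + 1 / u)"
  have off: "heis_pairing q d i j (int n) = - of_nat n * P" if "i \<noteq> j" for i j
  proof -
    define x y where "x = q ^ n" and "y = d ^ n"
    have xy: "x \<noteq> 0" "y \<noteq> 0" using nz by (auto simp: x_def y_def)
    have "q1 q d powi int n = y / x" "q3 q d powi int n = 1 / (x * y)" "q2 q d powi (- int n) = 1 / (x * x)"
      by (simp_all add: q1_def q2_def q3_def x_def y_def power_mult_distrib power_inverse power_int_minus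
           field_simps power2_eq_square)
    then have pairing: "heis_pairing q d i j (int n) = - of_nat n * ((y / x + 1 / (x * y)) / (1 + 1 / (x * x)))"
      using that by (simp add: heis_pairing_def)
    have uv': "(u = x \<and> v = y) \<or> (u = 1 / x \<and> v = 1 / y)"
      using \<sigma> by (auto simp: u v x_def y_def power_int_minus power_inverse inverse_eq_divide power_one_over)
    then have "u = x \<or> u = 1 / x" by blast
    moreover have "x * x + 1 = x * x * (u * u + 1)" if "u = 1 / x"
      unfolding that using xy by (simp add: field_simps)
    ultimately have "x * x + 1 \<noteq> 0" using un xy by (metis mult_eq_0_iff)
    then have "(y / x + 1 / (x * y)) / (1 + 1 / (x * x)) = (y + 1 / y) / (x + 1 / x)"
      using xy by (simp add: divide_simps)
    moreover have "(y + 1 / y) / (x + 1 / x) = (v + 1 / v) / (u + 1 / u)"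
      using uv' by (auto simp: add.commute)
    ultimately show ?thesis using pairing by (simp add: P_def)
  qed
  have c1: "pair_coeffs q (\<sigma> * s) (\<sigma> * t) \<xi> I1 (int n) = - of_int (\<sigma> * s) * u powi s / (of_nat n * \<xi> ^ n)"
    and c2: "pair_coeffs q (\<sigma> * s) (\<sigma> * t) \<xi> I2 (int n) = - of_int (\<sigma> * t) * u powi t / of_nat n" for s t \<xi>
    by (simp_all add: pair_coeffs_def add_coeffs_def vertex_coeffs_def sign_power[OF \<sigma>, unfolded mult.assoc]
          u power_int_minus field_simps)
  have c3: "pair_coeffs q (\<sigma> * s) (\<sigma> * t) \<xi> I1 (- int n) = of_int (\<sigma> * s) * u powi (- s) * \<xi> ^ n / of_nat n"
    and c4: "pair_coeffs q (\<sigma> * s) (\<sigma> * t) \<xi> I2 (- int n) = of_int (\<sigma> * t) * u powi (- t) / of_nat n" for s t \<xi>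
    by (simp_all add: pair_coeffs_def add_coeffs_def vertex_coeffs_def sign_power[OF \<sigma>, unfolded mult.assoc]
          u power_int_minus field_simps)
  have \<sigma>\<sigma>: "complex_of_int \<sigma> * complex_of_int \<sigma> = 1" using \<sigma> by auto
  have n0: "complex_of_nat n \<noteq> 0" using n by simp
  have "of_int (int n) * coeff_pairing q d (pair_coeffs q (\<sigma> * s) (\<sigma> * t) \<xi>) (pair_coeffs q (\<sigma> * s') (\<sigma> * t') \<eta>) (int n)
    = (of_int \<sigma> * of_int \<sigma>) * (- of_int (s * s') * u powi (s - s') * \<eta> ^ n / \<xi> ^ n - of_int (t * t') * u powi (t - t')
       + P * (of_int (s * t') * u powi (s - t') / \<xi> ^ n + of_int (t * s') * u powi (t - s') * \<eta> ^ n))"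
    unfolding coeff_pairing_def c1 c2 c3 c4 off[of I1 I2, OF idx.distinct(1)] off[of I2 I1, OF idx.distinct(2)]
    using n0 uv(1) \<xi>
    by (simp add: heis_pairing_def power_int_diff power_int_minus) (simp add: field_simps)
  then show ?thesis unfolding \<sigma>\<sigma> P_def by simp
qed


section \<open>Contractions of the summands of the current\<close>

text \<open>The sequence \<open>f\<close> consists of the coefficients of the scalar series that arises when the annihilation half of
  \<open>:\<Lambda>\<^sub>1\<^sup>s(\<xi> z) \<Lambda>\<^sub>2\<^sup>t(z):\<close> is moved past the creation half of the corresponding series for \<open>s', t', \<eta>\<close>.\<close>

definition contraction ::
  "complex \<Rightarrow> complex \<Rightarrow> int \<Rightarrow> int \<Rightarrow> complex \<Rightarrow> int \<Rightarrow> int \<Rightarrow> complex \<Rightarrow> (int \<Rightarrow> complex) \<Rightarrow> bool" where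
  "contraction q d s t \<xi> s' t' \<eta> f \<longleftrightarrow>
     log_deriv_coeffs (\<lambda>n. of_int n * coeff_pairing q d (pair_coeffs q s t \<xi>) (pair_coeffs q s' t' \<eta>) n) f"

text \<open>The sign \<open>\<sigma>\<close> distinguishes the two commutators. For each of them, the two choices of \<open>D\<close> give the two
  orders of the factors, since \<open>D \<mapsto> 1/D\<close> exchanges \<open>D/Q\<close> with \<open>1/(DQ)\<close>. The condition
  \<open>no_root\<close> keeps the denominators in the pairing away from zero.\<close>

locale sign_parameters =
  fixes q d :: complex and \<sigma> :: int and Q D :: complex
  assumes nz: "q \<noteq> 0" "d \<noteq> 0" and \<sigma>: "is_sign \<sigma>"
    and Q: "Q = q powi \<sigma>" and D: "D = d powi \<sigma> \<or> D = inverse (d powi \<sigma>)"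
    and no_root: "\<And>n. n > 0 \<Longrightarrow> Q ^ n * Q ^ n \<noteq> -1"
begin

lemma QD_nz: "Q \<noteq> 0" "D \<noteq> 0"
  using Q D nz by auto

lemma pairing_value:
  assumes "n > 0"
  shows "of_int (int n) * coeff_pairing q d (pair_coeffs q (\<sigma> * s) (\<sigma> * t) (D / Q))
            (pair_coeffs q (\<sigma> * s') (\<sigma> * t') (1 / (D * Q))) (int n)
     = - of_int (s * s') * (Q ^ n) powi (s - s') / (D ^ n * D ^ n) - of_int (t * t') * (Q ^ n) powi (t - t')
       + (D ^ n + 1 / D ^ n) / (Q ^ n + 1 / Q ^ n)
         * (of_int (s * t') * (Q ^ n) powi (s - t' + 1) / D ^ n
            + of_int (t * s') * (Q ^ n) powi (t - s' - 1) / D ^ n)"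
proof -
  have un: "Q ^ n * Q ^ n + 1 \<noteq> 0" using no_root[OF assms] by (simp add: add_eq_0_iff2)
  have "(d powi \<sigma>) ^ n + 1 / (d powi \<sigma>) ^ n = D ^ n + 1 / D ^ n"
    using D by (auto simp: power_inverse field_simps)
  note general = coeff_pairing_pair_coeffs[OF \<sigma> nz assms arg_cong[OF Q, of "\<lambda>x. x ^ n"] refl un, of "D / Q"
        s t s' t' "1 / (D * Q)", unfolded this]
  have e1: "x * (1 / (D * Q)) ^ n / (D / Q) ^ n = x / (D ^ n * D ^ n)" for x
    using QD_nz by (simp add: power_divide power_mult_distrib)
  have e2: "c * (Q ^ n) powi k / (D / Q) ^ n = c * (Q ^ n) powi (k + 1) / D ^ n" for c k
    using QD_nz by (simp add: power_divide power_int_add)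
  have e3: "c * (Q ^ n) powi k * (1 / (D * Q)) ^ n = c * (Q ^ n) powi (k - 1) / D ^ n" for c k
    using QD_nz by (simp add: power_divide power_mult_distrib power_int_diff)
  have "D / Q \<noteq> 0" using QD_nz by simp
  from general[OF this] show ?thesis by (simp only: e1) (simp only: e2 e3)
qed

lemma QD_powers: "Q ^ n \<noteq> 0" "D ^ n \<noteq> 0" "n > 0 \<Longrightarrow> Q ^ n * Q ^ n + 1 \<noteq> 0"
  using QD_nz no_root[of n] by (auto simp: add_eq_0_iff2)

text \<open>A contraction with Moebius coefficients is recognized from an identity of rational functions in \<open>u = Q\<^sup>n\<close> and
  \<open>v = D\<^sup>n\<close> that does not depend on \<open>n\<close>: the denominators from the pairing have to cancel, and the
  left-hand side has to collapse to \<open>b\<^sup>n - a\<^sup>n\<close>, where \<open>a\<close> and \<open>b\<close> are multiplicative in \<open>u\<close> and \<open>v\<close>.\<close>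

lemma contraction_moebius:
  assumes "\<And>u v. u \<noteq> 0 \<Longrightarrow> v \<noteq> 0 \<Longrightarrow> u * u + 1 \<noteq> 0 \<Longrightarrow>
     - of_int (s * s') * u powi (s - s') / (v * v) - of_int (t * t') * u powi (t - t')
       + (v + 1 / v) / (u + 1 / u)
         * (of_int (s * t') * u powi (s - t' + 1) / v + of_int (t * s') * u powi (t - s' - 1) / v)
     = b u v - a u v"
    and "\<And>n. a (Q ^ n) (D ^ n) = a Q D ^ n" "\<And>n. b (Q ^ n) (D ^ n) = b Q D ^ n"
  shows "contraction q d (\<sigma> * s) (\<sigma> * t) (D / Q) (\<sigma> * s') (\<sigma> * t') (1 / (D * Q)) (moebius_coeff (a Q D) (b Q D))"
  unfolding contraction_def
proof (rule log_deriv_moebius)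
  fix n :: nat assume n: "n > 0"
  show "of_int (int n) * coeff_pairing q d (pair_coeffs q (\<sigma> * s) (\<sigma> * t) (D / Q))
            (pair_coeffs q (\<sigma> * s') (\<sigma> * t') (1 / (D * Q))) (int n) = b Q D ^ n - a Q D ^ n"
    unfolding pairing_value[OF n] using assms(1)[OF QD_powers(1,2) QD_powers(3)[OF n]] assms(2,3)
    by simp
qed

lemma contraction_neutral:
  assumes "s = 1 \<or> s = -1" "s' = 1 \<or> s' = -1"
  shows "contraction q d (\<sigma> * s) (\<sigma> * s) (D / Q) (\<sigma> * s') (\<sigma> * s') (1 / (D * Q)) (moebius_coeff 1 1)"
proof (rule contraction_moebius[where a = "\<lambda>u v. 1" and b = "\<lambda>u v. 1"])
  fix u v :: complex assume uv: "u \<noteq> 0" "v \<noteq> 0" "u * u + 1 \<noteq> 0"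
  have u2: "(v + 1 / v) / (u + 1 / u) = (v * v + 1) * u / ((u * u + 1) * v)"
    using uv by (simp add: divide_simps)
  show "- of_int (s * s') * u powi (s - s') / (v * v) - of_int (s * s') * u powi (s - s')
       + (v + 1 / v) / (u + 1 / u)
         * (of_int (s * s') * u powi (s - s' + 1) / v + of_int (s * s') * u powi (s - s' - 1) / v) = 1 - 1"
    unfolding u2 using assms uv
    by (elim disjE; simp add: power_int_minus divide_simps power_numeral_reduce; simp add: algebra_simps)
qed auto

text \<open>In the names of the next lemmas, \<open>p\<close> and \<open>m\<close> are signs relative to \<open>\<sigma>\<close> (plus and minus), first those of the left factor, then
  those of the right one. Each case is one rational identity in \<open>u\<close> and \<open>v\<close>.\<close>

lemma contraction_pp_pm:
  "contraction q d \<sigma> \<sigma> (D / Q) \<sigma> (- \<sigma>) (1 / (D * Q)) (moebius_coeff (Q * Q / (D * D)) 1)"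
proof -
  have "contraction q d (\<sigma> * 1) (\<sigma> * 1) (D / Q) (\<sigma> * 1) (\<sigma> * -1) (1 / (D * Q)) (moebius_coeff (Q * Q / (D * D)) 1)"
  proof (rule contraction_moebius[where a = "\<lambda>u v. u * u / (v * v)" and b = "\<lambda>u v. 1"], goal_cases)
    case (1 u v)
    then have u2: "(v + 1 / v) / (u + 1 / u) = (v * v + 1) * u / ((u * u + 1) * v)"
      by (simp add: divide_simps)
    show ?case unfolding u2 using 1
      by (simp add: power_int_minus divide_simps power_numeral_reduce) algebra
  qed (auto simp: power_divide power_mult_distrib)
  then show ?thesis by simp
qed

lemma contraction_pm_pp:
  "contraction q d \<sigma> (- \<sigma>) (D / Q) \<sigma> \<sigma> (1 / (D * Q)) (moebius_coeff (1 / (Q * Q * D * D)) 1)"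
proof -
  have "contraction q d (\<sigma> * 1) (\<sigma> * -1) (D / Q) (\<sigma> * 1) (\<sigma> * 1) (1 / (D * Q)) (moebius_coeff (1 / (Q * Q * D * D)) 1)"
  proof (rule contraction_moebius[where a = "\<lambda>u v. 1 / (u * u * v * v)" and b = "\<lambda>u v. 1"], goal_cases)
    case (1 u v)
    then have u2: "(v + 1 / v) / (u + 1 / u) = (v * v + 1) * u / ((u * u + 1) * v)"
      by (simp add: divide_simps)
    show ?case unfolding u2 using 1
      by (simp add: power_int_minus divide_simps power_numeral_reduce) algebra
  qed (auto simp: power_divide power_mult_distrib)
  then show ?thesis by simp
qed

lemma contraction_mm_pm:
  "contraction q d (- \<sigma>) (- \<sigma>) (D / Q) \<sigma> (- \<sigma>) (1 / (D * Q)) (moebius_coeff (1 / (Q * Q)) (1 / (D * D)))"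
proof -
  have "contraction q d (\<sigma> * -1) (\<sigma> * -1) (D / Q) (\<sigma> * 1) (\<sigma> * -1) (1 / (D * Q)) (moebius_coeff (1 / (Q * Q)) (1 / (D * D)))"
  proof (rule contraction_moebius[where a = "\<lambda>u v. 1 / (u * u)" and b = "\<lambda>u v. 1 / (v * v)"], goal_cases)
    case (1 u v)
    then have u2: "(v + 1 / v) / (u + 1 / u) = (v * v + 1) * u / ((u * u + 1) * v)"
      by (simp add: divide_simps)
    show ?case unfolding u2 using 1
      by (simp add: power_int_minus divide_simps power_numeral_reduce) algebra
  qed (auto simp: power_divide power_mult_distrib)
  then show ?thesis by simp
qed

lemma contraction_pm_mm:
  "contraction q d \<sigma> (- \<sigma>) (D / Q) (- \<sigma>) (- \<sigma>) (1 / (D * Q)) (moebius_coeff (Q * Q) (1 / (D * D)))"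
proof -
  have "contraction q d (\<sigma> * 1) (\<sigma> * -1) (D / Q) (\<sigma> * -1) (\<sigma> * -1) (1 / (D * Q)) (moebius_coeff (Q * Q) (1 / (D * D)))"
  proof (rule contraction_moebius[where a = "\<lambda>u v. u * u" and b = "\<lambda>u v. 1 / (v * v)"], goal_cases)
    case (1 u v)
    then have u2: "(v + 1 / v) / (u + 1 / u) = (v * v + 1) * u / ((u * u + 1) * v)"
      by (simp add: divide_simps)
    show ?case unfolding u2 using 1
      by (simp add: power_int_minus divide_simps power_numeral_reduce) algebra
  qed (auto simp: power_divide power_mult_distrib)
  then show ?thesis by simp
qed

text \<open>Here the denominators of the pairing cancel as well, and no poles remain.\<close>

lemma contraction_pm_pm:
  "contraction q d \<sigma> (- \<sigma>) (D / Q) \<sigma> (- \<sigma>) (1 / (D * Q))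
     (quartic_coeff (Q * Q) (Q * Q / (D * D)) (1 / (Q * Q)) (1 / (Q * Q * D * D)))"
  unfolding contraction_def
proof (rule log_deriv_quartic)
  fix n :: nat assume n: "n > 0"
  define u v where "u = Q ^ n" and "v = D ^ n"
  have uv: "u \<noteq> 0" "v \<noteq> 0" "u * u + 1 \<noteq> 0"
    using QD_powers n by (auto simp: u_def v_def)
  then have u2: "(v + 1 / v) / (u + 1 / u) = (v * v + 1) * u / ((u * u + 1) * v)"
    by (simp add: divide_simps)
  show "of_int (int n) * coeff_pairing q d (pair_coeffs q \<sigma> (- \<sigma>) (D / Q))
            (pair_coeffs q \<sigma> (- \<sigma>) (1 / (D * Q))) (int n)
     = - ((Q * Q) ^ n) - (Q * Q / (D * D)) ^ n - (1 / (Q * Q)) ^ n - (1 / (Q * Q * D * D)) ^ n"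
    using pairing_value[OF n, of 1 "-1" 1 "-1"] uv u2
    unfolding power_divide power_mult_distrib u_def[symmetric] v_def[symmetric] power_one
    by (simp add: power_int_minus power_numeral_reduce) (simp add: divide_simps, simp add: algebra_simps)
qed

end


section \<open>Commutators of products of two vertex operators\<close>

text \<open>The normally ordered product of four vertex operators is insensitive to their order, so at \<open>w = p z\<close>
  two operators with the same index may exchange their signs as soon as their arguments agree. For the
  index 2 both arguments are \<open>z\<close> if \<open>p = 1\<close>; for the index 1 they are \<open>\<xi> z\<close> and \<open>\<eta> p z\<close>.\<close>

lemma fused_coeffs_swap_second:
  "add_coeffs (pair_coeffs q s t \<xi>) (dilate 1 (pair_coeffs q s' t' \<eta>))
     = add_coeffs (pair_coeffs q s t' \<xi>) (dilate 1 (pair_coeffs q s' t \<eta>))"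
  by (intro ext, rename_tac i n, case_tac i)
     (auto simp: add_coeffs_def dilate_def pair_coeffs_def vertex_coeffs_def)

lemma fused_coeffs_swap_first:
  assumes "\<xi> = p * \<eta>"
  shows "add_coeffs (pair_coeffs q s t \<xi>) (dilate p (pair_coeffs q s' t' \<eta>))
     = add_coeffs (pair_coeffs q s' t \<xi>) (dilate p (pair_coeffs q s t' \<eta>))"
  unfolding assms
  by (intro ext, rename_tac i n, case_tac i)
     (auto simp: add_coeffs_def dilate_def pair_coeffs_def vertex_coeffs_def power_int_mult_distrib algebra_simps)

context heisenberg_module
begin

text \<open>The part of \<open>:\<Lambda>\<^sub>1\<^sup>s \<Lambda>\<^sub>2\<^sup>t:\<close> made of \<open>e\<^sup>Q\<close> and \<open>q\<^sub>1\<^sup>a\<close>.\<close>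

definition twist :: "complex \<Rightarrow> int \<Rightarrow> int \<Rightarrow> 'v \<Rightarrow> 'v" where
  "twist l s t w = shift s (shift (- t) (apow l (s + t) w))"

lemma lin_twist: "lin (twist l s t)"
  unfolding twist_def by (intro lin_compose[OF lin_shift lin_compose[OF lin_shift lin_apow]])

lemma twist_hmode: "n \<noteq> 0 \<Longrightarrow> twist l s t (hmode H i n w) = hmode H i n (twist l s t w)"
  by (simp add: twist_def apow_hmode shift_hmode)

lemma charge_twist:
  assumes "charge c w" "is_sign s" "is_sign t"
  shows "charge (c + (s - t)) (twist l s t w)"
  using charge_shift[OF charge_shift[OF charge_apow[OF assms(1)], of "- t"] assms(2)] assms(3)
  by (auto simp: twist_def algebra_simps)

lemma twist_commute: "twist l s t (twist l s' t' w) = twist l s' t' (twist l s t w)"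
proof -
  have "shift a (shift b v) = shift b (shift a v)" for a b v
    using fun_cong[OF Q_Q[of I1 I2], of v] by (auto simp: shift_def comm_def)
  then have sh: "shift a (shift b (shift a' (shift b' v))) = shift a' (shift b' (shift a (shift b v)))" for a b a' b' v
    by metis
  show ?thesis by (simp add: twist_def apow_shift apow_apow sh add.commute)
qed

text \<open>The right factor raises the charge by \<open>s' - t'\<close> before the left factor sees it; this produces the factor
  \<open>\<xi>\<^bsup>s(s' - t')\<^esup>\<close> and the shift of the first index by \<open>(s - t) (s' - t')\<close>.\<close>

lemma vpair_vpair:
  assumes s: "is_sign s" "is_sign t" "is_sign s'" "is_sign t'" and q: "q \<noteq> 0"
    and f: "contraction q d s t \<xi> s' t' \<eta> f"
    and u: "charge c u" "annihilated_above M u"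
    and J: "J \<ge> n - (s' - t') * c + M" "J \<ge> 0"
  shows "vpair l s t \<xi> m (vpair l s' t' \<eta> n u) =
    (\<xi> powi (s * (c + (s' - t'))) * \<eta> powi (s' * c)) *s twist l s t (twist l s' t'
      (\<Sum>j\<in>{0..J}. f j *s vop2 M (pair_coeffs q s t \<xi>) (pair_coeffs q s' t' \<eta>)
          (m - (s - t) * (c + (s' - t')) + j) (n - (s' - t') * c - j) u))"
proof -
  let ?\<alpha> = "pair_coeffs q s t \<xi>" and ?\<rho> = "pair_coeffs q s' t' \<eta>"
  define b where "b = n - (s' - t') * c"
  define a where "a = m - (s - t) * (c + (s' - t'))"
  define w where "w = vop M ?\<rho> b u"
  obtain K0 where K0: "annihilated_above K0 (twist l s' t' w)" using annihilated_above_exists by blast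
  define K where "K = max K0 (M + J)"
  have K: "annihilated_above K (twist l s' t' w)"
    using K0 by (rule annihilated_above_mono) (simp add: K_def)
  have cw: "charge (c + (s' - t')) (twist l s' t' w)"
    unfolding w_def by (intro charge_twist charge_vop u s)
  have "vpair l s' t' \<eta> n u = \<eta> powi (s' * c) *s twist l s' t' w"
    using vpair_charge[OF s(3,4) q u] by (simp add: twist_def w_def b_def)
  moreover have "vpair l s t \<xi> m (twist l s' t' w)
      = \<xi> powi (s * (c + (s' - t'))) *s twist l s t (vop K ?\<alpha> a (twist l s' t' w))"
    using vpair_charge[OF s(1,2) q cw K] by (simp add: twist_def a_def)
  moreover have "vop K ?\<alpha> a (twist l s' t' w) = twist l s' t' (vop K ?\<alpha> a w)"
    by (rule vop_commute[symmetric]) (auto simp: lin_twist twist_hmode)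
  moreover have "vop K ?\<alpha> a w = (\<Sum>j\<in>{0..J}. f j *s vop2 M ?\<alpha> ?\<rho> (a + j) (b - j) u)"
    unfolding w_def using f J u(2) by (intro vop_vop) (auto simp: contraction_def b_def K_def)
  ultimately show ?thesis
    by (simp add: lin_scale[OF lin_vpair[OF s(1,2) q]] a_def b_def mult.commute)
qed

text \<open>If one of the factors preserves the charge, both orders involve the same normally ordered products, and the
  commutator is governed by the difference of the two scalar expansions. By hypothesis this difference is
  a multiple of the delta series at \<open>w = p z\<close>, so \<open>vop2_fusion\<close> evaluates the sum.\<close>

lemma comm_vpair_delta:
  assumes s: "is_sign s" "is_sign t" "is_sign s'" "is_sign t'"
    and nz: "q \<noteq> 0" "\<xi> \<noteq> 0" "\<eta> \<noteq> 0" "p \<noteq> 0"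
    and f: "contraction q d s t \<xi> s' t' \<eta> f" and f': "contraction q d s' t' \<eta> s t \<xi> f'"
    and orth: "(s - t) * (s' - t') = 0"
    and delta: "\<And>j. \<xi> powi (s * (s' - t')) * f j - \<eta> powi (s' * (s - t)) * f' (- j) = \<Delta> * p powi (- j)"
    and u: "charge c u" "annihilated_above M u"
  shows "comm (vpair l s t \<xi> m) (vpair l s' t' \<eta> n) u =
    (\<xi> powi (s * c) * \<eta> powi (s' * c) * \<Delta> * p powi ((s' - t') * c - n)) *s twist l s t (twist l s' t'
      (vop M (add_coeffs (pair_coeffs q s t \<xi>) (dilate p (pair_coeffs q s' t' \<eta>)))
         (m + n - (s - t + (s' - t')) * c) u))"
proof -
  let ?\<alpha> = "pair_coeffs q s t \<xi>" and ?\<rho> = "pair_coeffs q s' t' \<eta>"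
  define e e' where "e = s - t" and "e' = s' - t'"
  define a b where "a = m - e * c" and "b = n - e' * c"
  define J where "J = max 0 (max (a + M) (b + M))"
  define G where "G j = vop2 M ?\<alpha> ?\<rho> (a + j) (b - j) u" for j
  define \<theta> where "\<theta> w = twist l s t (twist l s' t' w)" for w
  have \<theta>: "lin \<theta>" unfolding \<theta>_def[abs_def] by (intro lin_compose[OF lin_twist lin_twist])
  have orth': "e * (c + e') = e * c" "e' * (c + e) = e' * c"
    using orth by (auto simp: e_def e'_def algebra_simps)
  have fneg: "f j = 0" "f' j = 0" if "j < 0" for j
    using f f' that by (auto simp: contraction_def log_deriv_coeffs_def)
  have "vpair l s t \<xi> m (vpair l s' t' \<eta> n u)
      = (\<xi> powi (s * (c + e')) * \<eta> powi (s' * c)) *s \<theta> (\<Sum>j\<in>{0..J}. f j *s G j)"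
    using vpair_vpair[OF s nz(1) f u, of n J l m] orth'
    by (simp add: e_def[symmetric] e'_def[symmetric] a_def b_def J_def G_def \<theta>_def)
  also have "(\<Sum>j\<in>{0..J}. f j *s G j) = (\<Sum>j\<in>{-J..J}. f j *s G j)"
    by (rule sum.mono_neutral_left) (auto simp: fneg)
  finally have AB: "vpair l s t \<xi> m (vpair l s' t' \<eta> n u)
      = (\<xi> powi (s * c) * \<eta> powi (s' * c)) *s \<theta> (\<Sum>j\<in>{-J..J}. (\<xi> powi (s * e') * f j) *s G j)"
    using nz by (simp add: distrib_left power_int_add lin_sum[OF \<theta>] lin_scale[OF \<theta>] scale_sum_right mult_ac)
  have "vpair l s' t' \<eta> n (vpair l s t \<xi> m u)
      = (\<eta> powi (s' * (c + e)) * \<xi> powi (s * c)) *s \<theta> (\<Sum>j\<in>{0..J}. f' j *s G (- j))"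
    using vpair_vpair[OF s(3,4,1,2) nz(1) f' u, of m J l n] orth'
    by (simp add: e_def[symmetric] e'_def[symmetric] a_def b_def J_def G_def \<theta>_def
         twist_commute[of l s' t'] vop2_swap[of M ?\<rho>])
  also have "(\<Sum>j\<in>{0..J}. f' j *s G (- j)) = (\<Sum>j\<in>{-J..J}. f' j *s G (- j))"
    by (rule sum.mono_neutral_left) (auto simp: fneg)
  also have "\<dots> = (\<Sum>j\<in>{-J..J}. f' (- j) *s G j)"
    by (rule sum.reindex_bij_witness[of _ uminus uminus]) auto
  finally have BA: "vpair l s' t' \<eta> n (vpair l s t \<xi> m u)
      = (\<xi> powi (s * c) * \<eta> powi (s' * c)) *s \<theta> (\<Sum>j\<in>{-J..J}. (\<eta> powi (s' * e) * f' (- j)) *s G j)"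
    using nz by (simp add: distrib_left power_int_add lin_sum[OF \<theta>] lin_scale[OF \<theta>] scale_sum_right mult_ac)
  have "comm (vpair l s t \<xi> m) (vpair l s' t' \<eta> n) u
      = (\<xi> powi (s * c) * \<eta> powi (s' * c)) *s \<theta> (\<Sum>j\<in>{-J..J}. (\<Delta> * p powi (- j)) *s G j)"
    unfolding comm_def AB BA
    by (simp add: scale_right_diff_distrib[symmetric] lin_diff[OF \<theta>, symmetric] sum_subtractf[symmetric]
         scale_left_diff_distrib[symmetric] delta[folded e_def e'_def] )
  also have "(\<Sum>j\<in>{-J..J}. (\<Delta> * p powi (- j)) *s G j)
      = (\<Delta> * p powi (- b)) *s (\<Sum>j\<in>{-J..J}. p powi (b - j) *s G j)"
  proof -
    have "p powi (- b) * p powi (b - j) = p powi (- j)" for j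
      using nz by (simp flip: power_int_add)
    then show ?thesis by (simp add: scale_sum_right mult.assoc)
  qed
  also have "(\<Sum>j\<in>{-J..J}. p powi (b - j) *s G j) = vop M (add_coeffs ?\<alpha> (dilate p ?\<rho>)) (a + b) u"
    unfolding G_def by (rule vop2_fusion) (auto simp: nz u J_def)
  finally show ?thesis
    by (simp add: \<theta>_def lin_scale[OF lin_twist] a_def b_def e_def e'_def mult_ac algebra_simps)
qed

text \<open>If both factors shift the charge by 2 in the same direction, the zero modes contribute \<open>z\<^sup>4\<close> in one
  order and \<open>w\<^sup>4\<close> in the other. A polynomial \<open>f\<close> of degree 4 makes \<open>z\<^sup>4 f(w/z)\<close> a polynomial in
  \<open>z\<close> and \<open>w\<close>, and by hypothesis the other order gives the same polynomial.\<close>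

lemma comm_vpair_polynomial:
  assumes s: "is_sign s" "is_sign t" "is_sign s'" "is_sign t'"
    and nz: "q \<noteq> 0" "\<xi> \<noteq> 0" "\<eta> \<noteq> 0"
    and f: "contraction q d s t \<xi> s' t' \<eta> f" and f': "contraction q d s' t' \<eta> s t \<xi> f'"
    and four: "(s - t) * (s' - t') = 4"
    and poly: "\<And>j. j > 4 \<Longrightarrow> f j = 0"
    and reverse: "\<And>j. \<xi> powi (s * (s' - t')) * f j = \<eta> powi (s' * (s - t)) * f' (4 - j)"
    and u: "charge c u" "annihilated_above M u"
  shows "comm (vpair l s t \<xi> m) (vpair l s' t' \<eta> n) u = 0"
proof -
  let ?\<alpha> = "pair_coeffs q s t \<xi>" and ?\<rho> = "pair_coeffs q s' t' \<eta>"
  define e e' where "e = s - t" and "e' = s' - t'"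
  define a b where "a = m - e * c" and "b = n - e' * c"
  define J where "J = max 4 (max (a + M) (b + M))"
  define G where "G j = vop2 M ?\<alpha> ?\<rho> (a + j) (b - 4 - j) u" for j
  define \<theta> where "\<theta> w = twist l s t (twist l s' t' w)" for w
  have \<theta>: "lin \<theta>" unfolding \<theta>_def[abs_def] by (intro lin_compose[OF lin_twist lin_twist])
  have four': "e * (c + e') = e * c + 4" "e' * (c + e) = e' * c + 4"
    using four by (auto simp: e_def e'_def algebra_simps)
  have fneg: "f j = 0" "f' j = 0" if "j < 0" for j
    using f f' that by (auto simp: contraction_def log_deriv_coeffs_def)
  have poly': "f' j = 0" if "j > 4" for j
    using reverse[of "4 - j"] that fneg nz by auto
  have "vpair l s t \<xi> m (vpair l s' t' \<eta> n u)
      = (\<xi> powi (s * (c + e')) * \<eta> powi (s' * c)) *s \<theta> (\<Sum>j\<in>{0..J}. f j *s G (j - 4))"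
    using vpair_vpair[OF s nz(1) f u, of n J l m] four'
    by (simp add: e_def[symmetric] e'_def[symmetric] a_def b_def J_def G_def \<theta>_def algebra_simps)
  also have "(\<Sum>j\<in>{0..J}. f j *s G (j - 4)) = (\<Sum>j\<in>{0..4}. f j *s G (j - 4))"
    by (rule sum.mono_neutral_right) (auto simp: poly J_def)
  finally have AB: "vpair l s t \<xi> m (vpair l s' t' \<eta> n u)
      = (\<xi> powi (s * c) * \<eta> powi (s' * c)) *s \<theta> (\<Sum>j\<in>{0..4}. (\<xi> powi (s * e') * f j) *s G (j - 4))"
    using nz by (simp add: distrib_left power_int_add lin_sum[OF \<theta>] lin_scale[OF \<theta>] scale_sum_right mult_ac)
  have "vpair l s' t' \<eta> n (vpair l s t \<xi> m u)
      = (\<eta> powi (s' * (c + e)) * \<xi> powi (s * c)) *s \<theta> (\<Sum>j\<in>{0..J}. f' j *s G (- j))"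
    using vpair_vpair[OF s(3,4,1,2) nz(1) f' u, of m J l n] four'
    by (simp add: e_def[symmetric] e'_def[symmetric] a_def b_def J_def G_def \<theta>_def
         twist_commute[of l s' t'] vop2_swap[of M ?\<rho>] algebra_simps)
  also have "(\<Sum>j\<in>{0..J}. f' j *s G (- j)) = (\<Sum>j\<in>{0..4}. f' j *s G (- j))"
    by (rule sum.mono_neutral_right) (auto simp: poly' J_def)
  also have "\<dots> = (\<Sum>j\<in>{0..4}. f' (4 - j) *s G (j - 4))"
    by (rule sum.reindex_bij_witness[of _ "\<lambda>j. 4 - j" "\<lambda>j. 4 - j"]) auto
  finally have BA: "vpair l s' t' \<eta> n (vpair l s t \<xi> m u)
      = (\<xi> powi (s * c) * \<eta> powi (s' * c)) *s \<theta> (\<Sum>j\<in>{0..4}. (\<eta> powi (s' * e) * f' (4 - j)) *s G (j - 4))"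
    using nz by (simp add: distrib_left power_int_add lin_sum[OF \<theta>] lin_scale[OF \<theta>] scale_sum_right mult_ac)
  show ?thesis
    unfolding comm_def AB BA by (simp add: reverse[folded e_def e'_def])
qed

lemma comm_combination:
  assumes "lin A1" "lin A2" "lin A3" "lin B1" "lin B2" "lin B3"
  shows "comm (\<lambda>v. a1 *s A1 v + a2 *s A2 v + a3 *s A3 v) (\<lambda>v. b1 *s B1 v + b2 *s B2 v + b3 *s B3 v) u
    = (a1 * b1) *s comm A1 B1 u + (a1 * b2) *s comm A1 B2 u + (a2 * b1) *s comm A2 B1 u
    + (a2 * b2) *s comm A2 B2 u + (a3 * b3) *s comm A3 B3 u
    + ((a1 * b3) *s comm A1 B3 u + (a3 * b1) *s comm A3 B1 u)
    + ((a2 * b3) *s comm A2 B3 u + (a3 * b2) *s comm A3 B2 u)"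
proof -
  have "comm A (\<lambda>v. b1 *s B1 v + b2 *s B2 v + b3 *s B3 v) u
      = b1 *s comm A B1 u + b2 *s comm A B2 u + b3 *s comm A B3 u" if "lin A" for A
    by (simp add: comm_def lin_add[OF that] lin_scale[OF that] scale_right_diff_distrib)
  moreover have "comm (\<lambda>v. a1 *s A1 v + a2 *s A2 v + a3 *s A3 v) B u
      = a1 *s comm A1 B u + a2 *s comm A2 B u + a3 *s comm A3 B u" if "lin B" for B
    by (simp add: comm_def lin_add[OF that] lin_scale[OF that] scale_right_diff_distrib)
  moreover have "lin (\<lambda>v. b1 *s B1 v + b2 *s B2 v + b3 *s B3 v)"
    using assms by (intro lin_comb lin_scaled)
  ultimately show ?thesis
    using assms by (simp add: scale_right_distrib ac_simps)
qed

section \<open>Commutativity of the currents\<close>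

text \<open>The three summands that remain of \<open>T\<close> at the arguments in question, in terms of \<open>Q = q\<^sup>\<sigma>\<close> and \<open>D = d\<^sup>\<sigma>\<close>.\<close>

definition current :: "complex \<Rightarrow> int \<Rightarrow> complex \<Rightarrow> complex \<Rightarrow> complex \<Rightarrow> 'v oseries" where
  "current l \<sigma> Q D \<xi> m v = Q *s vpair l \<sigma> \<sigma> \<xi> m v + inverse Q *s vpair l (- \<sigma>) (- \<sigma>) \<xi> m v
     + (Q * (1 - D / Q * \<xi>) * (1 - 1 / (D * Q) * \<xi>)) *s vpair l \<sigma> (- \<sigma>) \<xi> (m - 2) v"

text \<open>The nine commutators of the summands. The numbers in the names of the steps refer to the summands with the signs
  \<open>(\<sigma>, \<sigma>)\<close>, \<open>(-\<sigma>, -\<sigma>)\<close> and \<open>(\<sigma>, -\<sigma>)\<close>, in this order. Contractions in the reverse order are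
  those for \<open>1 / D\<close> in place of \<open>D\<close>.\<close>

lemma comm_current_charge:
  assumes params: "sign_parameters q d \<sigma> Q D" "sign_parameters q d \<sigma> Q (1 / D)"
    and u: "charge c u"
  shows "comm (current l \<sigma> Q D (D / Q) m) (current l \<sigma> Q D (1 / (D * Q)) n) u = 0"
proof -
  interpret P: sign_parameters q d \<sigma> Q D by fact
  interpret N: sign_parameters q d \<sigma> Q "1 / D" by fact
  define \<xi> \<eta> where "\<xi> = D / Q" and "\<eta> = 1 / (D * Q)"
  note QD = P.QD_nz
  have rev: "1 / D / Q = \<eta>" "1 / (1 / D * Q) = \<xi>" using QD by (auto simp: \<xi>_def \<eta>_def)
  note P_fold = \<xi>_def[symmetric] \<eta>_def[symmetric]
  have nz: "q \<noteq> 0" "\<xi> \<noteq> 0" "\<eta> \<noteq> 0" using QD P.nz by (auto simp: \<xi>_def \<eta>_def)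
  have s: "is_sign \<sigma>" "is_sign (- \<sigma>)" using P.\<sigma> by auto
  obtain M where M: "annihilated_above M u" using annihilated_above_exists by blast
  note u = u M
  have \<sigma>2: "\<sigma> * (\<sigma> - - \<sigma>) = 2" "- \<sigma> * (\<sigma> - - \<sigma>) = -2" "(\<sigma> - - \<sigma>) * (\<sigma> - - \<sigma>) = 4"
    using P.\<sigma> by auto
  let ?V = "vpair l"
  \<comment> \<open>A contraction equal to 1 is the case \<open>a = b\<close> of a Moebius function, and the multiple of the delta series is 0.\<close>
  have neutral: "comm (?V s s \<xi> m') (?V s' s' \<eta> n') u = 0"
    if "s = \<sigma> \<or> s = - \<sigma>" "s' = \<sigma> \<or> s' = - \<sigma>" for s s' m' n'
  proof -
    define a b where "a = \<sigma> * s" and "b = \<sigma> * s'"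
    then have ab: "s = \<sigma> * a" "s' = \<sigma> * b" "is_sign a" "is_sign b"
      using that P.\<sigma> by auto
    have "is_sign s" "is_sign s'" using that s by auto
    from comm_vpair_delta[OF this(1,1,2,2) nz zero_neq_one[symmetric]
        P.contraction_neutral[OF ab(3,4), unfolded P_fold, folded ab(1,2)]
        N.contraction_neutral[OF ab(4,3), unfolded rev, folded ab(1,2)] _ _ u, where \<Delta> = 0]
    show ?thesis by (simp add: moebius_coeff_def)
  qed
  have quartic: "comm (?V \<sigma> (- \<sigma>) \<xi> m') (?V \<sigma> (- \<sigma>) \<eta> n') u = 0" for m' n'
  proof (rule comm_vpair_polynomial[OF s s nz
      P.contraction_pm_pm[unfolded P_fold] N.contraction_pm_pm[unfolded rev] \<sigma>2(3) _ _ u])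
    show "\<xi> powi (\<sigma> * (\<sigma> - - \<sigma>)) * quartic_coeff (Q * Q) (Q * Q / (D * D)) (1 / (Q * Q)) (1 / (Q * Q * D * D)) j
      = \<eta> powi (\<sigma> * (\<sigma> - - \<sigma>)) * quartic_coeff (Q * Q) (Q * Q / (1 / D * (1 / D))) (1 / (Q * Q))
          (1 / (Q * Q * (1 / D) * (1 / D))) (4 - j)" for j
    proof -
      consider "j = 0" | "j = 1" | "j = 2" | "j = 3" | "j = 4" | "j < 0 \<or> j > 4" by linarith
      then show ?thesis
        unfolding \<sigma>2 using QD
        by cases (auto simp: quartic_coeff_def \<xi>_def \<eta>_def power2_eq_square field_simps)
    qed
  qed (simp add: quartic_coeff_def)
  \<comment> \<open>The delta series at \<open>w = z\<close>.\<close>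
  have c13: "comm (?V \<sigma> \<sigma> \<xi> m') (?V \<sigma> (- \<sigma>) \<eta> n') u =
    (\<xi> powi (\<sigma> * c) * \<eta> powi (\<sigma> * c) * (\<xi> * \<xi> - 1)) *s twist l \<sigma> \<sigma> (twist l \<sigma> (- \<sigma>)
      (vop M (add_coeffs (pair_coeffs q \<sigma> \<sigma> \<xi>) (dilate 1 (pair_coeffs q \<sigma> (- \<sigma>) \<eta>)))
         (m' + n' - 2 * \<sigma> * c) u))" for m' n'
  proof -
    have "\<xi> powi (\<sigma> * (\<sigma> - - \<sigma>)) * moebius_coeff (Q * Q / (D * D)) 1 j
        - \<eta> powi (\<sigma> * (\<sigma> - \<sigma>)) * moebius_coeff (1 / (Q * Q * (1 / D) * (1 / D))) 1 (- j) = (\<xi> * \<xi> - 1) * 1 powi (- j)" for j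
      using QD by (intro moebius_delta; simp only: \<sigma>2; simp add: \<xi>_def power2_eq_square; simp add: field_simps)
    from comm_vpair_delta[OF s(1,1,1,2) nz zero_neq_one[symmetric]
        P.contraction_pp_pm[unfolded P_fold] N.contraction_pm_pp[unfolded rev] _ this u]
    show ?thesis by simp
  qed
  have c31: "comm (?V \<sigma> (- \<sigma>) \<xi> m') (?V \<sigma> \<sigma> \<eta> n') u =
    (\<xi> powi (\<sigma> * c) * \<eta> powi (\<sigma> * c) * (1 - \<eta> * \<eta>)) *s twist l \<sigma> (- \<sigma>) (twist l \<sigma> \<sigma>
      (vop M (add_coeffs (pair_coeffs q \<sigma> (- \<sigma>) \<xi>) (dilate 1 (pair_coeffs q \<sigma> \<sigma> \<eta>)))
         (m' + n' - 2 * \<sigma> * c) u))" for m' n'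
  proof -
    have "\<xi> powi (\<sigma> * (\<sigma> - \<sigma>)) * moebius_coeff (1 / (Q * Q * D * D)) 1 j
        - \<eta> powi (\<sigma> * (\<sigma> - - \<sigma>)) * moebius_coeff (Q * Q / (1 / D * (1 / D))) 1 (- j) = (1 - \<eta> * \<eta>) * 1 powi (- j)" for j
      using QD by (intro moebius_delta; simp only: \<sigma>2; simp add: \<eta>_def power2_eq_square; simp add: field_simps)
    from comm_vpair_delta[OF s(1,2,1,1) nz zero_neq_one[symmetric]
        P.contraction_pm_pp[unfolded P_fold] N.contraction_pp_pm[unfolded rev] _ this u]
    show ?thesis by simp
  qed
  have DD: "D * D \<noteq> 0" using QD by simp
  \<comment> \<open>The delta series at \<open>w = D\<^sup>2 z\<close>.\<close>
  have c23: "comm (?V (- \<sigma>) (- \<sigma>) \<xi> m') (?V \<sigma> (- \<sigma>) \<eta> n') u =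
    (\<xi> powi (- \<sigma> * c) * \<eta> powi (\<sigma> * c) * (1 / (\<xi> * \<xi>) - 1) * (D * D) powi (2 * \<sigma> * c - n')) *s
      twist l (- \<sigma>) (- \<sigma>) (twist l \<sigma> (- \<sigma>)
      (vop M (add_coeffs (pair_coeffs q (- \<sigma>) (- \<sigma>) \<xi>) (dilate (D * D) (pair_coeffs q \<sigma> (- \<sigma>) \<eta>)))
         (m' + n' - 2 * \<sigma> * c) u))" for m' n'
  proof -
    have "\<xi> powi (- \<sigma> * (\<sigma> - - \<sigma>)) * moebius_coeff (1 / (Q * Q)) (1 / (D * D)) j
        - \<eta> powi (\<sigma> * (- \<sigma> - - \<sigma>)) * moebius_coeff (Q * Q) (1 / (1 / D * (1 / D))) (- j)
        = (1 / (\<xi> * \<xi>) - 1) * (1 / (1 / D * (1 / D))) powi (- j)" for j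
      using QD
      by (intro moebius_delta; simp only: \<sigma>2; simp add: \<xi>_def power2_eq_square power_int_minus; simp add: field_simps)
    then have "\<xi> powi (- \<sigma> * (\<sigma> - - \<sigma>)) * moebius_coeff (1 / (Q * Q)) (1 / (D * D)) j
        - \<eta> powi (\<sigma> * (- \<sigma> - - \<sigma>)) * moebius_coeff (Q * Q) (1 / (1 / D * (1 / D))) (- j)
        = (1 / (\<xi> * \<xi>) - 1) * (D * D) powi (- j)" for j
      by simp
    from comm_vpair_delta[OF s(2,2,1,2) nz DD
        P.contraction_mm_pm[unfolded P_fold] N.contraction_pm_mm[unfolded rev] _ this u]
    show ?thesis by simp
  qed
  have c32: "comm (?V \<sigma> (- \<sigma>) \<xi> m') (?V (- \<sigma>) (- \<sigma>) \<eta> n') u =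
    (\<xi> powi (\<sigma> * c) * \<eta> powi (- \<sigma> * c) * (1 - 1 / (\<eta> * \<eta>)) * (D * D) powi (- n')) *s
      twist l \<sigma> (- \<sigma>) (twist l (- \<sigma>) (- \<sigma>)
      (vop M (add_coeffs (pair_coeffs q \<sigma> (- \<sigma>) \<xi>) (dilate (D * D) (pair_coeffs q (- \<sigma>) (- \<sigma>) \<eta>)))
         (m' + n' - 2 * \<sigma> * c) u))" for m' n'
  proof -
    have "\<xi> powi (\<sigma> * (- \<sigma> - - \<sigma>)) * moebius_coeff (Q * Q) (1 / (D * D)) j
        - \<eta> powi (- \<sigma> * (\<sigma> - - \<sigma>)) * moebius_coeff (1 / (Q * Q)) (1 / (1 / D * (1 / D))) (- j)
        = (1 - 1 / (\<eta> * \<eta>)) * (1 / (1 / D * (1 / D))) powi (- j)" for j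
      using QD
      by (intro moebius_delta; simp only: \<sigma>2; simp add: \<eta>_def power2_eq_square power_int_minus; simp add: field_simps)
    then have "\<xi> powi (\<sigma> * (- \<sigma> - - \<sigma>)) * moebius_coeff (Q * Q) (1 / (D * D)) j
        - \<eta> powi (- \<sigma> * (\<sigma> - - \<sigma>)) * moebius_coeff (1 / (Q * Q)) (1 / (1 / D * (1 / D))) (- j)
        = (1 - 1 / (\<eta> * \<eta>)) * (D * D) powi (- j)" for j
      by simp
    from comm_vpair_delta[OF s(1,2,2,2) nz DD
        P.contraction_pm_mm[unfolded P_fold] N.contraction_mm_pm[unfolded rev] _ this u]
    show ?thesis by simp
  qed
  \<comment> \<open>The coefficients of the third summand at \<open>\<xi>\<close> and at \<open>\<eta>\<close>.\<close>
  define a3 where "a3 = Q * (1 - \<xi> * \<xi>) * (1 - \<eta> * \<xi>)"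
  define b3 where "b3 = Q * (1 - \<xi> * \<eta>) * (1 - \<eta> * \<eta>)"
  have sum13: "(Q * b3) *s comm (?V \<sigma> \<sigma> \<xi> m) (?V \<sigma> (- \<sigma>) \<eta> (n - 2)) u
      + (a3 * Q) *s comm (?V \<sigma> (- \<sigma>) \<xi> (m - 2)) (?V \<sigma> \<sigma> \<eta> n) u = 0"
  proof -
    define k where "k = \<xi> powi (\<sigma> * c) * \<eta> powi (\<sigma> * c)"
    have "Q * b3 * (k * (\<xi> * \<xi> - 1)) + a3 * Q * (k * (1 - \<eta> * \<eta>)) = 0"
      by (simp add: a3_def b3_def algebra_simps)
    then show ?thesis
      unfolding c13 c31 twist_commute[of l \<sigma> "- \<sigma>" \<sigma> \<sigma>] fused_coeffs_swap_second[of q \<sigma> "- \<sigma>"]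
      by (simp add: k_def algebra_simps flip: scale_left_distrib)
  qed
  have sum23: "(inverse Q * b3) *s comm (?V (- \<sigma>) (- \<sigma>) \<xi> m) (?V \<sigma> (- \<sigma>) \<eta> (n - 2)) u
      + (a3 * inverse Q) *s comm (?V \<sigma> (- \<sigma>) \<xi> (m - 2)) (?V (- \<sigma>) (- \<sigma>) \<eta> n) u = 0"
  proof -
    \<comment> \<open>This relation makes the arguments of both \<open>\<Lambda>\<^sub>1\<close> equal at \<open>w = D\<^sup>2 z\<close>.\<close>
    have \<xi>\<eta>: "\<xi> = D * D * \<eta>" using QD by (simp add: \<xi>_def \<eta>_def)
    define k where "k = (D * D) powi (\<sigma> * c - n)"
    have k1: "\<xi> powi (- \<sigma> * c) * \<eta> powi (\<sigma> * c) * (D * D) powi (2 * \<sigma> * c - (n - 2)) = D * D * (D * D) * k"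
    proof -
      have "\<xi> powi (- \<sigma> * c) * \<eta> powi (\<sigma> * c) = (D * D) powi (- \<sigma> * c)"
        unfolding \<xi>\<eta> power_int_mult_distrib using nz by (simp add: power_int_minus)
      then have "\<xi> powi (- \<sigma> * c) * \<eta> powi (\<sigma> * c) * (D * D) powi (2 * \<sigma> * c - (n - 2))
          = (D * D) powi (- \<sigma> * c + (2 * \<sigma> * c - (n - 2)))"
        by (simp only:) (rule power_int_add[symmetric], simp add: QD)
      also have "- \<sigma> * c + (2 * \<sigma> * c - (n - 2)) = 2 + (\<sigma> * c - n)" by simp
      also have "(D * D) powi (2 + (\<sigma> * c - n)) = D * D * (D * D) * k"
        unfolding k_def by (subst power_int_add) (use DD in \<open>simp_all add: power2_eq_square\<close>)
      finally show ?thesis .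
    qed
    have k2: "\<xi> powi (\<sigma> * c) * \<eta> powi (- \<sigma> * c) * (D * D) powi (- n) = k"
    proof -
      have "\<xi> powi (\<sigma> * c) * \<eta> powi (- \<sigma> * c) = (D * D) powi (\<sigma> * c)"
        unfolding \<xi>\<eta> power_int_mult_distrib using nz by (simp add: power_int_minus)
      then show ?thesis using DD by (simp add: k_def power_int_diff power_int_minus divide_inverse)
    qed
    have "b3 * (D * D * (D * D) * k * (1 / (\<xi> * \<xi>) - 1)) + a3 * (k * (1 - 1 / (\<eta> * \<eta>))) = 0"
      unfolding a3_def b3_def \<xi>_def \<eta>_def using QD by (simp add: field_simps)
    moreover have swap: "x * y * e * z = (x * y * z) * e" for x y e z :: complex by simp
    ultimately have coeff: "b3 * (\<xi> powi (- \<sigma> * c) * \<eta> powi (\<sigma> * c) * (1 / (\<xi> * \<xi>) - 1) * (D * D) powi (2 * \<sigma> * c - (n - 2)))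
        + a3 * (\<xi> powi (\<sigma> * c) * \<eta> powi (- \<sigma> * c) * (1 - 1 / (\<eta> * \<eta>)) * (D * D) powi (- n)) = 0"
      by (simp only: swap[of _ _ "1 / (\<xi> * \<xi>) - 1"] swap[of _ _ "1 - 1 / (\<eta> * \<eta>)"] k1 k2)
    define W where "W = twist l (- \<sigma>) (- \<sigma>) (twist l \<sigma> (- \<sigma>)
      (vop M (add_coeffs (pair_coeffs q (- \<sigma>) (- \<sigma>) \<xi>) (dilate (D * D) (pair_coeffs q \<sigma> (- \<sigma>) \<eta>)))
         (m + (n - 2) - 2 * \<sigma> * c) u))"
    have W: "W = twist l \<sigma> (- \<sigma>) (twist l (- \<sigma>) (- \<sigma>)
      (vop M (add_coeffs (pair_coeffs q \<sigma> (- \<sigma>) \<xi>) (dilate (D * D) (pair_coeffs q (- \<sigma>) (- \<sigma>) \<eta>)))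
         (m - 2 + n - 2 * \<sigma> * c) u))"
      unfolding W_def twist_commute[of l \<sigma> "- \<sigma>" "- \<sigma>" "- \<sigma>"]
        fused_coeffs_swap_first[OF \<xi>\<eta>, of q \<sigma> "- \<sigma>" "- \<sigma>" "- \<sigma>"]
      by (simp add: algebra_simps)
    have "(inverse Q * b3) *s x *s W + (a3 * inverse Q) *s y *s W = inverse Q *s (b3 * x + a3 * y) *s W" for x y
      by (simp add: algebra_simps scale_left_distrib)
    then show ?thesis unfolding c23 c32 W_def[symmetric] W[symmetric] by (simp only: coeff) simp
  qed
  have "current l \<sigma> Q D \<xi> m = (\<lambda>v. Q *s ?V \<sigma> \<sigma> \<xi> m v + inverse Q *s ?V (- \<sigma>) (- \<sigma>) \<xi> m v
         + a3 *s ?V \<sigma> (- \<sigma>) \<xi> (m - 2) v)"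
    and "current l \<sigma> Q D \<eta> n = (\<lambda>v. Q *s ?V \<sigma> \<sigma> \<eta> n v + inverse Q *s ?V (- \<sigma>) (- \<sigma>) \<eta> n v
         + b3 *s ?V \<sigma> (- \<sigma>) \<eta> (n - 2) v)"
    by (simp_all add: fun_eq_iff current_def a3_def b3_def \<xi>_def \<eta>_def)
  then have "comm (current l \<sigma> Q D \<xi> m) (current l \<sigma> Q D \<eta> n) u = 0"
    using s nz by (simp add: comm_combination lin_vpair neutral quartic sum13 sum23)
  then show ?thesis by (simp add: \<xi>_def \<eta>_def)
qed

lemma comm_current:
  assumes params: "sign_parameters q d \<sigma> Q D" "sign_parameters q d \<sigma> Q (1 / D)"
  shows "comm (current l \<sigma> Q D (D / Q) m) (current l \<sigma> Q D (1 / (D * Q)) n) v = 0"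
proof -
  interpret P: sign_parameters q d \<sigma> Q D by fact
  have s: "is_sign \<sigma>" "is_sign (- \<sigma>)" using P.\<sigma> by auto
  have cur: "lin (current l \<sigma> Q D \<xi> m)" for \<xi> m
  proof -
    show ?thesis unfolding current_def[abs_def] using s P.nz
      by (intro lin_comb lin_scaled lin_vpair) auto
  qed
  have "lin (comm (current l \<sigma> Q D (D / Q) m) (current l \<sigma> Q D (1 / (D * Q)) n))"
    unfolding lin_def comm_def using cur
    by (simp add: lin_add lin_scale scale_right_diff_distrib)
  from eq_on_charge[OF this lin_0] show ?thesis using comm_current_charge[OF params] by simp
qed

lemma vertex_signs: "vertex q l H 1 = Lambda_plus q l H" "vertex q l H (-1) = Lambda_minus q l H"
  by (auto simp: vertex_def fun_eq_iff)

lemma Tcur_eq: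
  "Tcur q d l H \<xi> m v = q *s vpair l 1 1 \<xi> m v + inverse q *s vpair l (-1) (-1) \<xi> m v
      + (q * (1 - q1 q d * \<xi>) * (1 - q3 q d * \<xi>)) *s vpair l 1 (-1) \<xi> (m - 2) v
      + (inverse q * (1 - inverse (q1 q d) * \<xi>) * (1 - inverse (q3 q d) * \<xi>)) *s vpair l (-1) 1 \<xi> (m - 2) v"
  by (simp add: Tcur_def Let_def vpair_def vertex_signs)

text \<open>At \<open>q\<^sub>1\<close> and \<open>q\<^sub>3\<close> the coefficient of the fourth summand of \<open>T\<close> vanishes, at their inverses that of
  the third.\<close>

lemma Tcur_q:
  assumes "q \<noteq> 0" "d \<noteq> 0" "\<xi> = q1 q d \<or> \<xi> = q3 q d"
  shows "Tcur q d l H \<xi> = current l 1 q d \<xi>"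
    and "Tcur q d l H (inverse \<xi>) = current l (-1) (inverse q) (inverse d) (inverse \<xi>)"
proof -
  have par: "q1 q d = d / q" "q3 q d = 1 / (d * q)"
      "inverse (q1 q d) = inverse d / inverse q" "inverse (q3 q d) = 1 / (inverse d * inverse q)"
    using assms(1,2) by (auto simp: q1_def q3_def field_simps)
  have "q1 q d \<noteq> 0" "q3 q d \<noteq> 0" using assms(1,2) by (auto simp: q1_def q3_def)
  then have "c * (1 - inverse (q1 q d) * \<xi>) * (1 - inverse (q3 q d) * \<xi>) = 0"
    and "c * (1 - q1 q d * inverse \<xi>) * (1 - q3 q d * inverse \<xi>) = 0" for c
    using assms(3) by auto
  then show "Tcur q d l H \<xi> = current l 1 q d \<xi>"
    and "Tcur q d l H (inverse \<xi>) = current l (-1) (inverse q) (inverse d) (inverse \<xi>)"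
    by (simp_all only: fun_eq_iff Tcur_eq current_def scale_zero_left add_0_right inverse_inverse_eq
          minus_minus par(1,2)[symmetric] par(3,4)[symmetric]) (simp_all add: algebra_simps)
qed

end

text \<open>If \<open>q\<^bsup>2\<sigma>n\<^esup> = -1\<close>, then \<open>q\<^bsup>4\<sigma>n\<^esup> = 1\<close>, against genericity.\<close>

lemma generic_sign_parameters:
  assumes "generic q d" "is_sign \<sigma>"
  shows "sign_parameters q d \<sigma> (q powi \<sigma>) (d powi \<sigma>)"
    and "sign_parameters q d \<sigma> (q powi \<sigma>) (1 / (d powi \<sigma>))"
proof -
  have nz: "q \<noteq> 0" "d \<noteq> 0" and gen: "\<And>n m :: int. (n, m) \<noteq> (0, 0) \<Longrightarrow> q powi n * d powi m \<noteq> 1"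
    using assms by (auto simp: generic_def)
  have "(q powi \<sigma>) ^ n * (q powi \<sigma>) ^ n \<noteq> -1" if "n > 0" for n
  proof
    assume "(q powi \<sigma>) ^ n * (q powi \<sigma>) ^ n = -1"
    then have "((q powi \<sigma>) ^ n * (q powi \<sigma>) ^ n) * ((q powi \<sigma>) ^ n * (q powi \<sigma>) ^ n) = 1" by simp
    then have "q powi (\<sigma> * int (n + n + (n + n))) = 1"
      unfolding power_int_mult power_int_of_nat by (simp add: mult.assoc flip: power_add)
    then show False using gen[of "\<sigma> * int (n + n + (n + n))" 0] that assms(2) by auto
  qed
  with nz assms(2) show "sign_parameters q d \<sigma> (q powi \<sigma>) (d powi \<sigma>)"
    and "sign_parameters q d \<sigma> (q powi \<sigma>) (1 / (d powi \<sigma>))"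
    by (auto simp: sign_parameters_def inverse_eq_divide)
qed

theorem theorem5p4:
  fixes q d l1 l3 :: complex and H :: "'v::ab_group_add heis_ops"
  assumes "generic q d"
    and "exp l1 = q1 q d" and "exp l3 = q3 q d"
    and "heisenberg_module q d (- l3 / l1) H"
  shows "oseries_comm (Tcur q d l1 H (q1 q d)) (Tcur q d l1 H (q3 q d)) = (\<lambda>m n v. 0) \<and>
         oseries_comm (Tcur q d l1 H (inverse (q1 q d))) (Tcur q d l1 H (inverse (q3 q d)))
           = (\<lambda>m n v. 0)"
proof -
  interpret heisenberg_module q d "- l3 / l1" H by fact
  have nz: "q \<noteq> 0" "d \<noteq> 0" using assms(1) by (auto simp: generic_def)
  have "q1 q d = d / q" "q3 q d = 1 / (d * q)" "inverse (q1 q d) = inverse d / inverse q"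
    "inverse (q3 q d) = 1 / (inverse d * inverse q)"
    using nz by (auto simp: q1_def q3_def field_simps)
  note par = this
  have "sign_parameters q d 1 q d" "sign_parameters q d 1 q (1 / d)"
    using generic_sign_parameters[OF assms(1), of 1] by simp_all
  from comm_current[OF this, of l1]
  have plus: "comm (current l1 1 q d (q1 q d) m) (current l1 1 q d (q3 q d) n) v = 0" for m n v
    unfolding par .
  have "sign_parameters q d (-1) (inverse q) (inverse d)" "sign_parameters q d (-1) (inverse q) (1 / inverse d)"
    using generic_sign_parameters[OF assms(1), of "-1"] by (simp_all add: power_int_minus)
  from comm_current[OF this, of l1]
  have minus: "comm (current l1 (-1) (inverse q) (inverse d) (inverse (q1 q d)) m)
      (current l1 (-1) (inverse q) (inverse d) (inverse (q3 q d)) n) v = 0" for m n v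
    unfolding par(3,4) .
  show ?thesis
    unfolding oseries_comm_def Tcur_q[OF nz disjI1[OF refl]] Tcur_q[OF nz disjI2[OF refl]]
    using plus minus by (simp add: fun_eq_iff)
qed

end
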